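(* Let $K$ be a number field of degree $k$, let $B$ be a $\mathbb{Q}$-vector space basis of $K$, let $n\ge 1$ and $d\ge 0$ be integers, and let $\psi:\mathbb{R}^{kn}\to\mathbb{C}$ be a smooth, compactly supported function. Then there is a constant $C=C_{K,B,n,d,\psi}$ such that for every nonzero polynomial $f$ in $n$ variables of degree at most $d$ with coefficients in $(\mathbb{R}\otimes_{\mathbb{Q}}K)_B$, and every subset $S\subset\Sigma$ with the property that a strictly complex embedding $\tau$ lies in $S$ if and only if $\overline{\tau}\in S$, $$\left|I_{K,B,\psi}(f)\right|\le C\, H_{f,K,B,S,\psi}^{-1},$$ where the right side is interpreted as $\infty$ if $H_{f,K,B,S,\psi}=0$.
   Context: Let $K$ be an algebraic number field of degree $k=[K:\mathbb{Q}]$ with $\mathbb{Q}$-basis $B=\{\omega_1,\dots,\omega_k\}$. For $q\in K$ let $A_{K,B}(q)$ be the $k\times k$ rational matrix of multiplication by $q$ with respect to $B$. The map $(q_1,\dots,q_k)\mapsto A_{K,B}(q_1\omega_1+\dots+q_k\omega_k)$ extends $\mathbb{R}$-linearly (by continuity) to a map $A^*:\mathbb{R}^k\to M_{k\times k}(\mathbb{R})$, whose image is a commutative $\mathbb{R}$-algebra denoted $(\mathbb{R}\otimes_{\mathbb{Q}}K)_B$. Let $\Sigma$ be the set of the $k$ field embeddings $\sigma:K\to\mathbb{C}$; an embedding is real if its image lies in $\mathbb{R}$ and strictly complex otherwise, and $\overline{\sigma}$ denotes the complex-conjugate embedding. Each $\sigma$ extends by continuity to a ring homomorphism $\sigma^*:(\mathbb{R}\otimes_{\mathbb{Q}}K)_B\to\mathbb{C}$,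 and $\sigma^{**}:=\sigma^*\circ A^*:\mathbb{R}^k\to\mathbb{C}$, i.e. $\sigma^{**}(x_1,\dots,x_k)=\sum_j x_j\sigma(\omega_j)$. Let $\mathrm{tr}^*$ be the matrix trace on $(\mathbb{R}\otimes_{\mathbb{Q}}K)_B$ (equal to $\sum_{\sigma\in\Sigma}\sigma^*$). Write points of $\mathbb{R}^{kn}$ as $\vec{\mathbf x}=(\mathbf x_1,\dots,\mathbf x_n)$ with $\mathbf x_l\in\mathbb{R}^k$, and $\vec\sigma(\vec{\mathbf x})=(\sigma^{**}(\mathbf x_1),\dots,\sigma^{**}(\mathbf x_n))\in\mathbb{C}^n$. For a polynomial $f$ in $n$ variables with coefficients in $(\mathbb{R}\otimes_{\mathbb{Q}}K)_B$, put $\phi_f(\vec{\mathbf x})=\mathrm{tr}^*\big(f(A^*(\mathbf x_1),\dots,A^*(\mathbf x_n))\big)$ (a real polynomial on $\mathbb{R}^{kn}$), and let $P_{f,\sigma}$ be the complex polynomial obtained by applying $\sigma^*$ to each coefficient of $f$. Define $I_{K,B,\psi}(f)=\int_{\mathbb{R}^{kn}}e^{2\pi i\phi_f(\vec{\mathbf x})}\psi(\vec{\mathbf x})\,d\vec{\mathbf x}$. For $\sigma\in\Sigma$ the pointwise $H$-functional is $H_{f,K,B,\sigma}(\vec{\mathbf x})=\max_{|\alpha|\ge1}\big|\tfrac{1}{\alpha!}\partial^\alpha P_{f,\sigma}(\vec\sigma(\vec{\mathbf x}))\big|^{1/|\alpha|}$ (multi-indices $\alpha\in\mathbb{N}^n$,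 complex derivatives of $P_{f,\sigma}$), the uniform one is $H_{f,K,B,\sigma,\psi}=\inf_{\vec{\mathbf x}\in\operatorname{supp}\psi}H_{f,K,B,\sigma}(\vec{\mathbf x})$, and for $S\subset\Sigma$ closed under conjugation $H_{f,K,B,S,\psi}=\prod_{\sigma\in S}H_{f,K,B,\sigma,\psi}$ (empty product $=1$). *)

theory Defs
  imports "HOL-Analysis.Analysis" "HOL-Library.Poly_Mapping"
begin

section \<open>Number fields with a chosen rational basis\<close>

text \<open>
  A number field \<open>K\<close> is a type \<open>'a\<close> of characteristic zero that has a finite basis over the
  rationals. The basis is indexed by a finite type \<open>'k\<close>, so \<open>[K : Q] = CARD('k)\<close>.
\<close>

abbreviation rat_scale :: "rat \<Rightarrow> 'a::field_char_0 \<Rightarrow> 'a"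
  where "rat_scale \<equiv> \<lambda>r x. of_rat r * x"

definition number_field_basis :: "('k::finite \<Rightarrow> 'a::field_char_0) \<Rightarrow> bool"
  where "number_field_basis \<omega> \<longleftrightarrow>
    inj \<omega> \<and> finite_dimensional_vector_space rat_scale (range \<omega>)"

definition coord :: "('k::finite \<Rightarrow> 'a::field_char_0) \<Rightarrow> 'a \<Rightarrow> 'k \<Rightarrow> rat"
  where "coord \<omega> q i = module.representation rat_scale (range \<omega>) q (\<omega> i)"

text \<open>Column \<open>j\<close> consists of the coordinates of \<open>q * \<omega> j\<close>.\<close>

definition mult_matrix :: "('k::finite \<Rightarrow> 'a::field_char_0) \<Rightarrow> 'a \<Rightarrow> real^'k^'k"
  where "mult_matrix \<omega> q = (\<chi> i j. of_rat (coord \<omega> (q * \<omega> j) i))"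

definition A_star :: "('k::finite \<Rightarrow> 'a::field_char_0) \<Rightarrow> real^'k \<Rightarrow> real^'k^'k"
  where "A_star \<omega> x = (\<Sum>j\<in>UNIV. (x $ j) *\<^sub>R mult_matrix \<omega> (\<omega> j))"

definition real_algebra :: "('k::finite \<Rightarrow> 'a::field_char_0) \<Rightarrow> (real^'k^'k) set"
  where "real_algebra \<omega> = range (A_star \<omega>)"

definition embeddings :: "('a::field_char_0 \<Rightarrow> complex) set"
  where "embeddings = {\<sigma>. \<sigma> 1 = 1 \<and> (\<forall>x y. \<sigma> (x + y) = \<sigma> x + \<sigma> y) \<and> (\<forall>x y. \<sigma> (x * y) = \<sigma> x * \<sigma> y)}"

definition strictly_complex :: "('a::field_char_0 \<Rightarrow> complex) \<Rightarrow> bool"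
  where "strictly_complex \<sigma> \<longleftrightarrow> \<not> range \<sigma> \<subseteq> \<real>"

definition emb_coord :: "('k::finite \<Rightarrow> 'a::field_char_0) \<Rightarrow> ('a \<Rightarrow> complex) \<Rightarrow> real^'k \<Rightarrow> complex"
  where "emb_coord \<omega> \<sigma> x = (\<Sum>j\<in>UNIV. of_real (x $ j) * \<sigma> (\<omega> j))"

text \<open>
  The continuous extension of \<open>\<sigma>\<close> to the real algebra. It is only meaningful on
  \<open>real_algebra \<omega>\<close>; there \<open>A_star \<omega>\<close> is invertible (\<open>inj_A_star\<close>), and the map extends
  \<open>\<sigma>\<close> (\<open>emb_star_mult_matrix\<close>).
\<close>

definition emb_star :: "('k::finite \<Rightarrow> 'a::field_char_0) \<Rightarrow> ('a \<Rightarrow> complex) \<Rightarrow> real^'k^'k \<Rightarrow> complex"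
  where "emb_star \<omega> \<sigma> M = emb_coord \<omega> \<sigma> (inv (A_star \<omega>) M)"

lemma coord_sum:
  assumes "number_field_basis \<omega>"
  shows "(\<Sum>i\<in>UNIV. of_rat (coord \<omega> q i) * \<omega> i) = q"
proof -
  interpret V: finite_dimensional_vector_space rat_scale "range \<omega>"
    using assms by (simp add: number_field_basis_def)
  have "(\<Sum>b\<in>range \<omega>. of_rat (V.representation (range \<omega>) q b) * b) = q"
    by (rule V.sum_representation_eq[OF V.independent_Basis _ V.finite_Basis order_refl])
      (simp add: V.span_Basis)
  then show ?thesis
    using assms by (simp add: sum.reindex number_field_basis_def coord_def)
qed

lemma coord_linear:
  assumes "number_field_basis \<omega>" and "finite I"
  shows "coord \<omega> (\<Sum>l\<in>I. of_rat (c l) * p l) i = (\<Sum>l\<in>I. c l * coord \<omega> (p l) i)"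
proof -
  interpret V: finite_dimensional_vector_space rat_scale "range \<omega>"
    using assms by (simp add: number_field_basis_def)
  show ?thesis
    unfolding coord_def using V.independent_Basis V.span_Basis
    by (simp add: V.representation_sum V.representation_scale)
qed

lemma coord_basis:
  assumes "number_field_basis \<omega>"
  shows "coord \<omega> (\<omega> l) i = (if i = l then 1 else 0)"
proof -
  interpret V: finite_dimensional_vector_space rat_scale "range \<omega>"
    using assms by (simp add: number_field_basis_def)
  show ?thesis
    unfolding coord_def using V.independent_Basis assms
    by (auto simp: V.representation_basis number_field_basis_def inj_eq)
qed

lemma inj_A_star:
  assumes "number_field_basis \<omega>"
  shows "inj (A_star \<omega>)"
proof (rule inj_on_inverseI)
  fix x
  define c where "c = coord \<omega> 1"
  have *: "(\<Sum>j\<in>UNIV. c j * coord \<omega> (\<omega> l * \<omega> j) i) = (if i = l then 1 else 0)" for l i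
  proof -
    have "(\<Sum>j\<in>UNIV. of_rat (c j) * (\<omega> l * \<omega> j)) = \<omega> l * (\<Sum>j\<in>UNIV. of_rat (c j) * \<omega> j)"
      by (simp add: sum_distrib_left mult_ac)
    also have "\<dots> = \<omega> l"
      unfolding c_def by (simp add: coord_sum[OF assms])
    finally show ?thesis
      using coord_linear[OF assms, of UNIV c "\<lambda>j. \<omega> l * \<omega> j" i] by (simp add: coord_basis[OF assms])
  qed
  show "(\<chi> i. \<Sum>j\<in>UNIV. of_rat (c j) * A_star \<omega> x $ i $ j) = x"
  proof (rule vec_eq_iff[THEN iffD2], rule allI)
    fix i
    have "(\<Sum>j\<in>UNIV. of_rat (c j) * A_star \<omega> x $ i $ j) =
        (\<Sum>j\<in>UNIV. \<Sum>l\<in>UNIV. x $ l * of_rat (c j * coord \<omega> (\<omega> l * \<omega> j) i))"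
      by (simp add: A_star_def mult_matrix_def sum_distrib_left of_rat_mult mult_ac)
    also have "\<dots> = (\<Sum>l\<in>UNIV. x $ l * of_rat (\<Sum>j\<in>UNIV. c j * coord \<omega> (\<omega> l * \<omega> j) i))"
      by (subst sum.swap) (simp add: sum_distrib_left of_rat_sum)
    also have "\<dots> = (\<Sum>l\<in>UNIV. if i = l then x $ l else 0)"
      unfolding * by (intro sum.cong) auto
    finally show "(\<chi> i. \<Sum>j\<in>UNIV. of_rat (c j) * A_star \<omega> x $ i $ j) $ i = x $ i"
      by simp
  qed
qed

lemma mult_matrix_eq_A_star:
  assumes "number_field_basis \<omega>"
  shows "mult_matrix \<omega> q = A_star \<omega> (\<chi> j. of_rat (coord \<omega> q j))"
proof -
  have "coord \<omega> (q * \<omega> j) i = (\<Sum>l\<in>UNIV. coord \<omega> q l * coord \<omega> (\<omega> l * \<omega> j) i)" for i j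
  proof -
    have "q * \<omega> j = (\<Sum>l\<in>UNIV. of_rat (coord \<omega> q l) * (\<omega> l * \<omega> j))"
      by (subst (1) coord_sum[OF assms, of q, symmetric]) (simp add: sum_distrib_left sum_distrib_right mult_ac)
    then show ?thesis
      using coord_linear[OF assms, of UNIV "coord \<omega> q" "\<lambda>l. \<omega> l * \<omega> j" i] by simp
  qed
  then show ?thesis
    by (simp add: vec_eq_iff A_star_def mult_matrix_def of_rat_sum of_rat_mult)
qed

lemma embedding_of_rat:
  assumes "\<sigma> \<in> embeddings"
  shows "\<sigma> (of_rat r) = of_rat r"
proof -
  have one: "\<sigma> 1 = 1" and add: "\<sigma> (x + y) = \<sigma> x + \<sigma> y" and mult: "\<sigma> (x * y) = \<sigma> x * \<sigma> y" for x y
    using assms by (auto simp: embeddings_def)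
  have zero: "\<sigma> 0 = 0" using add[of 0 0] by simp
  have nat: "\<sigma> (of_nat n) = of_nat n" for n by (induction n) (simp_all add: zero one add)
  have minus: "\<sigma> (- x) = - \<sigma> x" for x using add[of x "- x"] zero by (simp add: eq_neg_iff_add_eq_0 add.commute)
  have int: "\<sigma> (of_int m) = of_int m" for m by (cases m rule: int_cases2) (simp_all add: nat minus)
  obtain a b where r: "r = Fract a b" "b > 0" by (cases r) auto
  have "of_rat r * of_int b = (of_int a :: 'a)" using r by (simp add: of_rat_rat)
  then have "\<sigma> (of_rat r) * of_int b = of_int a" by (metis mult int)
  then show ?thesis using r by (simp add: of_rat_rat field_simps)
qed

lemma emb_star_mult_matrix:
  assumes "number_field_basis \<omega>" and "\<sigma> \<in> embeddings"
  shows "emb_star \<omega> \<sigma> (mult_matrix \<omega> q) = \<sigma> q"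
proof -
  have add: "\<sigma> (x + y) = \<sigma> x + \<sigma> y" and mult: "\<sigma> (x * y) = \<sigma> x * \<sigma> y" for x y
    using assms by (auto simp: embeddings_def)
  have zero: "\<sigma> 0 = 0" using add[of 0 0] by simp
  have sum: "\<sigma> (\<Sum>i\<in>I. g i) = (\<Sum>i\<in>I. \<sigma> (g i))" for I :: "'a set" and g
    by (induction I rule: infinite_finite_induct) (simp_all add: zero add)
  have real: "complex_of_real (of_rat r) = of_rat r" for r
    by (cases r) (simp add: of_rat_rat)
  have "emb_star \<omega> \<sigma> (mult_matrix \<omega> q) = (\<Sum>j\<in>UNIV. of_rat (coord \<omega> q j) * \<sigma> (\<omega> j))"
    unfolding emb_star_def mult_matrix_eq_A_star[OF assms(1)] inv_f_f[OF inj_A_star[OF assms(1)]]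
    by (simp add: emb_coord_def real)
  also have "\<dots> = \<sigma> (\<Sum>j\<in>UNIV. of_rat (coord \<omega> q j) * \<omega> j)"
    by (simp add: sum mult embedding_of_rat[OF assms(2)])
  finally show ?thesis by (simp add: coord_sum[OF assms(1)])
qed


section \<open>Polynomials in \<open>n\<close> variables\<close>

text \<open>
  The variables are indexed by a finite type \<open>'n\<close>. A polynomial is a finitely supported family of
  coefficients indexed by the multi-indices \<open>'n \<Rightarrow>\<^sub>0 nat\<close>.
\<close>

type_synonym ('n, 'c) mpoly = "('n \<Rightarrow>\<^sub>0 nat) \<Rightarrow>\<^sub>0 'c"

definition mdeg :: "('n::finite \<Rightarrow>\<^sub>0 nat) \<Rightarrow> nat"
  where "mdeg \<alpha> = (\<Sum>i\<in>UNIV. Poly_Mapping.lookup \<alpha> i)"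

definition mfact :: "('n::finite \<Rightarrow>\<^sub>0 nat) \<Rightarrow> nat"
  where "mfact \<alpha> = (\<Prod>i\<in>UNIV. fact (Poly_Mapping.lookup \<alpha> i))"

definition total_degree :: "('n::finite, 'c::zero) mpoly \<Rightarrow> nat"
  where "total_degree f = Max (insert 0 (mdeg ` Poly_Mapping.keys f))"

definition ceval :: "('n::finite, complex) mpoly \<Rightarrow> complex^'n \<Rightarrow> complex"
  where "ceval p z = (\<Sum>\<beta>\<in>Poly_Mapping.keys p. Poly_Mapping.lookup p \<beta> * (\<Prod>i\<in>UNIV. (z $ i) ^ Poly_Mapping.lookup \<beta> i))"

text \<open>
  Evaluation at matrices uses the matrix product \<open>**\<close> (the multiplication \<open>*\<close> of the type
  \<open>real^'k^'k\<close> is entrywise). The folded maps commute when the \<open>X i\<close> commute, which is the case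
  on \<open>real_algebra \<omega>\<close>.
\<close>

definition mat_eval :: "('n::finite, real^'k^'k) mpoly \<Rightarrow> ('n \<Rightarrow> real^'k^'k) \<Rightarrow> real^'k^'k"
  where "mat_eval f X = (\<Sum>\<beta>\<in>Poly_Mapping.keys f.
    Poly_Mapping.lookup f \<beta> ** Finite_Set.fold (\<lambda>i. (**) (X i) ^^ Poly_Mapping.lookup \<beta> i) (mat 1) UNIV)"

text \<open>
  For \<open>Poly_Mapping.lookup \<beta> i = 0\<close> the subtraction truncates, but the coefficient vanishes. The value of \<open>pdiff i p\<close> is the complex partial derivative
  (\<open>has_field_derivative_ceval\<close>).
\<close>

definition pdiff :: "'n::finite \<Rightarrow> ('n, complex) mpoly \<Rightarrow> ('n, complex) mpoly"
  where "pdiff i p = (\<Sum>\<beta>\<in>Poly_Mapping.keys p.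
    Poly_Mapping.single (\<beta> - Poly_Mapping.single i 1) (of_nat (Poly_Mapping.lookup \<beta> i) * Poly_Mapping.lookup p \<beta>))"

lemma ceval_superset:
  assumes "finite T" and "Poly_Mapping.keys p \<subseteq> T"
  shows "ceval p z = (\<Sum>\<beta>\<in>T. Poly_Mapping.lookup p \<beta> * (\<Prod>i\<in>UNIV. (z $ i) ^ Poly_Mapping.lookup \<beta> i))"
  unfolding ceval_def by (rule sum.mono_neutral_left) (use assms in \<open>auto simp: in_keys_iff\<close>)

lemma ceval_add: "ceval (p + q) z = ceval p z + ceval q z"
  by (simp add: ceval_superset[of "Poly_Mapping.keys p \<union> Poly_Mapping.keys q"] keys_add
      lookup_add sum.distrib distrib_right)

lemma ceval_sum: "ceval (\<Sum>x\<in>I. g x) z = (\<Sum>x\<in>I. ceval (g x) z)"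
  by (induction I rule: infinite_finite_induct) (simp_all add: ceval_add, simp_all add: ceval_def)

lemma ceval_single:
  "ceval (Poly_Mapping.single \<beta> c) z = c * (\<Prod>i\<in>UNIV. (z $ i) ^ Poly_Mapping.lookup \<beta> i)"
  by (subst ceval_superset[of "{\<beta>}"]) auto

lemma has_field_derivative_ceval:
  "((\<lambda>t. ceval p (\<chi> j. if j = i then t else z $ j)) has_field_derivative ceval (pdiff i p) z) (at (z $ i))"
proof -
  have prod: "(\<Prod>j\<in>UNIV. g j) = g i * (\<Prod>j\<in>UNIV - {i}. g j)" for g :: "'a \<Rightarrow> complex"
    by (rule prod.remove) auto
  define R where "R \<beta> = (\<Prod>j\<in>UNIV - {i}. (z $ j) ^ Poly_Mapping.lookup \<beta> j)" for \<beta> :: "'a \<Rightarrow>\<^sub>0 nat"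
  have 1: "ceval p (\<chi> j. if j = i then t else z $ j) =
      (\<Sum>\<beta>\<in>Poly_Mapping.keys p. Poly_Mapping.lookup p \<beta> * (t ^ Poly_Mapping.lookup \<beta> i * R \<beta>))" for t
    unfolding ceval_def prod R_def by (intro sum.cong refl arg_cong2[where f = "(*)"] prod.cong) auto
  have 2: "ceval (pdiff i p) z = (\<Sum>\<beta>\<in>Poly_Mapping.keys p. Poly_Mapping.lookup p \<beta> *
      (of_nat (Poly_Mapping.lookup \<beta> i) * (z $ i) ^ (Poly_Mapping.lookup \<beta> i - 1) * R \<beta>))"
    unfolding pdiff_def ceval_sum ceval_single prod R_def
    by (intro sum.cong refl) (simp add: lookup_minus lookup_single mult_ac)
  show ?thesis
    unfolding 1 2 by (auto intro!: derivative_eq_intros simp: mult_ac)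
qed

text \<open>The operators \<open>pdiff i\<close> commute, so the fold does not depend on the order.\<close>

definition mpdiff :: "('n::finite \<Rightarrow>\<^sub>0 nat) \<Rightarrow> ('n, complex) mpoly \<Rightarrow> ('n, complex) mpoly"
  where "mpdiff \<alpha> p = Finite_Set.fold (\<lambda>i. pdiff i ^^ Poly_Mapping.lookup \<alpha> i) p UNIV"


section \<open>Smooth functions\<close>

primrec times_cont_diff :: "nat \<Rightarrow> ('v::euclidean_space \<Rightarrow> 'w::real_normed_vector) \<Rightarrow> bool"
  where
    "times_cont_diff 0 g \<longleftrightarrow> continuous_on UNIV g"
  | "times_cont_diff (Suc m) g \<longleftrightarrow> (\<forall>x. g differentiable (at x)) \<and>
      (\<forall>v. times_cont_diff m (\<lambda>x. frechet_derivative g (at x) v))"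

definition smooth :: "('v::euclidean_space \<Rightarrow> 'w::real_normed_vector) \<Rightarrow> bool"
  where "smooth g \<longleftrightarrow> (\<forall>m. times_cont_diff m g)"

definition supp :: "('v::topological_space \<Rightarrow> complex) \<Rightarrow> 'v set"
  where "supp \<psi> = closure {x. \<psi> x \<noteq> 0}"


section \<open>The oscillatory integral and the \<open>H\<close>-functionals\<close>

definition phase :: "('k::finite \<Rightarrow> 'a::field_char_0) \<Rightarrow> ('n::finite, real^'k^'k) mpoly
    \<Rightarrow> (real^'k)^'n \<Rightarrow> real"
  where "phase \<omega> f x = trace (mat_eval f (\<lambda>l. A_star \<omega> (x $ l)))"

definition osc_integral :: "('k::finite \<Rightarrow> 'a::field_char_0) \<Rightarrow> ((real^'k)^'n::finite \<Rightarrow> complex)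
    \<Rightarrow> ('n, real^'k^'k) mpoly \<Rightarrow> complex"
  where "osc_integral \<omega> \<psi> f =
    (LINT x|lborel. exp (2 * of_real pi * \<i> * of_real (phase \<omega> f x)) * \<psi> x)"

definition emb_poly :: "('k::finite \<Rightarrow> 'a::field_char_0) \<Rightarrow> ('a \<Rightarrow> complex)
    \<Rightarrow> ('n, real^'k^'k) mpoly \<Rightarrow> ('n, complex) mpoly"
  where "emb_poly \<omega> \<sigma> f = Poly_Mapping.map (emb_star \<omega> \<sigma>) f"

definition emb_vec :: "('k::finite \<Rightarrow> 'a::field_char_0) \<Rightarrow> ('a \<Rightarrow> complex)
    \<Rightarrow> (real^'k)^'n::finite \<Rightarrow> complex^'n"
  where "emb_vec \<omega> \<sigma> x = (\<chi> l. emb_star \<omega> \<sigma> (A_star \<omega> (x $ l)))"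

text \<open>
  The maximum is over infinitely many \<open>\<alpha>\<close>, but over a finite set of values: all derivatives of
  order greater than the degree vanish.
\<close>

definition H_point :: "('k::finite \<Rightarrow> 'a::field_char_0) \<Rightarrow> ('n::finite, real^'k^'k) mpoly
    \<Rightarrow> ('a \<Rightarrow> complex) \<Rightarrow> (real^'k)^'n \<Rightarrow> real"
  where "H_point \<omega> f \<sigma> x =
    Max ((\<lambda>\<alpha>. root (mdeg \<alpha>)
            (cmod (1 / of_nat (mfact \<alpha>) * ceval (mpdiff \<alpha> (emb_poly \<omega> \<sigma> f)) (emb_vec \<omega> \<sigma> x))))
         ` {\<alpha>. mdeg \<alpha> \<ge> 1})"

text \<open>
  The infimum is taken in \<open>ennreal\<close>, so that it is \<open>\<infinity>\<close> in the degenerate case \<open>\<psi> = 0\<close> of an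
  empty support.
\<close>

definition H_unif :: "('k::finite \<Rightarrow> 'a::field_char_0) \<Rightarrow> ((real^'k)^'n::finite \<Rightarrow> complex)
    \<Rightarrow> ('n, real^'k^'k) mpoly \<Rightarrow> ('a \<Rightarrow> complex) \<Rightarrow> ennreal"
  where "H_unif \<omega> \<psi> f \<sigma> = (INF x\<in>supp \<psi>. ennreal (H_point \<omega> f \<sigma> x))"

definition H_prod :: "('k::finite \<Rightarrow> 'a::field_char_0) \<Rightarrow> ((real^'k)^'n::finite \<Rightarrow> complex)
    \<Rightarrow> ('n, real^'k^'k) mpoly \<Rightarrow> ('a \<Rightarrow> complex) set \<Rightarrow> ennreal"
  where "H_prod \<omega> \<psi> f S = (\<Prod>\<sigma>\<in>S. H_unif \<omega> \<psi> f \<sigma>)"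

end

theory Submission
  imports Defs "HOL-Computational_Algebra.Fundamental_Theorem_Algebra"
begin

text \<open>
  The embeddings span the rational-linear functionals \<open>K \<rightarrow> \<complex>\<close>, so there are exactly \<open>k\<close> of them, the matrices
  \<open>A_star \<omega> x\<close> are simultaneously diagonal in the basis they form, and the phase is
  \<open>\<Sum>\<^sub>\<sigma> P\<^sub>\<sigma> (\<sigma> x)\<close> in independent variables, one real or complex block for each place (a real embedding or
  a conjugate pair). At each place with lower bound \<open>h\<close> of the \<open>H\<close>-functional one splits the amplitude
  smoothly according to \<open>|\<nabla>P\<^sub>\<sigma>| < h\<close> or not.

  Where \<open>|\<nabla>P\<^sub>\<sigma>| \<ge> h\<close> one integrates by parts, once at a real place, and once with \<open>\<partial>\<close> and once with
  \<open>\<partial>\<close>-bar at a complex place. This leaves weights like \<open>|q'| / (1 + |q|\<^sup>2)\<close> (real) or its square (complex),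
  where \<open>q = \<partial>P\<^sub>\<sigma> / h\<close>, whose integrals over lines in coordinate directions are bounded in terms of the degree only.
  Where \<open>|\<nabla>P\<^sub>\<sigma>| < h\<close> the \<open>H\<close>-functional forces a derivative \<open>Q\<close> of \<open>P\<^sub>\<sigma>\<close> with \<open>|\<partial>\<^sub>iQ| > h |Q|\<close> for some \<open>i\<close>; on every line
  in direction \<open>i\<close> such points lie within \<open>d / h\<close> of a zero of \<open>Q\<close>. So each place contributes \<open>h\<^sup>-\<^sup>1\<close> or
  \<open>h\<^sup>-\<^sup>2\<close>, and averaging over translations in the directions of the places replaces Fubini's theorem in
  adapted coordinates.
\<close>

section \<open>Complex directional derivatives\<close>

text \<open>The constant may depend on the degree and the amplitude but not on \<open>f\<close>, so
  no estimate may see the size of the coefficients. The weights therefore have a geometric meaning: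
  \<open>|q'| / (1 + q^2)\<close> is the variation of \<open>arctan q\<close>, and
  \<open>|q'|^2 / (1 + |q|^2)^2\<close> is the area form of the Riemann sphere pulled back by
  \<open>q\<close>; both are controlled by how often \<open>q\<close> takes a value, hence by the
  degree. Using the holomorphic derivative twice at a complex place would bring in third derivatives
  of the polynomial. With one antiholomorphic derivative they do not occur, since it annihilates
  \<open>q\<close> and \<open>q'\<close>, and the phase, being real, oscillates for both
  derivatives. The amplitude does not factor over the places. Its derivatives are taken along real
  vectors \<open>a\<close>, \<open>b\<close> of the original space whose combination
  \<open>a + \<i> b\<close> is dual to one embedding, and the weight of one place is constant in the
  directions of the others. The derived amplitudes are finite in number and independent of
  \<open>f\<close>, which fixes the constant before \<open>f\<close> appears.\<close>

definition dird :: "'v::real_normed_vector \<Rightarrow> ('v \<Rightarrow> complex) \<Rightarrow> ('v \<Rightarrow> complex) \<Rightarrow> bool"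
  where "dird v f f' \<longleftrightarrow> (\<forall>x. ((\<lambda>t. f (x + t *\<^sub>R v)) has_vector_derivative f' x) (at 0))"

lemma dirdD:
  assumes "dird v f f'"
  shows "((\<lambda>t. f (x + t *\<^sub>R v)) has_vector_derivative f' (x + t0 *\<^sub>R v)) (at t0)"
proof -
  have "((\<lambda>t. f ((x + t0 *\<^sub>R v) + t *\<^sub>R v)) has_vector_derivative f' (x + t0 *\<^sub>R v)) (at (t0 - t0))"
    using assms by (auto simp: dird_def)
  moreover have "((\<lambda>t. t - t0) has_vector_derivative 1) (at t0)"
    by (auto intro!: derivative_eq_intros)
  ultimately have "((\<lambda>t. f ((x + t0 *\<^sub>R v) + (t - t0) *\<^sub>R v)) has_vector_derivative f' (x + t0 *\<^sub>R v)) (at t0)"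
    using vector_diff_chain_at[of "\<lambda>t. t - t0" 1 t0] by (force simp: o_def)
  then show ?thesis by (simp add: algebra_simps)
qed

text \<open>The derivative along the complex direction \<open>a + \<i> b\<close>. The domain stays
  the real space, while complex combinations of real derivatives isolate the coordinate of a single
  complex embedding. On the complex plane with \<open>a = 1\<close> and \<open>b = \<i>\<close> this
  is twice the Cauchy-Riemann operator.\<close>

definition cder :: "'v::real_normed_vector \<Rightarrow> 'v \<Rightarrow> ('v \<Rightarrow> complex) \<Rightarrow> ('v \<Rightarrow> complex) \<Rightarrow> bool"
  where "cder a b f f' \<longleftrightarrow> continuous_on UNIV f \<and>
    (\<exists>fa fb. continuous_on UNIV fa \<and> continuous_on UNIV fb \<and> dird a f fa \<and> dird b f fb \<and>
      f' = (\<lambda>x. fa x + \<i> * fb x))"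

lemma cder_continuous: "cder a b f f' \<Longrightarrow> continuous_on UNIV f" "cder a b f f' \<Longrightarrow> continuous_on UNIV f'"
  by (auto simp: cder_def intro!: continuous_intros)

lemma cderE:
  assumes "cder a b f f'"
  obtains fa fb where "continuous_on UNIV f" "continuous_on UNIV fa" "continuous_on UNIV fb"
    "dird a f fa" "dird b f fb" "f' = (\<lambda>x. fa x + \<i> * fb x)"
  using assms unfolding cder_def by blast

lemma cderI:
  assumes "continuous_on UNIV f" "continuous_on UNIV fa" "continuous_on UNIV fb"
    "dird a f fa" "dird b f fb" "\<And>x. f' x = fa x + \<i> * fb x"
  shows "cder a b f f'"
proof -
  have "f' = (\<lambda>x. fa x + \<i> * fb x)" using assms(6) by auto
  then show ?thesis using assms unfolding cder_def by blast
qed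

lemma cder_cong: "cder a b f f' \<Longrightarrow> (\<And>x. f' x = g x) \<Longrightarrow> cder a b f g"
  by (metis ext)

lemma cder_const: "cder a b (\<lambda>_. c) (\<lambda>_. 0)"
  by (rule cderI[where fa = "\<lambda>_. 0" and fb = "\<lambda>_. 0"]) (auto simp: dird_def)

lemma cder_add:
  assumes "cder a b f f'" "cder a b g g'"
  shows "cder a b (\<lambda>x. f x + g x) (\<lambda>x. f' x + g' x)"
proof -
  obtain fa fb where f: "continuous_on UNIV f" "continuous_on UNIV fa" "continuous_on UNIV fb"
    "dird a f fa" "dird b f fb" "f' = (\<lambda>x. fa x + \<i> * fb x)" using assms(1) by (rule cderE)
  obtain ga gb where g: "continuous_on UNIV g" "continuous_on UNIV ga" "continuous_on UNIV gb"
    "dird a g ga" "dird b g gb" "g' = (\<lambda>x. ga x + \<i> * gb x)" using assms(2) by (rule cderE)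
  show ?thesis
    by (rule cderI[where fa = "\<lambda>x. fa x + ga x" and fb = "\<lambda>x. fb x + gb x"])
      (use f g in \<open>auto simp: dird_def algebra_simps intro!: continuous_intros has_vector_derivative_add\<close>)
qed

lemma cder_mult:
  assumes "cder a b f f'" "cder a b g g'"
  shows "cder a b (\<lambda>x. f x * g x) (\<lambda>x. f x * g' x + f' x * g x)"
proof -
  obtain fa fb where f: "continuous_on UNIV f" "continuous_on UNIV fa" "continuous_on UNIV fb"
    "dird a f fa" "dird b f fb" "f' = (\<lambda>x. fa x + \<i> * fb x)" using assms(1) by (rule cderE)
  obtain ga gb where g: "continuous_on UNIV g" "continuous_on UNIV ga" "continuous_on UNIV gb"
    "dird a g ga" "dird b g gb" "g' = (\<lambda>x. ga x + \<i> * gb x)" using assms(2) by (rule cderE)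
  have *: "dird v (\<lambda>x. f x * g x) (\<lambda>x. f x * ga x + fa x * g x)"
    if "dird v f fa" "dird v g ga" for v fa ga
    unfolding dird_def
  proof
    fix x
    from has_vector_derivative_mult[OF that(1)[unfolded dird_def, rule_format, of x]
        that(2)[unfolded dird_def, rule_format, of x]]
    show "((\<lambda>t. f (x + t *\<^sub>R v) * g (x + t *\<^sub>R v)) has_vector_derivative f x * ga x + fa x * g x) (at 0)"
      by simp
  qed
  show ?thesis
    by (rule cderI[OF _ _ _ *[OF f(4) g(4)] *[OF f(5) g(5)]])
      (use f g in \<open>auto simp: algebra_simps intro!: continuous_intros\<close>)
qed

lemma cder_cmult: "cder a b f f' \<Longrightarrow> cder a b (\<lambda>x. c * f x) (\<lambda>x. c * f' x)"
  by (rule cder_cong[OF cder_mult[OF cder_const]]) auto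

lemma cder_sum:
  assumes "\<And>i. i \<in> I \<Longrightarrow> cder a b (f i) (f' i)"
  shows "cder a b (\<lambda>x. \<Sum>i\<in>I. f i x) (\<lambda>x. \<Sum>i\<in>I. f' i x)"
  using assms by (induction I rule: infinite_finite_induct) (auto intro: cder_const cder_add)

text \<open>Conjugating \<open>fa + \<i> fb\<close> gives \<open>cnj fa - \<i> cnj fb\<close>, so
  the second direction changes sign. Antiholomorphic derivatives are obtained from holomorphic ones
  in this way.\<close>

lemma cder_cnj:
  assumes "cder a b f f'"
  shows "cder a (- b) (\<lambda>x. cnj (f x)) (\<lambda>x. cnj (f' x))"
proof -
  obtain fa fb where f: "continuous_on UNIV f" "continuous_on UNIV fa" "continuous_on UNIV fb"
    "dird a f fa" "dird b f fb" "f' = (\<lambda>x. fa x + \<i> * fb x)" using assms(1) by (rule cderE)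
  have 1: "dird a (\<lambda>x. cnj (f x)) (\<lambda>x. cnj (fa x))"
    using f(4) by (auto simp: dird_def intro: has_vector_derivative_cnj)
  have 2: "dird (- b) (\<lambda>x. cnj (f x)) (\<lambda>x. - cnj (fb x))"
    unfolding dird_def
  proof
    fix x
    have "((\<lambda>t. f (x + t *\<^sub>R b)) has_vector_derivative fb x) (at (- 0))"
      using f(5) by (auto simp: dird_def)
    moreover have "((\<lambda>t. - t) has_vector_derivative - 1) (at (0::real))"
      by (auto intro!: derivative_eq_intros)
    ultimately have "((\<lambda>t. f (x - t *\<^sub>R b)) has_vector_derivative - fb x) (at 0)"
      using vector_diff_chain_at[of uminus "- 1" 0] by (force simp: o_def)
    from has_vector_derivative_cnj[OF this]
    show "((\<lambda>t. cnj (f (x + t *\<^sub>R - b))) has_vector_derivative - cnj (fb x)) (at 0)"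
      by simp
  qed
  show ?thesis
    by (rule cderI[OF _ _ _ 1 2]) (use f in \<open>auto intro!: continuous_intros\<close>)
qed

lemma cder_exp:
  assumes "cder a b f f'"
  shows "cder a b (\<lambda>x. exp (f x)) (\<lambda>x. f' x * exp (f x))"
proof -
  obtain fa fb where f: "continuous_on UNIV f" "continuous_on UNIV fa" "continuous_on UNIV fb"
    "dird a f fa" "dird b f fb" "f' = (\<lambda>x. fa x + \<i> * fb x)" using assms(1) by (rule cderE)
  have *: "dird v (\<lambda>x. exp (f x)) (\<lambda>x. fa x * exp (f x))" if "dird v f fa" for v fa
    unfolding dird_def
  proof
    fix x
    have "((exp \<circ> (\<lambda>t. f (x + t *\<^sub>R v))) has_vector_derivative fa x * exp (f (x + 0 *\<^sub>R v))) (at 0)"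
      by (rule field_vector_diff_chain_at) (use that in \<open>auto simp: dird_def intro: DERIV_exp\<close>)
    then show "((\<lambda>t. exp (f (x + t *\<^sub>R v))) has_vector_derivative fa x * exp (f x)) (at 0)"
      by (simp add: o_def)
  qed
  show ?thesis
    by (rule cderI[OF _ _ _ *[OF f(4)] *[OF f(5)]])
      (use f in \<open>auto simp: algebra_simps intro!: continuous_intros\<close>)
qed

text \<open>Along each real direction the derivative of the real function \<open>s\<close> is real,
  so the one-variable chain rule applies to both components; only their combination
  \<open>s'\<close> is complex. Differentiability of \<open>g\<close> is asked for at values of
  \<open>s\<close> alone, which admits \<open>1 / (1 + t)\<close> for nonnegative
  \<open>s\<close>.\<close>

lemma cder_chain_real:
  fixes g g' :: "real \<Rightarrow> real"
  assumes s: "cder a b (\<lambda>x. of_real (s x)) s'"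
    and g: "\<And>x. (g has_real_derivative g' (s x)) (at (s x))" "continuous_on UNIV (\<lambda>x. g' (s x))"
  shows "cder a b (\<lambda>x. of_real (g (s x))) (\<lambda>x. of_real (g' (s x)) * s' x)"
proof -
  obtain fa fb where f: "continuous_on UNIV (\<lambda>x. complex_of_real (s x))" "continuous_on UNIV fa" "continuous_on UNIV fb"
    "dird a (\<lambda>x. of_real (s x)) fa" "dird b (\<lambda>x. of_real (s x)) fb" "s' = (\<lambda>x. fa x + \<i> * fb x)"
    using s by (rule cderE)
  have cs: "continuous_on UNIV s"
    using continuous_on_Re[OF f(1)] by simp
  have cgs: "continuous_on UNIV (\<lambda>x. g (s x))"
    unfolding continuous_on_eq_continuous_at[OF open_UNIV]
  proof
    fix x
    have "isCont s x" using cs by (simp add: continuous_on_eq_continuous_at)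
    then show "isCont (\<lambda>x. g (s x)) x" using DERIV_isCont[OF g(1)] by (rule isCont_o2)
  qed
  have *: "dird v (\<lambda>x. of_real (g (s x))) (\<lambda>x. of_real (g' (s x)) * fa x)"
    if "dird v (\<lambda>x. of_real (s x)) fa" for v fa
    unfolding dird_def
  proof
    fix x
    have hv: "((\<lambda>t. complex_of_real (s (x + t *\<^sub>R v))) has_vector_derivative fa x) (at 0)"
      using that by (auto simp: dird_def)
    have re: "((\<lambda>t. s (x + t *\<^sub>R v)) has_vector_derivative Re (fa x)) (at 0)"
      and im: "((\<lambda>t. 0::real) has_vector_derivative Im (fa x)) (at (0::real))"
      using hv by (simp_all add: has_vector_derivative_complex_iff has_real_derivative_iff_has_vector_derivative)
    have im0: "Im (fa x) = 0"
      using vector_derivative_unique_at[OF im has_vector_derivative_const] by simp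
    have "(g has_field_derivative g' (s x)) (at (s (x + 0 *\<^sub>R v)))"
      using g(1) by simp
    from field_vector_diff_chain_at[OF re this]
    have d: "((\<lambda>t. g (s (x + t *\<^sub>R v))) has_vector_derivative Re (fa x) * g' (s x)) (at 0)"
      by (simp add: o_def)
    show "((\<lambda>t. complex_of_real (g (s (x + t *\<^sub>R v)))) has_vector_derivative of_real (g' (s x)) * fa x) (at 0)"
    proof -
      have "complex_of_real (Re (fa x) * g' (s x)) = of_real (g' (s x)) * fa x"
        using im0 by (simp add: complex_eq_iff)
      then show ?thesis
        using has_vector_derivative_of_real[OF d[folded has_real_derivative_iff_has_vector_derivative]] by metis
    qed
  qed
  show ?thesis
    by (rule cderI[OF _ _ _ *[OF f(4)] *[OF f(5)]])
      (use f cgs g(2) in \<open>auto simp: algebra_simps intro!: continuous_intros\<close>)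
qed

definition invariant :: "'v::real_normed_vector set \<Rightarrow> ('v \<Rightarrow> 'b) \<Rightarrow> bool"
  where "invariant U g \<longleftrightarrow> (\<forall>v\<in>U. \<forall>x t. g (x + t *\<^sub>R v) = g x)"

lemma cder_invariant:
  assumes "invariant U f" "continuous_on UNIV f" "a \<in> U" "b \<in> U"
  shows "cder a b f (\<lambda>_. 0)"
  by (rule cderI[where fa = "\<lambda>_. 0" and fb = "\<lambda>_. 0"]) (use assms in \<open>auto simp: dird_def invariant_def\<close>)

section \<open>Integrals of derivatives of compactly supported functions\<close>

section \<open>Integration by parts\<close>

lemma compact_supported_integrable:
  fixes h :: "'v::euclidean_space \<Rightarrow> complex"
  assumes "continuous_on UNIV h" "compact K" "\<And>x. x \<notin> K \<Longrightarrow> h x = 0"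
  shows "integrable lborel h"
proof -
  have "integrable lborel (\<lambda>x. indicator K x *\<^sub>R h x)"
    by (rule borel_integrable_compact) (use assms in \<open>auto intro: continuous_on_subset\<close>)
  also have "(\<lambda>x. indicator K x *\<^sub>R h x) = h"
    using assms(3) by (auto simp: fun_eq_iff indicator_def)
  finally show ?thesis .
qed

lemma LINT_lborel_translate:
  fixes h :: "'v::euclidean_space \<Rightarrow> complex"
  assumes "continuous_on UNIV h"
  shows "(LINT x|lborel. h (x + v)) = (LINT x|lborel. h x)"
proof -
  have m: "h \<in> borel_measurable borel" using assms by (rule borel_measurable_continuous_onI)
  have "(LINT x|lborel. h x) = (LINT x|distr lborel borel ((+) v). h x)"
    by (simp add: lborel_distr_plus)
  also have "\<dots> = (LINT x|lborel. h (v + x))"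
    by (rule integral_distr) (use m in auto)
  finally show ?thesis by (simp add: add.commute)
qed

lemma dird_vanish:
  fixes h h' :: "'v::euclidean_space \<Rightarrow> complex"
  assumes h: "dird v h h'" and K: "closed K" "\<And>x. x \<notin> K \<Longrightarrow> h x = 0" and x: "x \<notin> K"
  shows "h' x = 0"
proof -
  have "open (- K)" using K by auto
    then obtain e where e: "e > 0" "ball x e \<subseteq> - K"
      using x by (meson ComplI open_contains_ball)
    define d where "d = e / (norm v + 1)"
    have d: "d > 0" unfolding d_def using e by (intro divide_pos_pos) (auto intro: add_nonneg_pos)
    have z: "h (x + t *\<^sub>R v) = 0" if "t \<in> ball 0 d" for t
    proof -
      have "\<bar>t\<bar> * norm v \<le> \<bar>t\<bar> * (norm v + 1)" by (intro mult_left_mono) auto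
      also have "\<dots> < e"
        using that pos_less_divide_eq[of "norm v + 1" "\<bar>t\<bar>" e] unfolding d_def
        by (simp add: add_nonneg_pos)
      finally have "x + t *\<^sub>R v \<in> ball x e" by (simp add: dist_norm)
      then show ?thesis using e K by blast
    qed
    have "((\<lambda>t. h (x + t *\<^sub>R v)) has_vector_derivative 0) (at 0)"
      by (rule has_vector_derivative_transform_within_open[where f = "\<lambda>_. 0" and S = "ball 0 d"])
        (use d z in auto)
    then show ?thesis
      using h vector_derivative_unique_at by (metis dird_def)
  qed

text \<open>Integrate \<open>h (x + v) - h x\<close>, which is the integral of
  \<open>h' (x + t v)\<close> over \<open>t\<close> in the unit interval, with respect to
  \<open>x\<close>. Translation invariance makes the left side zero, and Fubini's theorem turns the
  right side into the integral of \<open>h'\<close>. The direction \<open>v\<close> need not be a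
  coordinate direction.\<close>

lemma integral_dird_zero:
  fixes h h' :: "'v::euclidean_space \<Rightarrow> complex"
  assumes h: "continuous_on UNIV h" "continuous_on UNIV h'" "dird v h h'"
    and K: "compact K" "\<And>x. x \<notin> K \<Longrightarrow> h x = 0"
  shows "(LINT x|lborel. h' x) = 0"
proof -
  have zero': "h' x = 0" if "x \<notin> K" for x
    using dird_vanish[OF h(3) compact_imp_closed[OF K(1)] K(2) that] .
  \<comment> \<open>All points from which a segment of direction \<open>v\<close> reaches
    \<open>K\<close>; the integrand in \<open>(x, t)\<close> then vanishes outside a compact
    product, as required for Fubini's theorem.\<close>
  define K' where "K' = (\<lambda>(x, t). x - t *\<^sub>R v) ` (K \<times> {0..1})"
  have K': "compact K'"
    unfolding K'_def by (intro compact_continuous_image) (use K in \<open>auto intro!: continuous_intros compact_Times simp: case_prod_beta\<close>)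
  have out: "h' (x + t *\<^sub>R v) = 0" if "x \<notin> K'" "t \<in> {0..1}" for x t
  proof (rule zero', rule notI)
    assume "x + t *\<^sub>R v \<in> K"
    then have "x \<in> K'" unfolding K'_def using that by (intro image_eqI[where x = "(x + t *\<^sub>R v, t)"]) auto
    with that show False by simp
  qed
  have "continuous_on UNIV (\<lambda>(x, t::real). h' (x + t *\<^sub>R v))"
    unfolding case_prod_beta by (rule continuous_on_compose2[OF h(2)]) (auto intro!: continuous_intros)
  then have "integrable lborel (\<lambda>z. indicator (K' \<times> {0..1}) z *\<^sub>R (case z of (x, t::real) \<Rightarrow> h' (x + t *\<^sub>R v)))"
    using K' by (intro borel_integrable_compact compact_Times) (auto intro: continuous_on_subset)
  then have int: "integrable (lborel \<Otimes>\<^sub>M lborel) (\<lambda>(x, t). indicator (K' \<times> {0..1}) (x, t) *\<^sub>R h' (x + t *\<^sub>R v))"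
    unfolding lborel_prod by (simp add: case_prod_beta')
  have ftc: "(LINT t|lborel. indicator (K' \<times> {0..1}) (x, t) *\<^sub>R h' (x + t *\<^sub>R v)) = h (x + v) - h x" for x
  proof -
    have "(LINT t|lborel. indicator (K' \<times> {0..1}) (x, t) *\<^sub>R h' (x + t *\<^sub>R v))
      = (LINT t|lborel. indicator {0..1} t *\<^sub>R h' (x + t *\<^sub>R v))"
      using out[of x] by (intro Bochner_Integration.integral_cong) (force simp: indicator_def)+
    also have "\<dots> = h (x + 1 *\<^sub>R v) - h (x + 0 *\<^sub>R v)"
      by (rule integral_FTC_Icc[where F = "\<lambda>t. h (x + t *\<^sub>R v)"])
        (auto intro!: has_vector_derivative_at_within dirdD[OF h(3)] continuous_on_compose2[OF h(2), where f = "\<lambda>t. x + t *\<^sub>R v"] continuous_intros)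
    finally show ?thesis by simp
  qed
  have hint: "integrable lborel h" and hint': "integrable lborel h'"
    using compact_supported_integrable h K zero' by blast+
  have hintv: "integrable lborel (\<lambda>x. h (x + v))"
  proof (rule compact_supported_integrable[where K = "(\<lambda>x. x - v) ` K"])
    show "continuous_on UNIV (\<lambda>x. h (x + v))"
      by (rule continuous_on_compose2[OF h(1)]) (auto intro!: continuous_intros)
    show "compact ((\<lambda>x. x - v) ` K)"
      by (intro compact_continuous_image continuous_intros K)
    show "h (x + v) = 0" if "x \<notin> (\<lambda>x. x - v) ` K" for x
      using that by (intro K(2)) (auto intro: image_eqI[where x = "x + v"])
  qed
  have "0 = (LINT x|lborel. h (x + v) - h x)"
    using hint hintv LINT_lborel_translate[OF h(1), of v] by simp
  also have "\<dots> = (LINT x|lborel. LINT t|lborel. indicator (K' \<times> {0..1}) (x, t) *\<^sub>R h' (x + t *\<^sub>R v))"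
    by (simp add: ftc)
  also have "\<dots> = (LINT t|lborel. LINT x|lborel. indicator (K' \<times> {0..1}) (x, t) *\<^sub>R h' (x + t *\<^sub>R v))"
    using lborel_pair.Fubini_integral[OF int] by simp
  also have "\<dots> = (LINT t|lborel. indicator {0..1::real} t *\<^sub>R (LINT x|lborel. h' x))"
  proof (rule Bochner_Integration.integral_cong[OF refl])
    fix t :: real
    have "(LINT x|lborel. indicator (K' \<times> {0..1}) (x, t) *\<^sub>R h' (x + t *\<^sub>R v)) =
      (LINT x|lborel. indicator {0..1} t *\<^sub>R h' (x + t *\<^sub>R v))"
      using out[of _ t] by (intro Bochner_Integration.integral_cong) (force simp: indicator_def)+
    then show "(LINT x|lborel. indicator (K' \<times> {0..1}) (x, t) *\<^sub>R h' (x + t *\<^sub>R v)) =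
      indicator {0..1} t *\<^sub>R (LINT x|lborel. h' x)"
      by (simp add: LINT_lborel_translate[OF h(2)])
  qed
  also have "\<dots> = (LINT x|lborel. h' x)"
    by simp
  finally show ?thesis by simp
qed

lemma integral_cder_zero:
  fixes h :: "'v::euclidean_space \<Rightarrow> complex"
  assumes "cder a b h h'" "compact K" "\<And>x. x \<notin> K \<Longrightarrow> h x = 0"
  shows "(LINT x|lborel. h' x) = 0"
proof -
  obtain fa fb where f: "continuous_on UNIV h" "continuous_on UNIV fa" "continuous_on UNIV fb"
    "dird a h fa" "dird b h fb" "h' = (\<lambda>x. fa x + \<i> * fb x)" using assms(1) by (rule cderE)
  have "integrable lborel fa" "integrable lborel fb"
    using compact_supported_integrable[OF f(2) assms(2)] compact_supported_integrable[OF f(3) assms(2)]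
      dird_vanish[OF f(4) compact_imp_closed[OF assms(2)] assms(3)]
      dird_vanish[OF f(5) compact_imp_closed[OF assms(2)] assms(3)] by blast+
  then show ?thesis
    using integral_dird_zero[OF f(1,2,4) assms(2,3)] integral_dird_zero[OF f(1,3,5) assms(2,3)]
    by (simp add: f(6))
qed

section \<open>Formal derivatives and restriction to coordinate lines\<close>

section \<open>Polynomials and their derivatives\<close>

text \<open>Truncated subtraction sends an exponent without the variable \<open>i\<close> to itself,
  but its factor is zero; so exactly one exponent contributes to each \<open>\<gamma>\<close>. In
  this form commutation of derivatives and the loss of degree are read off coefficientwise.\<close>

lemma lookup_pdiff:
  "Poly_Mapping.lookup (pdiff i p) \<gamma> =
    of_nat (Poly_Mapping.lookup \<gamma> i + 1) * Poly_Mapping.lookup p (\<gamma> + Poly_Mapping.single i 1)"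
proof -
  have eq: "(of_nat (Poly_Mapping.lookup \<beta> i) * Poly_Mapping.lookup p \<beta> when \<beta> - Poly_Mapping.single i 1 = \<gamma>) =
      (if \<beta> = \<gamma> + Poly_Mapping.single i 1 then of_nat (Poly_Mapping.lookup \<gamma> i + 1) * Poly_Mapping.lookup p \<beta> else 0)"
    for \<beta>
  proof (cases "Poly_Mapping.lookup \<beta> i = 0")
    case True
    then have "\<beta> \<noteq> \<gamma> + Poly_Mapping.single i 1" by (auto simp: lookup_add)
    with True show ?thesis by simp
  next
    case False
    have "\<beta> - Poly_Mapping.single i 1 = \<gamma> \<longleftrightarrow> \<beta> = \<gamma> + Poly_Mapping.single i 1"
    proof
      assume "\<beta> - Poly_Mapping.single i 1 = \<gamma>"
      with False show "\<beta> = \<gamma> + Poly_Mapping.single i 1"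
        by (intro poly_mapping_eqI) (auto simp: lookup_add lookup_minus lookup_single when_def)
    qed auto
    then show ?thesis by (auto simp: lookup_add when_def)
  qed
  have "Poly_Mapping.lookup (pdiff i p) \<gamma> = (\<Sum>\<beta>\<in>Poly_Mapping.keys p.
      (of_nat (Poly_Mapping.lookup \<beta> i) * Poly_Mapping.lookup p \<beta> when \<beta> - Poly_Mapping.single i 1 = \<gamma>))"
    unfolding pdiff_def by (simp add: lookup_sum lookup_single)
  also have "\<dots> = of_nat (Poly_Mapping.lookup \<gamma> i + 1) * Poly_Mapping.lookup p (\<gamma> + Poly_Mapping.single i 1)"
    unfolding eq by (simp add: sum.delta in_keys_iff)
  finally show ?thesis .
qed

lemma pdiff_commute: "pdiff i (pdiff j p) = pdiff j (pdiff i p)"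
  by (rule poly_mapping_eqI) (auto simp: lookup_pdiff lookup_add lookup_single when_def ac_simps)

lemma funpow_comp_commute:
  assumes "f \<circ> g = g \<circ> f"
  shows "(f ^^ m) \<circ> (g ^^ n) = (g ^^ n) \<circ> (f ^^ m)"
proof -
  have 1: "f \<circ> (g ^^ n) = (g ^^ n) \<circ> f" for n
    using assms by (induction n) (auto simp: fun_eq_iff)
  show ?thesis
    using 1 by (induction m) (auto simp: fun_eq_iff)
qed

text \<open>A multi-index becomes a word of variables, from which single derivatives can be peeled
  off by list induction; the order of differentiation becomes the length of the word.\<close>

lemma mpdiff_eq_foldr:
  fixes \<alpha> :: "'n::finite \<Rightarrow>\<^sub>0 nat"
  shows "\<exists>js. length js = mdeg \<alpha> \<and> (\<forall>p. mpdiff \<alpha> p = foldr pdiff js p)"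
proof -
  interpret comp_fun_commute "\<lambda>i::'n. pdiff i ^^ Poly_Mapping.lookup \<alpha> i"
    by unfold_locales (rule funpow_comp_commute, auto simp: pdiff_commute)
  have "\<exists>js. length js = (\<Sum>i\<in>A. Poly_Mapping.lookup \<alpha> i) \<and>
      (\<forall>p. Finite_Set.fold (\<lambda>i. pdiff i ^^ Poly_Mapping.lookup \<alpha> i) p A = foldr pdiff js p)"
    if "finite A" for A
    using that
  proof (induction A)
    case (insert i A)
    then obtain js where js: "length js = (\<Sum>i\<in>A. Poly_Mapping.lookup \<alpha> i)"
      "\<And>p. Finite_Set.fold (\<lambda>i. pdiff i ^^ Poly_Mapping.lookup \<alpha> i) p A = foldr pdiff js p"
      by blast
    have "foldr pdiff (replicate m i) q = (pdiff i ^^ m) q" for m q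
      by (induction m) auto
    then show ?case
      using insert js by (intro exI[of _ "replicate (Poly_Mapping.lookup \<alpha> i) i @ js"]) auto
  qed auto
  from this[of UNIV] show ?thesis
    by (auto simp: mpdiff_def mdeg_def)
qed

definition degree_at_most :: "nat \<Rightarrow> ('n::finite, 'c::zero) mpoly \<Rightarrow> bool"
  where "degree_at_most d p \<longleftrightarrow> (\<forall>\<gamma>. Poly_Mapping.lookup p \<gamma> \<noteq> 0 \<longrightarrow> mdeg \<gamma> \<le> d)"

lemma mdeg_add_single: "mdeg (\<gamma> + Poly_Mapping.single i 1) = mdeg \<gamma> + 1"
proof -
  have "(\<Sum>j\<in>UNIV. (1::nat) when i = j) = 1" by (simp add: when_def)
  then show ?thesis by (simp add: mdeg_def lookup_add lookup_single sum.distrib)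
qed

lemma foldr_pdiff_degree:
  assumes "degree_at_most d p" "Poly_Mapping.lookup (foldr pdiff js p) \<gamma> \<noteq> 0"
  shows "mdeg \<gamma> + length js \<le> d"
  using assms(2)
proof (induction js arbitrary: \<gamma>)
  case (Cons j js)
  from Cons.IH[of "\<gamma> + Poly_Mapping.single j 1"] Cons.prems show ?case
    by (auto simp: lookup_pdiff mdeg_add_single[unfolded One_nat_def])
qed (use assms in \<open>auto simp: degree_at_most_def\<close>)

lemma degree_at_most_foldr_pdiff: "degree_at_most d p \<Longrightarrow> degree_at_most d (foldr pdiff js p)"
  using foldr_pdiff_degree by (fastforce simp: degree_at_most_def[of d "foldr pdiff js p"])

lemma degree_at_most_pdiff: "degree_at_most d p \<Longrightarrow> degree_at_most d (pdiff j p)"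
  using degree_at_most_foldr_pdiff[of d p "[j]"] by simp

lemma foldr_pdiff_eq_0: "degree_at_most d p \<Longrightarrow> length js > d \<Longrightarrow> foldr pdiff js p = 0"
  using foldr_pdiff_degree by (intro poly_mapping_eqI) fastforce

lemma ceval_0 [simp]: "ceval 0 z = 0"
  by (simp add: ceval_def)

lemma ceval_pdiff:
  "ceval (pdiff i p) z = (\<Sum>\<beta>\<in>Poly_Mapping.keys p. Poly_Mapping.lookup p \<beta> *
      (of_nat (Poly_Mapping.lookup \<beta> i) * (z $ i) ^ (Poly_Mapping.lookup \<beta> i - 1) *
       (\<Prod>j\<in>UNIV - {i}. (z $ j) ^ Poly_Mapping.lookup \<beta> j)))"
proof -
  have prod: "(\<Prod>j\<in>UNIV. g j) = g i * (\<Prod>j\<in>UNIV - {i}. g j)" for g :: "'a \<Rightarrow> complex"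
    by (rule prod.remove) auto
  show ?thesis
    unfolding pdiff_def ceval_sum ceval_single prod
    by (intro sum.cong refl) (simp add: lookup_minus lookup_single mult_ac)
qed

lemma has_derivative_ceval:
  "(ceval p has_derivative (\<lambda>h. \<Sum>i\<in>UNIV. h $ i * ceval (pdiff i p) z)) (at z)"
proof -
  have c: "((\<lambda>z::complex^'a. z $ j) has_derivative (\<lambda>h. h $ j)) (at z)" for j
    by (rule bounded_linear_imp_has_derivative) (rule bounded_linear_vec_nth)
  have "((\<lambda>z. \<Sum>\<beta>\<in>Poly_Mapping.keys p. Poly_Mapping.lookup p \<beta> *
        (\<Prod>i\<in>UNIV. (z $ i) ^ Poly_Mapping.lookup \<beta> i)) has_derivative
      (\<lambda>h. \<Sum>\<beta>\<in>Poly_Mapping.keys p. Poly_Mapping.lookup p \<beta> * (\<Sum>i\<in>UNIV.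
        (of_nat (Poly_Mapping.lookup \<beta> i) * h $ i * (z $ i) ^ (Poly_Mapping.lookup \<beta> i - 1)) *
        (\<Prod>j\<in>UNIV - {i}. (z $ j) ^ Poly_Mapping.lookup \<beta> j)))) (at z)"
    by (intro has_derivative_sum has_derivative_mult_right has_derivative_prod has_derivative_power c)
  also have "(\<lambda>z. \<Sum>\<beta>\<in>Poly_Mapping.keys p. Poly_Mapping.lookup p \<beta> *
        (\<Prod>i\<in>UNIV. (z $ i) ^ Poly_Mapping.lookup \<beta> i)) = ceval p"
    by (simp add: ceval_def fun_eq_iff)
  finally show ?thesis
    by (rule has_derivative_eq_rhs)
      (simp add: fun_eq_iff ceval_pdiff sum_distrib_left sum_distrib_right sum.swap[of _ UNIV "Poly_Mapping.keys p"] mult_ac)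
qed

lemma continuous_on_ceval [continuous_intros]:
  assumes "continuous_on A g"
  shows "continuous_on A (\<lambda>x. ceval p (g x))"
proof -
  have "continuous_on UNIV (ceval p)"
    by (meson continuous_at_imp_continuous_on has_derivative_continuous has_derivative_ceval)
  then show ?thesis using assms by (rule continuous_on_compose2) auto
qed

text \<open>The choice of directions enters only through the coefficients
  \<open>s a $ i + \<i> * s b $ i\<close>. For a dual pair they are 0 or 1, and for the opposite
  direction at a complex place they all vanish.\<close>

lemma cder_ceval:
  fixes s :: "'v::euclidean_space \<Rightarrow> complex^'n"
  assumes s: "linear s"
  shows "cder a b (\<lambda>x. ceval p (s x)) (\<lambda>x. \<Sum>i\<in>UNIV. (s a $ i + \<i> * s b $ i) * ceval (pdiff i p) (s x))"
proof -
  have cs: "continuous_on UNIV s" using s by (rule linear_continuous_on[OF linear_conv_bounded_linear[THEN iffD1]])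
  have *: "dird v (\<lambda>x. ceval p (s x)) (\<lambda>x. \<Sum>i\<in>UNIV. s v $ i * ceval (pdiff i p) (s x))" for v
    unfolding dird_def
  proof
    fix x
    have "((\<lambda>t. s x + t *\<^sub>R s v) has_derivative (\<lambda>t. t *\<^sub>R s v)) (at 0)"
      by (auto intro!: derivative_eq_intros)
    moreover have "(ceval p has_derivative (\<lambda>h. \<Sum>i\<in>UNIV. h $ i * ceval (pdiff i p) (s x))) (at (s x + 0 *\<^sub>R s v))"
      using has_derivative_ceval[of p "s x"] by simp
    ultimately have "((\<lambda>t. ceval p (s x + t *\<^sub>R s v)) has_derivative
        (\<lambda>t. \<Sum>i\<in>UNIV. (t *\<^sub>R s v) $ i * ceval (pdiff i p) (s x))) (at 0)"
      by (rule has_derivative_compose)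
    then show "((\<lambda>t. ceval p (s (x + t *\<^sub>R v))) has_vector_derivative
        (\<Sum>i\<in>UNIV. s v $ i * ceval (pdiff i p) (s x))) (at 0)"
      by (simp add: has_vector_derivative_def linear_add[OF s] linear_scale[OF s] scaleR_sum_right)
  qed
  show ?thesis
    by (rule cderI[OF _ _ _ * *])
      (auto intro!: continuous_intros cs simp: algebra_simps sum.distrib sum_distrib_left)
qed

text \<open>Passage to one variable: the degree bound is the same for every line, which is the
  source of all bounds independent of the base point.\<close>

lemma ceval_line:
  fixes p :: "('n::finite, complex) mpoly"
  assumes "degree_at_most d p"
  obtains r where "degree r \<le> d" "\<And>t. poly r t = ceval p (z + axis i t)"
    "\<And>t. poly (pderiv r) t = ceval (pdiff i p) (z + axis i t)"
proof -
  define r where "r = (\<Sum>\<beta>\<in>Poly_Mapping.keys p. smult (Poly_Mapping.lookup p \<beta> *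
      (\<Prod>j\<in>UNIV - {i}. (z $ j) ^ Poly_Mapping.lookup \<beta> j)) ([:z $ i, 1:] ^ Poly_Mapping.lookup \<beta> i))"
  have prod: "(\<Prod>j\<in>UNIV. g j) = g i * (\<Prod>j\<in>UNIV - {i}. g j)" for g :: "'n \<Rightarrow> complex"
    by (rule prod.remove) auto
  have r: "poly r t = ceval p (z + axis i t)" for t
    unfolding r_def ceval_def poly_sum prod
    by (intro sum.cong refl) (simp add: axis_def mult_ac)
  have "degree r \<le> d"
    unfolding r_def
  proof (rule degree_sum_le)
    fix \<beta> assume "\<beta> \<in> Poly_Mapping.keys p"
    then have "mdeg \<beta> \<le> d" using assms by (auto simp: degree_at_most_def in_keys_iff)
    then have "Poly_Mapping.lookup \<beta> i \<le> d"
      using member_le_sum[of i UNIV "Poly_Mapping.lookup \<beta>"] by (simp add: mdeg_def)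
    moreover have "degree ([:z $ i, 1:] ^ Poly_Mapping.lookup \<beta> i) = Poly_Mapping.lookup \<beta> i"
      by (simp add: degree_power_eq)
    ultimately show "degree (smult (Poly_Mapping.lookup p \<beta> *
      (\<Prod>j\<in>UNIV - {i}. (z $ j) ^ Poly_Mapping.lookup \<beta> j)) ([:z $ i, 1:] ^ Poly_Mapping.lookup \<beta> i)) \<le> d"
      using degree_smult_le le_trans by metis
  qed auto
  moreover have "poly (pderiv r) t = ceval (pdiff i p) (z + axis i t)" for t
  proof -
    have "((\<lambda>u. ceval p (\<chi> j. if j = i then u else (z + axis i t) $ j)) has_field_derivative
        ceval (pdiff i p) (z + axis i t)) (at (z $ i + t))"
      using has_field_derivative_ceval[of p i "z + axis i t"] by (simp add: axis_def)
    moreover have "ceval p (\<chi> j. if j = i then u else (z + axis i t) $ j) = poly r (u - z $ i)" for u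
      unfolding r by (intro arg_cong[where f = "ceval p"]) (auto simp: vec_eq_iff axis_def)
    ultimately have 1: "((\<lambda>u. poly r (u - z $ i)) has_field_derivative
        ceval (pdiff i p) (z + axis i t)) (at (z $ i + t))" by simp
    have "((\<lambda>u. poly r (u - z $ i)) has_field_derivative poly (pderiv r) t) (at (z $ i + t))"
      by (auto intro!: derivative_eq_intros)
    from DERIV_unique[OF this 1] show ?thesis .
  qed
  ultimately show thesis using that r by blast
qed

section \<open>Complex conjugation of the coefficients\<close>

lemma lookup_map_cnj: "Poly_Mapping.lookup (Poly_Mapping.map cnj p) \<gamma> = cnj (Poly_Mapping.lookup p \<gamma>)"
  by (simp add: Poly_Mapping.map.rep_eq when_def)

lemma pdiff_map_cnj: "pdiff i (Poly_Mapping.map cnj p) = Poly_Mapping.map cnj (pdiff i p)"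
  by (rule poly_mapping_eqI) (simp add: lookup_pdiff lookup_map_cnj)

lemma mpdiff_map_cnj: "mpdiff \<alpha> (Poly_Mapping.map cnj p) = Poly_Mapping.map cnj (mpdiff \<alpha> p)"
proof -
  obtain js where js: "length js = mdeg \<alpha>" "\<And>p. mpdiff \<alpha> p = foldr pdiff js p"
    using mpdiff_eq_foldr[of \<alpha>] by blast
  show ?thesis unfolding js(2) by (induction js) (simp_all add: pdiff_map_cnj)
qed

lemma ceval_map_cnj: "ceval (Poly_Mapping.map cnj p) (\<chi> i. cnj (z $ i)) = cnj (ceval p z)"
proof -
  have "Poly_Mapping.keys (Poly_Mapping.map cnj p) = Poly_Mapping.keys p"
    by (auto simp: in_keys_iff lookup_map_cnj)
  then show ?thesis by (simp add: ceval_def lookup_map_cnj)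
qed

section \<open>Properties of the \<open>H\<close>-functional\<close>

lemma finite_mdeg_le: "finite {\<alpha> :: 'n::finite \<Rightarrow>\<^sub>0 nat. mdeg \<alpha> \<le> d}"
proof (rule finite_imageD)
  show "inj_on Poly_Mapping.lookup {\<alpha> :: 'n \<Rightarrow>\<^sub>0 nat. mdeg \<alpha> \<le> d}"
    by (auto intro!: inj_onI poly_mapping_eqI)
  have "Poly_Mapping.lookup \<alpha> i \<le> d" if "mdeg \<alpha> \<le> d" for \<alpha> :: "'n \<Rightarrow>\<^sub>0 nat" and i
    using that member_le_sum[of i UNIV "Poly_Mapping.lookup \<alpha>"] by (simp add: mdeg_def)
  then have "Poly_Mapping.lookup ` {\<alpha> :: 'n \<Rightarrow>\<^sub>0 nat. mdeg \<alpha> \<le> d} \<subseteq> PiE UNIV (\<lambda>_. {..d})"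
    by (auto simp: PiE_def)
  then show "finite (Poly_Mapping.lookup ` {\<alpha> :: 'n \<Rightarrow>\<^sub>0 nat. mdeg \<alpha> \<le> d})"
    by (rule finite_subset) (auto intro: finite_PiE)
qed

lemma H_point_attained:
  fixes f :: "('n::finite, real^'k^'k) mpoly"
  assumes deg: "degree_at_most d (emb_poly \<omega> \<sigma> f)" and h: "0 < h" "h \<le> H_point \<omega> f \<sigma> x"
  obtains js where "js \<noteq> []" "h ^ length js \<le> cmod (ceval (foldr pdiff js (emb_poly \<omega> \<sigma> f)) (emb_vec \<omega> \<sigma> x))"
proof -
  define g where "g \<alpha> = root (mdeg \<alpha>)
    (cmod (1 / of_nat (mfact \<alpha>) * ceval (mpdiff \<alpha> (emb_poly \<omega> \<sigma> f)) (emb_vec \<omega> \<sigma> x)))" for \<alpha>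
  have g0: "g \<alpha> = 0" if "mdeg \<alpha> > d" for \<alpha>
  proof -
    obtain js where "length js = mdeg \<alpha>" "\<And>p. mpdiff \<alpha> p = foldr pdiff js p"
      using mpdiff_eq_foldr[of \<alpha>] by blast
    then show ?thesis using that foldr_pdiff_eq_0[OF deg] by (simp add: g_def)
  qed
  \<comment> \<open>Orders above \<open>d\<close> contribute only the value 0, so the maximum over
    infinitely many multi-indices runs over a finite set of values.\<close>
  have "g ` {\<alpha>. mdeg \<alpha> \<ge> 1} \<subseteq> insert 0 (g ` {\<alpha>. mdeg \<alpha> \<le> d})"
    using g0 by (auto simp: not_le) (metis image_eqI mem_Collect_eq not_le)
  then have fin: "finite (g ` {\<alpha>. mdeg \<alpha> \<ge> 1})"
    by (rule finite_subset) (auto intro: finite_mdeg_le)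
  have "0 + Poly_Mapping.single undefined 1 \<in> {\<alpha> :: 'n \<Rightarrow>\<^sub>0 nat. mdeg \<alpha> \<ge> 1}"
    unfolding mem_Collect_eq mdeg_add_single by simp
  then have "g ` {\<alpha>. mdeg \<alpha> \<ge> 1} \<noteq> {}" by (metis empty_iff image_is_empty)
  from Max_in[OF fin this] obtain \<alpha> where \<alpha>: "mdeg \<alpha> \<ge> 1" "H_point \<omega> f \<sigma> x = g \<alpha>"
    by (auto simp: H_point_def g_def)
  obtain js where js: "length js = mdeg \<alpha>" "\<And>p. mpdiff \<alpha> p = foldr pdiff js p"
    using mpdiff_eq_foldr[of \<alpha>] by blast
  define v where "v = cmod (ceval (foldr pdiff js (emb_poly \<omega> \<sigma> f)) (emb_vec \<omega> \<sigma> x))"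
  have mf: "real (mfact \<alpha>) \<ge> 1"
    using prod_ge_1[of UNIV "\<lambda>i. fact (Poly_Mapping.lookup \<alpha> i) :: nat"] unfolding mfact_def
    by (metis fact_ge_1 of_nat_1 of_nat_le_iff)
  have "h \<le> root (mdeg \<alpha>) (v / mfact \<alpha>)"
    using h(2) by (simp add: \<alpha> g_def js v_def norm_divide)
  also have "\<dots> \<le> root (mdeg \<alpha>) v"
  proof (rule real_root_le_mono)
    have "v * 1 \<le> v * mfact \<alpha>" using mf by (intro mult_left_mono) (auto simp: v_def)
    then show "v / mfact \<alpha> \<le> v" using mf by (simp add: divide_le_eq)
  qed (use \<alpha>(1) in simp)
  finally have "h ^ length js \<le> root (mdeg \<alpha>) v ^ mdeg \<alpha>"
    using h(1) by (simp add: js power_mono)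
  also have "\<dots> = v" using \<alpha>(1) by (simp add: v_def)
  finally show thesis using that[of js] js(1) \<alpha>(1) by (cases "js = []") (auto simp: v_def)
qed

text \<open>The lower bound \<open>h ^ m\<close> holds for the given word and fails for all words of
  length 1. When letters are removed one by one there is a first place where it breaks, and there a
  single differentiation increases the modulus by more than the factor \<open>h\<close>.\<close>

lemma derivative_growth_step:
  assumes "js \<noteq> []" "h > 0" "h ^ length js \<le> cmod (ceval (foldr pdiff js p) z)"
    and "\<And>i. cmod (ceval (pdiff i p) z) < h"
  obtains i js' where "length js' < length js"
    "h * cmod (ceval (foldr pdiff js' p) z) < cmod (ceval (pdiff i (foldr pdiff js' p)) z)"
  using assms(1,3)
proof (induction js arbitrary: thesis)
  case (Cons i js)
  show ?case
  proof (cases "js = []")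
    case True
    with Cons.prems assms(4)[of i] show ?thesis by simp
  next
    case False
    show ?thesis
    proof (cases "h ^ length js \<le> cmod (ceval (foldr pdiff js p) z)")
      case True
      obtain i' js' where "length js' < length js"
        "h * cmod (ceval (foldr pdiff js' p) z) < cmod (ceval (pdiff i' (foldr pdiff js' p)) z)"
        using Cons.IH[OF _ False True] by blast
      then show ?thesis using Cons.prems(1)[of js' i'] by simp
    next
      case False
      then have "h * cmod (ceval (foldr pdiff js p) z) < h ^ length (i # js)"
        using assms(2) by simp
      also have "\<dots> \<le> cmod (ceval (pdiff i (foldr pdiff js p)) z)"
        using Cons.prems(3) by simp
      finally show ?thesis using Cons.prems(1)[of js i] by simp
    qed
  qed
qed simp

lemma emb_coord_cnj: "emb_coord \<omega> (cnj \<circ> \<sigma>) x = cnj (emb_coord \<omega> \<sigma> x)"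
  by (simp add: emb_coord_def cnj_sum)

lemma emb_poly_cnj: "emb_poly \<omega> (cnj \<circ> \<sigma>) f = Poly_Mapping.map cnj (emb_poly \<omega> \<sigma> f)"
  by (rule poly_mapping_eqI)
    (simp add: emb_poly_def lookup_map_cnj Poly_Mapping.map.rep_eq when_def emb_star_def emb_coord_cnj)

text \<open>Conjugating the embedding conjugates both the coefficients and the point, hence every
  derivative value, and moduli do not change. A conjugate pair therefore contributes a square to the
  product.\<close>

lemma H_unif_cnj:
  fixes \<omega> :: "'k::finite \<Rightarrow> 'a::field_char_0" and f :: "('n::finite, real^'k^'k) mpoly"
  shows "H_unif \<omega> \<psi> f (cnj \<circ> \<sigma>) = H_unif \<omega> \<psi> f \<sigma>"
proof -
  have *: "emb_vec \<omega> (cnj \<circ> \<sigma>) x = (\<chi> l. cnj (emb_vec \<omega> \<sigma> x $ l))" for x :: "(real^'k)^'n"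
    by (simp add: emb_vec_def emb_star_def emb_coord_cnj)
  have "cmod (1 / of_nat m * cnj c) = cmod (1 / of_nat m * c)" for m c
    by (simp add: norm_divide)
  then show ?thesis
    unfolding H_unif_def H_point_def emb_poly_cnj mpdiff_map_cnj * ceval_map_cnj by simp
qed

section \<open>Root-counting estimates that are uniform in the coefficients\<close>

section \<open>Polynomials in one complex variable\<close>

lemma pderiv_prod_linear:
  fixes z :: "'i \<Rightarrow> complex"
  assumes "finite I" "\<And>i. i \<in> I \<Longrightarrow> t \<noteq> z i"
  shows "poly (pderiv (\<Prod>i\<in>I. [:- z i, 1:])) t = poly (\<Prod>i\<in>I. [:- z i, 1:]) t * (\<Sum>i\<in>I. 1 / (t - z i))"
  using assms
proof (induction I)
  case (insert i I)
  define P where "P = (\<Prod>i\<in>I. [:- z i, 1:])"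
  have "t - z i \<noteq> 0" using insert.prems by auto
  moreover have "poly (pderiv P) t = poly P t * (\<Sum>i\<in>I. 1 / (t - z i))"
    unfolding P_def using insert by simp
  ultimately show ?case
    using insert.hyps by (simp add: pderiv_mult pderiv_pCons P_def[symmetric] del: mult_pCons_left) (simp add: field_simps)
qed simp

text \<open>Partial fractions over the roots with multiplicity. The later bounds depend on the
  polynomial only through the number of these terms.\<close>

lemma log_derivative:
  fixes r :: "complex poly"
  assumes "r \<noteq> 0"
  obtains z where "\<And>t. poly r t = 0 \<Longrightarrow> \<exists>i<degree r. t = z i"
    "\<And>t. poly r t \<noteq> 0 \<Longrightarrow> poly (pderiv r) t = poly r t * (\<Sum>i<degree r. 1 / (t - z i))"
proof -
  obtain z where z: "smult (lead_coeff r) (\<Prod>i<degree r. [:- z i, 1:]) = r"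
    by (rule complex_poly_decompose')
  have pr: "poly r t = lead_coeff r * (\<Prod>i<degree r. t - z i)" for t
    by (subst z[symmetric]) (simp add: poly_prod)
  show thesis
  proof (rule that)
    fix t
    show "\<exists>i<degree r. t = z i" if "poly r t = 0"
      using that assms by (auto simp: pr)
    assume "poly r t \<noteq> 0"
    then have "\<And>i. i \<in> {..<degree r} \<Longrightarrow> t \<noteq> z i" by (auto simp: pr)
    from pderiv_prod_linear[OF finite_lessThan this]
    have "poly (smult (lead_coeff r) (pderiv (\<Prod>i<degree r. [:- z i, 1:]))) t =
        poly (smult (lead_coeff r) (\<Prod>i<degree r. [:- z i, 1:])) t * (\<Sum>i<degree r. 1 / (t - z i))"
      by simp
    then show "poly (pderiv r) t = poly r t * (\<Sum>i<degree r. 1 / (t - z i))"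
      unfolding pderiv_smult[symmetric] z .
  qed
qed

text \<open>The logarithmic derivative exceeds \<open>h\<close> and is a sum of at most
  \<open>d\<close> terms \<open>1 / (t - z i)\<close>, so one term exceeds
  \<open>h / degree r\<close>, and \<open>t\<close> is within \<open>d / h\<close> of that root. For
  \<open>r = 0\<close> the strict inequality never holds.\<close>

lemma near_root:
  fixes r :: "complex poly"
  assumes "degree r \<le> d" "h > 0"
  obtains Z where "finite Z" "card Z \<le> d"
    "\<And>t. h * cmod (poly r t) < cmod (poly (pderiv r) t) \<Longrightarrow> \<exists>z\<in>Z. t \<in> cball z (d / h)"
proof (cases "r = 0")
  case True
  then show thesis using that[of "{}"] by simp
next
  case False
  obtain z where z: "\<And>t. poly r t = 0 \<Longrightarrow> \<exists>i<degree r. t = z i"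
    "\<And>t. poly r t \<noteq> 0 \<Longrightarrow> poly (pderiv r) t = poly r t * (\<Sum>i<degree r. 1 / (t - z i))"
    using log_derivative[OF False] by blast
  show thesis
  proof (rule that[of "z ` {..<degree r}"])
    show "card (z ` {..<degree r}) \<le> d"
      using card_image_le[of "{..<degree r}" z] assms by simp
    fix t assume t: "h * cmod (poly r t) < cmod (poly (pderiv r) t)"
    show "\<exists>y\<in>z ` {..<degree r}. t \<in> cball y (d / h)"
    proof (cases "poly r t = 0")
      case True
      then obtain i where "i < degree r" "t = z i" using z(1) by blast
      then show ?thesis using assms by (intro bexI[of _ "z i"]) auto
    next
      case False
      have "h < cmod (\<Sum>i<degree r. 1 / (t - z i))"
        using t False by (simp add: z(2)[OF False] norm_mult mult.commute)
      also have "\<dots> \<le> (\<Sum>i<degree r. 1 / cmod (t - z i))"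
        by (rule order_trans[OF norm_sum]) (simp add: norm_divide)
      finally have lt: "h < (\<Sum>i<degree r. 1 / cmod (t - z i))" .
      have "\<exists>i<degree r. h / degree r < 1 / cmod (t - z i)"
      proof (rule ccontr)
        assume "\<not> ?thesis"
        then have le: "1 / cmod (t - z i) \<le> h / degree r" if "i \<in> {..<degree r}" for i
          using that by (metis lessThan_iff not_less)
        have "(\<Sum>i<degree r. 1 / cmod (t - z i)) \<le> (\<Sum>i<degree r. h / degree r)"
          by (rule sum_mono[OF le])
        also have "\<dots> \<le> h" using assms by simp
        finally show False using lt by simp
      qed
      then obtain i where i: "i < degree r" "h / degree r < 1 / cmod (t - z i)" by blast
      have "0 < h / degree r" using i assms by simp
      with i(2) have "cmod (t - z i) > 0" using less_trans zero_less_divide_1_iff by blast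
      with i assms(2) have "cmod (t - z i) < degree r / h"
        by (simp add: field_simps)
      also have "\<dots> \<le> d / h" using assms by (simp add: divide_right_mono)
      finally show ?thesis
        using i(1) by (intro bexI[of _ "z i"]) (simp_all add: dist_norm norm_minus_commute)
    qed
  qed auto
qed

section \<open>Measure of neighbourhoods of the roots\<close>

lemma emeasure_UN_cball_le:
  fixes Z :: "'v::euclidean_space set"
  assumes "finite Z" "card Z \<le> d" "\<rho> \<ge> 0" "A \<subseteq> (\<Union>z\<in>Z. cball z \<rho>)"
  shows "emeasure lborel A \<le> ennreal (d * (unit_ball_vol DIM('v) * \<rho> ^ DIM('v)))"
proof -
  have "emeasure lborel A \<le> emeasure lborel (\<Union>z\<in>Z. cball z \<rho>)"
    using assms by (intro emeasure_mono) auto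
  also have "\<dots> \<le> (\<Sum>z\<in>Z. emeasure lborel (cball z \<rho>))"
    using assms by (intro emeasure_subadditive_finite) auto
  also have "\<dots> = ennreal (card Z * (unit_ball_vol DIM('v) * \<rho> ^ DIM('v)))"
    using assms(3) by (simp add: emeasure_cball ennreal_mult ennreal_of_nat_eq_real_of_nat)
  also have "\<dots> \<le> ennreal (d * (unit_ball_vol DIM('v) * \<rho> ^ DIM('v)))"
    using assms by (intro ennreal_leI mult_right_mono) auto
  finally show ?thesis .
qed

lemma near_root_complex_measure:
  fixes r :: "complex poly"
  assumes "degree r \<le> d" "h > 0"
  shows "emeasure lborel {t. h * cmod (poly r t) < cmod (poly (pderiv r) t)} \<le> ennreal (4 * real d ^ 3 / h\<^sup>2)"
proof -
  obtain Z where Z: "finite Z" "card Z \<le> d"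
    "\<And>t. h * cmod (poly r t) < cmod (poly (pderiv r) t) \<Longrightarrow> \<exists>z\<in>Z. t \<in> cball z (d / h)"
    using near_root[OF assms] by blast
  have "emeasure lborel {t. h * cmod (poly r t) < cmod (poly (pderiv r) t)} \<le>
      ennreal (d * (unit_ball_vol DIM(complex) * (d / h) ^ DIM(complex)))"
    by (rule emeasure_UN_cball_le[OF Z(1,2)]) (use Z(3) assms in auto)
  also have "\<dots> \<le> ennreal (4 * real d ^ 3 / h\<^sup>2)"
  proof (rule ennreal_leI)
    have "d * (unit_ball_vol DIM(complex) * (d / h) ^ DIM(complex)) = pi * (d ^ 3 / h\<^sup>2)"
      by (simp add: unit_ball_vol_2 power2_eq_square power3_eq_cube)
    also have "\<dots> \<le> 4 * (d ^ 3 / h\<^sup>2)"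
      using pi_less_4 by (intro mult_right_mono) auto
    finally show "d * (unit_ball_vol DIM(complex) * (d / h) ^ DIM(complex)) \<le> 4 * real d ^ 3 / h\<^sup>2" by simp
  qed
  finally show ?thesis .
qed

lemma near_root_real_measure:
  fixes r :: "complex poly"
  assumes "degree r \<le> d" "h > 0"
  shows "emeasure lborel {t::real. h * cmod (poly r (of_real t)) < cmod (poly (pderiv r) (of_real t))}
    \<le> ennreal (2 * d\<^sup>2 / h)"
proof -
  obtain Z where Z: "finite Z" "card Z \<le> d"
    "\<And>t. h * cmod (poly r t) < cmod (poly (pderiv r) t) \<Longrightarrow> \<exists>z\<in>Z. t \<in> cball z (d / h)"
    using near_root[OF assms] by blast
  \<comment> \<open>Replacing a root by its real part only decreases its distance to real
    points.\<close>
  have "{t::real. h * cmod (poly r (of_real t)) < cmod (poly (pderiv r) (of_real t))}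
      \<subseteq> (\<Union>z\<in>Re ` Z. cball z (d / h))"
  proof safe
    fix t :: real
    assume "h * cmod (poly r (of_real t)) < cmod (poly (pderiv r) (of_real t))"
    from Z(3)[OF this] obtain z where z: "z \<in> Z" "cmod (z - of_real t) \<le> d / h"
      by (auto simp: dist_norm)
    with abs_Re_le_cmod[of "z - of_real t"] show "t \<in> (\<Union>z\<in>Re ` Z. cball z (d / h))"
      by (auto simp: dist_norm intro!: bexI[of _ z])
  qed
  from emeasure_UN_cball_le[OF _ _ _ this, of d] Z card_image_le[of Z Re] assms
  show ?thesis by (simp add: power2_eq_square mult_ac)
qed

section \<open>Variation of a polynomial that is real on the real line\<close>

lemma real_on_reals_pderiv:
  fixes q :: "complex poly"
  assumes "\<And>t::real. poly q (of_real t) \<in> \<real>"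
  shows "poly (pderiv q) (of_real t) \<in> \<real>"
proof -
  have "(poly q has_field_derivative poly (pderiv q) (of_real t)) (at (of_real t))"
    by (rule poly_DERIV)
  moreover have "(complex_of_real has_vector_derivative 1) (at t)"
    by (auto intro!: derivative_eq_intros simp: has_vector_derivative_def scaleR_conv_of_real)
  ultimately have "((\<lambda>t. poly q (of_real t)) has_vector_derivative poly (pderiv q) (of_real t)) (at t)"
    using field_vector_diff_chain_at[of of_real 1 t "poly q"] by (force simp: o_def)
  then have "((\<lambda>t. Im (poly q (of_real t))) has_vector_derivative Im (poly (pderiv q) (of_real t))) (at t)"
    by (simp add: has_vector_derivative_complex_iff has_real_derivative_iff_has_vector_derivative)
  moreover have "Im (poly q (of_real t)) = 0" for t
    using assms complex_is_Real_iff by blast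
  ultimately have "((\<lambda>t::real. 0::real) has_vector_derivative Im (poly (pderiv q) (of_real t))) (at t)"
    by simp
  then have "Im (poly (pderiv q) (of_real t)) = 0"
    using vector_derivative_unique_at has_vector_derivative_const by blast
  then show ?thesis by (simp add: complex_is_Real_iff)
qed

text \<open>The kernel is the derivative of \<open>arctan ((t - a) / |b|)\<close>, whose total
  variation is \<open>pi\<close> for every width \<open>b\<close> and centre
  \<open>a\<close>.\<close>

lemma Poisson_kernel_integral:
  "(\<integral>\<^sup>+t. ennreal (\<bar>b\<bar> / ((t - a)\<^sup>2 + b\<^sup>2)) * indicator {-1..1} t \<partial>lborel) \<le> ennreal pi"
proof (cases "b = 0")
  case False
  define F where "F t = arctan ((t - a) / \<bar>b\<bar>)" for t
  have F: "(F has_real_derivative \<bar>b\<bar> / ((t - a)\<^sup>2 + b\<^sup>2)) (at t)" for t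
    unfolding F_def using False
    by (auto intro!: derivative_eq_intros simp: field_simps power2_eq_square abs_if)
  have "(\<integral>\<^sup>+t. ennreal (\<bar>b\<bar> / ((t - a)\<^sup>2 + b\<^sup>2)) * indicator {-1..1} t \<partial>lborel) = ennreal (F 1 - F (-1))"
    by (rule nn_integral_FTC_Icc) (use F in \<open>auto intro: has_field_derivative_at_within\<close>)
  also have "\<dots> \<le> ennreal pi"
  proof (rule ennreal_leI)
    show "F 1 - F (-1) \<le> pi"
      using arctan_ubound[of "(1 - a) / \<bar>b\<bar>"] arctan_lbound[of "(-1 - a) / \<bar>b\<bar>"] by (simp add: F_def)
  qed
  finally show ?thesis .
qed simp

text \<open>
  For \<open>q\<close> real on the reals, \<open>q' / (1 + q\<^sup>2)\<close> is the imaginary part of the logarithmic derivative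
  of \<open>q - \<i>\<close>, hence a sum of Poisson kernels.
\<close>

lemma real_variation_integral:
  assumes deg: "degree q \<le> d" and real: "\<And>t::real. poly q (of_real t) \<in> \<real>"
  shows "(\<integral>\<^sup>+t. ennreal (cmod (poly (pderiv q) (of_real t)) / (1 + (cmod (poly q (of_real t)))\<^sup>2)) *
      indicator {-1..1} t \<partial>lborel) \<le> ennreal (d * pi)"
proof -
  define r where "r = q - [:\<i>:]"
  have r: "poly r t = poly q t - \<i>" "pderiv r = pderiv q" for t
    by (simp_all add: r_def pderiv_diff pderiv_pCons)
  \<comment> \<open>A real value never equals \<open>\<i>\<close>, so \<open>q - \<i>\<close> has no
    real root and the partial fractions hold at every real \<open>t\<close>.\<close>
  have nz: "poly r (of_real t) \<noteq> 0" for t :: real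
    using real[of t] by (auto simp: r complex_is_Real_iff)
  then have "r \<noteq> 0" by auto
  obtain z where z: "\<And>t. poly r t = 0 \<Longrightarrow> \<exists>i<degree r. t = z i"
    "\<And>t. poly r t \<noteq> 0 \<Longrightarrow> poly (pderiv r) t = poly r t * (\<Sum>i<degree r. 1 / (t - z i))"
    using log_derivative[OF \<open>r \<noteq> 0\<close>] by blast
  have degr: "degree r \<le> d"
    unfolding r_def using deg by (intro degree_diff_le) auto
  have bound: "cmod (poly (pderiv q) (of_real t)) / (1 + (cmod (poly q (of_real t)))\<^sup>2) \<le>
      (\<Sum>i<degree r. \<bar>Im (z i)\<bar> / ((t - Re (z i))\<^sup>2 + (Im (z i))\<^sup>2))" for t
  proof -
    obtain x y where xy: "poly q (of_real t) = of_real x" "poly (pderiv q) (of_real t) = of_real y"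
      using real real_on_reals_pderiv[OF real] by (metis Reals_cases)
    have "(\<Sum>i<degree r. 1 / (of_real t - z i)) = of_real y / (of_real x - \<i>)"
      using z(2)[OF nz[of t]] nz[of t] by (simp add: r xy field_simps)
    \<comment> \<open>With real values \<open>x\<close> of \<open>q\<close> and \<open>y\<close> of
      its derivative, \<open>y / (x - \<i>)\<close> has imaginary part
      \<open>y / (1 + x^2)\<close>.\<close>
    then have "Im (\<Sum>i<degree r. 1 / (of_real t - z i)) = y / (1 + x\<^sup>2)"
      by (simp add: Im_divide power2_eq_square add.commute)
    then have "y / (1 + x\<^sup>2) = (\<Sum>i<degree r. Im (z i) / ((t - Re (z i))\<^sup>2 + (Im (z i))\<^sup>2))"
      by (simp add: Im_divide)
    then have "\<bar>y\<bar> / (1 + x\<^sup>2) = \<bar>\<Sum>i<degree r. Im (z i) / ((t - Re (z i))\<^sup>2 + (Im (z i))\<^sup>2)\<bar>"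
      by (metis abs_divide abs_of_nonneg add_nonneg_nonneg zero_le_one zero_le_power2)
    also have "\<dots> \<le> (\<Sum>i<degree r. \<bar>Im (z i)\<bar> / ((t - Re (z i))\<^sup>2 + (Im (z i))\<^sup>2))"
      by (rule order_trans[OF sum_abs]) (simp add: abs_divide)
    finally show ?thesis by (simp add: xy)
  qed
  have "(\<integral>\<^sup>+t. ennreal (cmod (poly (pderiv q) (of_real t)) / (1 + (cmod (poly q (of_real t)))\<^sup>2)) *
      indicator {-1..1} t \<partial>lborel) \<le>
    (\<integral>\<^sup>+t. (\<Sum>i<degree r. ennreal (\<bar>Im (z i)\<bar> / ((t - Re (z i))\<^sup>2 + (Im (z i))\<^sup>2)) * indicator {-1..1} t) \<partial>lborel)"
    unfolding sum_distrib_right[symmetric]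
    by (intro nn_integral_mono mult_right_mono) (use bound in \<open>auto intro: ennreal_leI simp: sum_ennreal\<close>)
  also have "\<dots> = (\<Sum>i<degree r. \<integral>\<^sup>+t. ennreal (\<bar>Im (z i)\<bar> / ((t - Re (z i))\<^sup>2 + (Im (z i))\<^sup>2)) * indicator {-1..1} t \<partial>lborel)"
    by (rule nn_integral_sum) auto
  also have "\<dots> \<le> (\<Sum>i<degree r. ennreal pi)"
    by (intro sum_mono Poisson_kernel_integral)
  also have "\<dots> \<le> ennreal (d * pi)"
    using degr by (auto simp: ennreal_of_nat_eq_real_of_nat simp flip: ennreal_mult intro!: ennreal_leI mult_right_mono)
  finally show ?thesis .
qed

section \<open>Spherical area covered by a polynomial\<close>

lemma cder_poly: "cder a b (poly q) (\<lambda>z. (a + \<i> * b) * poly (pderiv q) z)"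
proof -
  have *: "dird v (poly q) (\<lambda>z. v * poly (pderiv q) z)" for v
    unfolding dird_def
  proof
    fix z
    have "(poly q has_field_derivative poly (pderiv q) z) (at (z + 0 *\<^sub>R v))"
      by (simp add: poly_DERIV)
    moreover have "((\<lambda>t. z + t *\<^sub>R v) has_vector_derivative v) (at 0)"
      by (auto intro!: derivative_eq_intros)
    ultimately show "((\<lambda>t. poly q (z + t *\<^sub>R v)) has_vector_derivative v * poly (pderiv q) z) (at 0)"
      using field_vector_diff_chain_at[of "\<lambda>t. z + t *\<^sub>R v" v 0 "poly q"] by (simp add: o_def)
  qed
  show ?thesis
    by (rule cderI[OF _ _ _ * *]) (auto intro!: continuous_intros simp: algebra_simps)
qed

text \<open>
  The integrand is \<open>\<partial>/\<partial>\<bar>z\<close> of \<open>q' \<bar>q / (1 + |q|\<^sup>2)\<close>, which is at most \<open>|q' / q|\<close> and so eventually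
  at most \<open>2 d / |z|\<close>; integrate by parts against a cutoff at a large radius.
\<close>

lemma complex_variation_integral:
  assumes deg: "degree q \<le> d"
  shows "(\<integral>\<^sup>+z. ennreal ((cmod (poly (pderiv q) z) / (1 + (cmod (poly q z))\<^sup>2))\<^sup>2) *
      indicator (ball 0 1) z \<partial>lborel) \<le> ennreal (4 + 32 * d)"
proof -
  define u where "u z = (cmod (poly q z))\<^sup>2" for z
  define \<Psi> where "\<Psi> z = poly (pderiv q) z * cnj (poly q z) * of_real (1 / (1 + u z))" for z
  define G where "G z = (cmod (poly (pderiv q) z) / (1 + u z))\<^sup>2" for z
  have cs: "(complex_of_real (cmod w))\<^sup>2 = w * cnj w" for w
    using complex_norm_square[of w] by simp
  have u0: "u z \<ge> 0" for z by (simp add: u_def)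
  have u1: "1 + u z > 0" for z using u0[of z] by linarith
  have contu: "continuous_on UNIV u" unfolding u_def by (intro continuous_intros)
  have uq: "complex_of_real (u z) = poly q z * cnj (poly q z)" for z
    unfolding u_def by (rule complex_norm_square)
  have Dq: "cder 1 \<i> (poly q) (\<lambda>_. 0)" "cder 1 \<i> (poly (pderiv q)) (\<lambda>_. 0)" for q
    by (rule cder_cong[OF cder_poly], simp)+
  have Dcq: "cder 1 \<i> (\<lambda>z. cnj (poly q z)) (\<lambda>z. 2 * cnj (poly (pderiv q) z))" for q
    using cder_cnj[OF cder_poly[of 1 "- \<i>" q]] by simp
  have Du: "cder 1 \<i> (\<lambda>z. complex_of_real (u z)) (\<lambda>z. poly q z * (2 * cnj (poly (pderiv q) z)))"
    unfolding uq by (rule cder_cong[OF cder_mult[OF Dq(1) Dcq]]) simp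
  have D1: "cder 1 \<i> (\<lambda>z. complex_of_real (1 / (1 + u z)))
      (\<lambda>z. of_real (- 1 / (1 + u z)\<^sup>2) * (poly q z * (2 * cnj (poly (pderiv q) z))))"
  proof (rule cder_chain_real[OF Du])
    fix z
    show "((\<lambda>t. 1 / (1 + t)) has_real_derivative - 1 / (1 + u z)\<^sup>2) (at (u z))"
      using u1[of z] by (auto intro!: derivative_eq_intros simp: power2_eq_square)
    show "continuous_on UNIV (\<lambda>z. - 1 / (1 + u z)\<^sup>2)"
      using u1 by (intro continuous_intros contu) (metis less_irrefl power_eq_0_iff zero_neq_numeral)
  qed
  have D\<Psi>: "cder 1 \<i> \<Psi> (\<lambda>z. of_real (2 * G z))"
    unfolding \<Psi>_def
  proof (rule cder_cong[OF cder_mult[OF cder_mult[OF Dq(2) Dcq] D1]])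
    fix z
    define K where "K = 1 + complex_of_real (u z)"
    define a where "a = poly (pderiv q) z"
    define c where "c = poly q z"
    have K: "K \<noteq> 0"
      using u1[of z] unfolding K_def by (metis less_irrefl of_real_1 of_real_add of_real_eq_0_iff)
    have G: "of_real (2 * G z) = 2 * (a * cnj a) / K\<^sup>2"
      by (simp add: G_def power_divide K_def cs a_def)
    have "a * cnj c * (- 1 / K\<^sup>2 * (c * (2 * cnj a))) = - (2 * (a * cnj a)) * (c * cnj c) / K\<^sup>2"
      by simp
    also have "c * cnj c = K - 1" using uq[of z] by (simp add: K_def c_def)
    finally have "a * cnj c * (- 1 / K\<^sup>2 * (c * (2 * cnj a))) + (a * (2 * cnj a) + 0 * cnj c) * (1 / K) =
        2 * (a * cnj a) / K\<^sup>2"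
      using K by (simp add: field_simps power2_eq_square)
    then show "poly (pderiv q) z * cnj (poly q z) * (of_real (- 1 / (1 + u z)\<^sup>2) * (poly q z * (2 * cnj (poly (pderiv q) z)))) +
        (poly (pderiv q) z * (2 * cnj (poly (pderiv q) z)) + 0 * cnj (poly q z)) * of_real (1 / (1 + u z)) =
        of_real (2 * G z)"
      unfolding G by (simp add: a_def c_def K_def)
  qed
  have cont\<Psi>: "continuous_on UNIV \<Psi>" and contG: "continuous_on UNIV G"
    using cder_continuous(1)[OF D\<Psi>] u1 by (auto simp: G_def intro!: continuous_intros contu) (metis less_irrefl)
  obtain R0 where R0: "R0 \<ge> 1" "\<And>z. cmod z \<ge> R0 \<Longrightarrow> cmod (z * \<Psi> z) \<le> 2 * d"
  proof (cases "pderiv q = 0")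
    case True
    then show thesis using that[of 1] by (simp add: \<Psi>_def)
  next
    case False
    then have "q \<noteq> 0" by auto
    obtain w where w: "\<And>t. poly q t = 0 \<Longrightarrow> \<exists>i<degree q. t = w i"
      "\<And>t. poly q t \<noteq> 0 \<Longrightarrow> poly (pderiv q) t = poly q t * (\<Sum>i<degree q. 1 / (t - w i))"
      using log_derivative[OF \<open>q \<noteq> 0\<close>] by blast
    \<comment> \<open>Beyond twice the modulus of every root, \<open>z\<close> stays at distance at
      least \<open>|z| / 2\<close> from all roots, so each partial fraction is at most
      \<open>2 / |z|\<close>.\<close>
    define R0 where "R0 = 1 + 2 * (\<Sum>i<degree q. cmod (w i))"
    have wi: "2 * cmod (w i) \<le> R0 - 1" if "i < degree q" for i
      using member_le_sum[of i "{..<degree q}" "\<lambda>i. cmod (w i)"] that by (simp add: R0_def)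
    show thesis
    proof (rule that[of R0])
      show "R0 \<ge> 1" by (simp add: R0_def sum_nonneg)
      fix z assume z: "cmod z \<ge> R0"
      then have z0: "cmod z > 0" using \<open>R0 \<ge> 1\<close> by linarith
      have sep: "cmod (z - w i) \<ge> cmod z / 2" if "i < degree q" for i
        using wi[OF that] z norm_triangle_ineq2[of z "w i"] by linarith
      have nz: "poly q z \<noteq> 0"
      proof
        assume "poly q z = 0"
        then obtain i where "i < degree q" "z = w i" using w(1) by blast
        with sep[of i] z0 show False by simp
      qed
      have "cmod (\<Sum>i<degree q. 1 / (z - w i)) \<le> (\<Sum>i<degree q. 2 / cmod z)"
      proof (rule sum_norm_le)
        fix i assume "i \<in> {..<degree q}"
        with sep[of i] have s: "cmod (z - w i) \<ge> cmod z / 2" by simp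
        have "cmod (1 / (z - w i)) = 1 / cmod (z - w i)" by (simp add: norm_divide)
        also have "\<dots> \<le> 1 / (cmod z / 2)" using s z0 by (intro divide_left_mono mult_pos_pos) auto
        finally show "cmod (1 / (z - w i)) \<le> 2 / cmod z" by simp
      qed
      also have "\<dots> \<le> 2 * d / cmod z" using deg z0 by (simp add: field_simps)
      finally have S: "cmod (\<Sum>i<degree q. 1 / (z - w i)) \<le> 2 * d / cmod z" .
      have "\<Psi> z = (\<Sum>i<degree q. 1 / (z - w i)) * of_real (u z / (1 + u z))"
        using uq[of z] by (simp add: \<Psi>_def w(2)[OF nz] mult_ac)
      then have "cmod (\<Psi> z) = cmod (\<Sum>i<degree q. 1 / (z - w i)) * \<bar>u z / (1 + u z)\<bar>"
        by (simp only: norm_mult norm_of_real)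
      also have "\<dots> \<le> cmod (\<Sum>i<degree q. 1 / (z - w i)) * 1"
        using u0[of z] by (intro mult_left_mono) auto
      finally have "cmod (\<Psi> z) \<le> 2 * d / cmod z" using S by simp
      then show "cmod (z * \<Psi> z) \<le> 2 * d" using z0 by (simp add: norm_mult field_simps)
    qed
  qed
  obtain M where M: "M \<ge> 0" "\<And>z. cmod z \<le> R0 \<Longrightarrow> cmod (z * \<Psi> z) \<le> M"
  proof -
    have "compact ((\<lambda>z. z * \<Psi> z) ` cball 0 R0)"
      by (intro compact_continuous_image continuous_intros continuous_on_subset[OF cont\<Psi>]) auto
    then obtain M where "\<forall>x\<in>(\<lambda>z. z * \<Psi> z) ` cball 0 R0. cmod x \<le> M"
      using compact_imp_bounded bounded_iff by metis
    then show thesis by (intro that[of "max M 0"]) (auto simp: le_max_iff_disj)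
  qed
  \<comment> \<open>Large enough that the inner region, where only the bound \<open>M\<close> is
    known, contributes a bounded amount: \<open>(2 + x)^2 \<ge> 4 x\<close> gives
    \<open>M * R0^2 / R^2 \<le> 1 / 4\<close>. The 2 also keeps the unit ball well inside the
    cutoff.\<close>
  define R where "R = 2 + M * R0\<^sup>2"
  have R2: "R \<ge> 2" using M by (simp add: R_def)
  define s where "s z = (cmod z)\<^sup>2 / R\<^sup>2" for z :: complex
  \<comment> \<open>Squaring the positive part makes the cutoff continuously differentiable across
    the circle of radius \<open>R\<close>, as one integration by parts requires.\<close>
  define \<kappa> where "\<kappa> z = (max 0 (1 - s z))\<^sup>2" for z :: complex
  have Ds: "cder 1 \<i> (\<lambda>z. complex_of_real (s z)) (\<lambda>z. 2 * z / (of_real R)\<^sup>2)"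
  proof -
    have "cder 1 \<i> (\<lambda>z. 1 / (of_real R)\<^sup>2 * (poly [:0, 1:] z * cnj (poly [:0, 1:] z)))
      (\<lambda>z. 1 / (of_real R)\<^sup>2 * (poly [:0, 1:] z * (2 * cnj (poly (pderiv [:0, 1:]) z)) + 0 * cnj (poly [:0, 1:] z)))"
      by (intro cder_cmult cder_mult Dq Dcq)
    moreover have "(\<lambda>z. complex_of_real (s z)) = (\<lambda>z. 1 / (of_real R)\<^sup>2 * (poly [:0, 1:] z * cnj (poly [:0, 1:] z)))"
      by (simp add: s_def fun_eq_iff cs)
    ultimately show ?thesis
      by (auto elim!: cder_cong simp: pderiv_pCons)
  qed
  have conts: "continuous_on UNIV s" unfolding s_def using R2 by (intro continuous_intros) auto
  have D\<kappa>: "cder 1 \<i> (\<lambda>z. complex_of_real (\<kappa> z)) (\<lambda>z. of_real (- 2 * max 0 (1 - s z)) * (2 * z / (of_real R)\<^sup>2))"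
    unfolding \<kappa>_def
  proof (rule cder_chain_real[OF Ds])
    show "continuous_on UNIV (\<lambda>z. - 2 * max 0 (1 - s z))" by (intro continuous_intros conts)
    have "((\<lambda>t. (max 0 (1 - t))\<^sup>2) has_real_derivative - 2 * max 0 (1 - t)) (at t)" for t :: real
    proof (cases t "1 :: real" rule: linorder_cases)
      case less
      have "((\<lambda>t. (1 - t)\<^sup>2) has_real_derivative - 2 * (1 - t)) (at t)"
        by (auto intro!: derivative_eq_intros)
      then have "((\<lambda>t. (max 0 (1 - t))\<^sup>2) has_real_derivative - 2 * (1 - t)) (at t)"
        by (rule has_field_derivative_transform_within_open[of _ _ _ "{..<1}"]) (use less in auto)
      then show ?thesis using less by simp
    next
      case greater
      have "((\<lambda>t. 0) has_real_derivative 0) (at t)" by simp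
      then have "((\<lambda>t. (max 0 (1 - t))\<^sup>2) has_real_derivative 0) (at t)"
        by (rule has_field_derivative_transform_within_open[of _ _ _ "{1<..}"]) (use greater in auto)
      then show ?thesis using greater by simp
    next
      case equal
      have "((\<lambda>h. ((max 0 (1 - (1 + h)))\<^sup>2 - (max 0 (1 - 1))\<^sup>2) / h) \<longlongrightarrow> (0::real)) (at 0)"
      proof (rule Lim_null_comparison)
        show "\<forall>\<^sub>F h::real in at 0. norm (((max 0 (1 - (1 + h)))\<^sup>2 - (max 0 (1 - 1))\<^sup>2) / h) \<le> \<bar>h\<bar>"
        proof (rule eventuallyI)
          fix h :: real
          have "(max 0 (- h))\<^sup>2 \<le> \<bar>h\<bar> * \<bar>h\<bar>" by (auto simp: max_def power2_eq_square)
          then show "norm (((max 0 (1 - (1 + h)))\<^sup>2 - (max 0 (1 - 1))\<^sup>2) / h) \<le> \<bar>h\<bar>"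
            by (cases "h = 0") (auto simp: divide_le_eq)
        qed
        show "((\<lambda>h::real. \<bar>h\<bar>) \<longlongrightarrow> 0) (at 0)" using tendsto_rabs_zero[OF tendsto_ident_at] .
      qed
      with equal show ?thesis by (simp add: DERIV_def)
    qed
    then show "((\<lambda>t. (max 0 (1 - t))\<^sup>2) has_real_derivative - 2 * max 0 (1 - s z)) (at (s z))" for z .
  qed
  have s1: "max 0 (1 - s z) = 0" if "z \<notin> cball 0 R" for z
  proof -
    have "(cmod z)\<^sup>2 \<ge> R\<^sup>2" using that R2 by (intro power_mono) auto
    then show ?thesis using R2 by (simp add: s_def)
  qed
  have cont\<kappa>: "continuous_on UNIV \<kappa>" unfolding \<kappa>_def by (intro continuous_intros conts)
  \<comment> \<open>The two terms of the product rule for \<open>\<kappa> * \<Psi>\<close>: in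
    \<open>A\<close> the derivative falls on \<open>\<Psi>\<close> and produces
    \<open>2 * G\<close>, in \<open>B\<close> it falls on the cutoff.\<close>
  define A where "A z = complex_of_real (\<kappa> z * (2 * G z))" for z
  define B where "B z = of_real (- 2 * max 0 (1 - s z)) * (2 * z / (of_real R)\<^sup>2) * \<Psi> z" for z
  have "(LINT z|lborel. A z + B z) = 0"
  proof (rule integral_cder_zero[OF cder_cong[OF cder_mult[OF D\<kappa> D\<Psi>]]])
    show "compact (cball (0::complex) R)" by simp
    show "complex_of_real (\<kappa> z) * \<Psi> z = 0" if "z \<notin> cball 0 R" for z
      using s1[OF that] by (simp add: \<kappa>_def)
  qed (simp add: A_def B_def)
  moreover have "integrable lborel A" "integrable lborel B"
    unfolding A_def B_def
    by (rule compact_supported_integrable[of _ "cball 0 R"];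
        (use s1 R2 in \<open>auto simp: \<kappa>_def intro!: continuous_intros conts contG cont\<Psi>\<close>))+
  ultimately have AB: "(LINT z|lborel. A z) = - (LINT z|lborel. B z)"
    by (simp add: eq_neg_iff_add_eq_0)
  \<comment> \<open>The derivative of the cutoff is at most \<open>4 |z| / R^2\<close>. Its factor
    \<open>|z|\<close> is combined with \<open>\<Psi>\<close>, and \<open>z * \<Psi> z\<close> is
    bounded by \<open>M\<close> inside radius \<open>R0\<close> and by \<open>2 d\<close>
    outside.\<close>
  have Bbound: "cmod (B z) \<le> 4 / R\<^sup>2 * (M * indicator (cball 0 R0) z + 2 * real d * indicat_real (cball 0 R) z)" for z
  proof (cases "z \<in> cball 0 R")
    case True
    have m: "max 0 (1 - s z) \<le> 1" "max 0 (1 - s z) \<ge> 0" by (auto simp: s_def)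
    have "cmod (B z) = max 0 (1 - s z) * (4 / R\<^sup>2 * cmod (z * \<Psi> z))"
      using m R2 by (simp add: B_def norm_mult norm_divide norm_power power2_eq_square)
    also have "\<dots> \<le> 1 * (4 / R\<^sup>2 * cmod (z * \<Psi> z))" using m by (intro mult_right_mono) auto
    also have "\<dots> \<le> 4 / R\<^sup>2 * (M * indicator (cball 0 R0) z + 2 * real d * indicat_real (cball 0 R) z)"
      unfolding mult_1 using True R0(2)[of z] M(2)[of z] M(1)
      by (intro mult_left_mono) (auto simp: indicator_def)
    finally show ?thesis .
  next
    case False
    then show ?thesis using s1[OF False] M(1) by (simp add: B_def indicator_def)
  qed
  have measR: "measure lborel (cball (0::complex) \<rho>) = pi * \<rho>\<^sup>2" if "\<rho> \<ge> 0" for \<rho>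
    using content_cball[OF that, of "0::complex"] by (simp add: unit_ball_vol_2)
  have finR: "emeasure lborel (cball (0::complex) \<rho>) < \<infinity>" for \<rho>
    using emeasure_lborel_cball_finite by (simp add: less_top[symmetric])
  have "cmod (LINT z|lborel. B z) \<le> (LINT z|lborel. 4 / R\<^sup>2 * (M * indicator (cball (0::complex) R0) z + 2 * real d * indicat_real (cball 0 R) z))"
    using \<open>integrable lborel B\<close> Bbound finR
    by (intro order_trans[OF integral_norm_bound] integral_mono integrable_norm
        Bochner_Integration.integrable_mult_right Bochner_Integration.integrable_add integrable_real_indicator) auto
  also have "\<dots> = 4 / R\<^sup>2 * (M * (pi * R0\<^sup>2) + 2 * d * (pi * R\<^sup>2))"
    using finR measR R0(1) R2 by (simp add: integrable_real_indicator)
  also have "\<dots> = 4 * pi * (M * R0\<^sup>2 / R\<^sup>2) + 8 * pi * d"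
    using R2 by (simp add: field_simps)
  also have "\<dots> \<le> 4 * pi * (1 / 4) + 8 * pi * d"
  proof -
    have "4 * (M * R0\<^sup>2) \<le> (2 + M * R0\<^sup>2)\<^sup>2"
      using zero_le_power2[of "M * R0\<^sup>2"] unfolding power2_sum[of 2 "M * R0\<^sup>2"] by simp
    then have "M * R0\<^sup>2 / R\<^sup>2 \<le> 1 / 4" using R2 by (simp add: R_def field_simps)
    then show ?thesis by (intro add_right_mono mult_left_mono) auto
  qed
  \<comment> \<open>The bound obtained so far is \<open>pi + 8 * pi * d\<close>; rounding
    \<open>pi\<close> up to 4 gives integers.\<close>
  also have "\<dots> \<le> 4 + 32 * d"
    using pi_less_4 by (auto intro!: add_mono mult_right_mono)
  finally have LA: "cmod (LINT z|lborel. A z) \<le> 4 + 32 * d" by (simp add: AB)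
  have "(\<integral>\<^sup>+z. ennreal (G z) * indicator (ball 0 1) z \<partial>lborel) \<le> (\<integral>\<^sup>+z. ennreal (\<kappa> z * (2 * G z)) \<partial>lborel)"
  proof (rule nn_integral_mono)
    fix z :: complex
    show "ennreal (G z) * indicator (ball 0 1) z \<le> ennreal (\<kappa> z * (2 * G z))"
    proof (cases "z \<in> ball 0 1")
      case True
      have "(cmod z)\<^sup>2 \<le> 1\<^sup>2" using True by (intro power_mono) auto
      moreover have "R\<^sup>2 \<ge> 2\<^sup>2" using R2 by (intro power_mono) auto
      \<comment> \<open>Hence the cutoff is at least \<open>9 / 16\<close> on the unit ball, and
        twice the cutoff exceeds 1, absorbing the factor 2 in \<open>2 * G\<close>.\<close>
      ultimately have "s z \<le> 1 / 4" unfolding s_def by (auto simp: divide_le_eq)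
      then have "max 0 (1 - s z) \<ge> 3 / 4" by auto
      then have "\<kappa> z \<ge> (3 / 4)\<^sup>2" unfolding \<kappa>_def by (rule power_mono) simp
      then have "1 * G z \<le> (2 * \<kappa> z) * G z"
        by (intro mult_right_mono) (auto simp: power2_eq_square G_def)
      then show ?thesis using True by (auto intro!: ennreal_leI simp: mult_ac)
    qed auto
  qed
  also have "\<dots> = ennreal (LINT z|lborel. \<kappa> z * (2 * G z))"
    using integrable_Re[OF \<open>integrable lborel A\<close>]
    by (intro nn_integral_eq_integral) (auto simp: A_def \<kappa>_def G_def)
  also have "(LINT z|lborel. \<kappa> z * (2 * G z)) = Re (LINT z|lborel. A z)"
  proof -
    have "\<kappa> z * (2 * G z) = Re (A z)" for z by (simp only: A_def Re_complex_of_real)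
    then show ?thesis using integral_Re[OF \<open>integrable lborel A\<close>] by presburger
  qed
  also have "ennreal \<dots> \<le> ennreal (4 + 32 * d)"
    using LA complex_Re_le_cmod order_trans by (blast intro: ennreal_leI)
  finally show ?thesis by (simp add: G_def u_def)
qed

section \<open>Embeddings of a number field\<close>

lemma sum_delta_mult:
  fixes g :: "'k::finite \<Rightarrow> complex"
  shows "(\<Sum>m\<in>UNIV. (if j = m then 1 else 0) * g m) = g j" "(\<Sum>m\<in>UNIV. (if m = j then 1 else 0) * g m) = g j"
    "(\<Sum>m\<in>UNIV. g m * (if j = m then 1 else 0)) = g j" "(\<Sum>m\<in>UNIV. g m * (if m = j then 1 else 0)) = g j"
proof -
  have "(\<Sum>m\<in>UNIV. if j = m then g m else 0) = g j" by simp
  moreover have "(if j = m then 1 else 0) * g m = (if j = m then g m else 0)"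
    "g m * (if j = m then 1 else 0) = (if j = m then g m else 0)"
    "(if m = j then 1 else 0) * g m = (if j = m then g m else 0)"
    "g m * (if m = j then 1 else 0) = (if j = m then g m else 0)" for m by auto
  ultimately show "(\<Sum>m\<in>UNIV. (if j = m then 1 else 0) * g m) = g j"
    "(\<Sum>m\<in>UNIV. (if m = j then 1 else 0) * g m) = g j"
    "(\<Sum>m\<in>UNIV. g m * (if j = m then 1 else 0)) = g j"
    "(\<Sum>m\<in>UNIV. g m * (if m = j then 1 else 0)) = g j" by simp_all
qed

definition Q_linear :: "('a::field_char_0 \<Rightarrow> complex) \<Rightarrow> bool"
  where "Q_linear g \<longleftrightarrow> (\<forall>x y. g (x + y) = g x + g y) \<and> (\<forall>r x. g (of_rat r * x) = of_rat r * g x)"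

lemma Q_linear_sum:
  assumes "Q_linear g"
  shows "g (\<Sum>i\<in>I. of_rat (c i) * p i) = (\<Sum>i\<in>I. of_rat (c i) * g (p i))"
proof -
  have "g 0 = 0" using assms unfolding Q_linear_def by (metis add_cancel_right_right)
  then show ?thesis
    using assms by (induction I rule: infinite_finite_induct) (auto simp: Q_linear_def)
qed

lemma embedding_Q_linear: "\<sigma> \<in> embeddings \<Longrightarrow> Q_linear \<sigma>"
  using embedding_of_rat[of \<sigma>] by (auto simp: Q_linear_def embeddings_def)

lemma Q_linear_expand:
  assumes "number_field_basis \<omega>" "Q_linear g"
  shows "g x = (\<Sum>j\<in>UNIV. of_rat (coord \<omega> x j) * g (\<omega> j))"
  using Q_linear_sum[OF assms(2), of "coord \<omega> x" \<omega> UNIV] by (simp add: coord_sum[OF assms(1)])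

subsection \<open>Squarefree annihilating polynomials\<close>

text \<open>The value field is left open because the same rational polynomial is evaluated at an
  element of the number field and at complex numbers.\<close>

definition rat_eval :: "rat poly \<Rightarrow> 'f::field_char_0 \<Rightarrow> 'f"
  where "rat_eval P x = poly (map_poly of_rat P) x"

lemma rat_eval_simps [simp]:
  "rat_eval 0 x = 0"
  "rat_eval (pCons a P) x = of_rat a + x * rat_eval P x"
  by (simp_all add: rat_eval_def map_poly_pCons)

lemma rat_eval_add: "rat_eval (P + R) x = rat_eval P x + rat_eval R x"
  by (induction P R rule: poly_induct2) (simp_all add: of_rat_add algebra_simps)

lemma rat_eval_smult: "rat_eval (smult c P) x = of_rat c * rat_eval P x"
  by (induction P) (simp_all add: of_rat_mult algebra_simps)

lemma rat_eval_mult: "rat_eval (P * R) x = rat_eval P x * rat_eval R x"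
  by (induction P) (simp_all add: rat_eval_add rat_eval_smult algebra_simps)

lemma rat_eval_altdef: "rat_eval P x = (\<Sum>j\<le>degree P. of_rat (coeff P j) * x ^ j)"
proof -
  have "degree (map_poly of_rat P :: 'a poly) = degree P" by (rule degree_map_poly) auto
  then show ?thesis by (simp add: rat_eval_def poly_altdef coeff_map_poly)
qed

lemma algebraic_over_Q:
  fixes \<omega> :: "'k::finite \<Rightarrow> 'a::field_char_0"
  assumes "number_field_basis \<omega>"
  obtains P where "P \<noteq> 0" "rat_eval P (q :: 'a) = 0"
proof -
  interpret V: finite_dimensional_vector_space rat_scale "range \<omega>"
    using assms by (simp add: number_field_basis_def)
  define N where "N = card (range \<omega>)"
  show thesis
  proof (cases "inj_on (\<lambda>j. q ^ j) {..N}")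
    \<comment> \<open>With a repeated power the set of powers has fewer than \<open>N + 1\<close>
      elements and the dimension count fails, but the repetition itself is a polynomial
      relation.\<close>
    case False
    then obtain i j where ij: "i \<noteq> j" "q ^ i = q ^ j" by (auto simp: inj_on_def)
    have "rat_eval (monom c n) q = of_rat c * q ^ n" for c n
      by (simp add: rat_eval_def map_poly_monom poly_monom)
    then have "rat_eval (monom 1 i + monom (- 1) j) q = 0"
      using ij by (simp add: rat_eval_add of_rat_minus)
    moreover have "coeff (monom 1 i + monom (- 1) j :: rat poly) i \<noteq> 0" using ij by simp
    then have "(monom 1 i + monom (- 1) j :: rat poly) \<noteq> 0" by (metis coeff_0)
    ultimately show thesis using that by blast
  next
    case True
    define S where "S = (\<lambda>j. q ^ j) ` {..N}"
    have "card S = Suc N" using True by (simp add: S_def card_image)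
    moreover have "V.dim S \<le> N"
      using V.dim_subset_UNIV[of S] V.dimension_def by (simp add: N_def V.dim_UNIV)
    ultimately have "V.dependent S"
      using V.dim_eq_card_independent[of S] by fastforce
    then obtain u where u: "\<exists>v\<in>S. u v \<noteq> 0" "(\<Sum>v\<in>S. of_rat (u v) * v) = 0"
      using V.dependent_finite[of S] by (auto simp: S_def)
    define P where "P = (\<Sum>j\<le>N. monom (u (q ^ j)) j)"
    have cP: "coeff P j = (if j \<le> N then u (q ^ j) else 0)" for j
      by (simp add: P_def coeff_sum)
    from u(1) obtain j where "j \<le> N" "u (q ^ j) \<noteq> 0" by (auto simp: S_def)
    then have "P \<noteq> 0" using cP[of j] by auto
    moreover have "rat_eval P q = (\<Sum>j\<le>N. of_rat (coeff P j) * q ^ j)"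
      unfolding rat_eval_altdef
    proof (rule sum.mono_neutral_left)
      show "{..degree P} \<subseteq> {..N}" using cP degree_le[of N P] by auto
    qed (auto simp: coeff_eq_0)
    then have "rat_eval P q = 0"
      using u(2) True by (simp add: cP S_def sum.reindex)
    ultimately show thesis using that by blast
  qed
qed

text \<open>
  An annihilating polynomial of least degree is irreducible. If it had a multiple root \<open>z\<close> in the
  complex numbers, the rational minimal polynomial of \<open>z\<close> would be a proper factor.
\<close>

lemma squarefree_annihilator:
  fixes \<omega> :: "'k::finite \<Rightarrow> 'a::field_char_0"
  assumes "number_field_basis \<omega>"
  obtains P where "P \<noteq> 0" "rat_eval P (q :: 'a) = 0" "rsquarefree (map_poly of_rat P :: complex poly)"
proof -
  have ex: "\<exists>P. P \<noteq> 0 \<and> rat_eval P q = 0" by (rule algebraic_over_Q[OF assms, of q]) auto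
  obtain P where P: "P \<noteq> 0" "rat_eval P q = 0"
    and min: "\<And>R. R \<noteq> 0 \<Longrightarrow> rat_eval R q = 0 \<Longrightarrow> degree P \<le> degree R"
    using ex ex_has_least_nat[of "\<lambda>P. P \<noteq> 0 \<and> rat_eval P q = 0" _ degree] by metis
  have degP: "degree P > 0"
  proof (rule ccontr)
    assume "\<not> degree P > 0"
    then obtain a where "P = [:a:]" by (auto elim: degree_eq_zeroE)
    then show False using P by simp
  qed
  have pd: "pderiv (map_poly of_rat P) = (map_poly of_rat (pderiv P) :: complex poly)"
    by (rule poly_eqI) (simp add: coeff_pderiv coeff_map_poly of_rat_mult of_rat_add)
  have "rsquarefree (map_poly of_rat P :: complex poly)"
    unfolding rsquarefree_roots pd rat_eval_def[symmetric]
  proof (intro allI notI)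
    fix z :: complex assume z: "rat_eval P z = 0 \<and> rat_eval (pderiv P) z = 0"
    obtain M where M: "M \<noteq> 0" "rat_eval M z = 0"
      and minM: "\<And>R. R \<noteq> 0 \<Longrightarrow> rat_eval R z = 0 \<Longrightarrow> degree M \<le> degree R"
      using P(1) z ex_has_least_nat[of "\<lambda>P. P \<noteq> 0 \<and> rat_eval P z = 0" P degree] by metis
    have dvd: "M dvd R" if "rat_eval R z = 0" for R
    proof -
      have "rat_eval R z = rat_eval (R div M) z * rat_eval M z + rat_eval (R mod M) z"
        by (metis div_mult_mod_eq rat_eval_add rat_eval_mult)
      then have "rat_eval (R mod M) z = 0" using that M by simp
      then have "R mod M = 0" using minM[of "R mod M"] degree_mod_less[OF M(1), of R] by (metis not_le)
      then show ?thesis by auto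
    qed
    have degM: "degree M > 0"
    proof (rule ccontr)
      assume "\<not> degree M > 0"
      then obtain a where "M = [:a:]" by (auto elim: degree_eq_zeroE)
      then show False using M by simp
    qed
    obtain A where A: "P = M * A" using dvd z by blast
    then have "A \<noteq> 0" using P by auto
    then have "degree P = degree M + degree A" using A M by (simp add: degree_mult_eq)
    \<comment> \<open>The cofactor has smaller degree than \<open>P\<close> and cannot annihilate
      \<open>q\<close>. Hence \<open>M\<close> does, although its degree is at most that of
      \<open>pderiv P\<close>.\<close>
    then have "rat_eval A q \<noteq> 0" using min[of A] \<open>A \<noteq> 0\<close> degM by auto
    then have "rat_eval M q = 0" using P A by (simp add: rat_eval_mult)
    then have "degree P \<le> degree M" using min M by blast
    moreover have "degree M \<le> degree (pderiv P)"
      using dvd z degP by (intro dvd_imp_degree_le) (auto simp: pderiv_eq_0_iff)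
    moreover have "degree (pderiv P) < degree P" using degP by (simp add: degree_pderiv)
    ultimately show False by simp
  qed
  then show thesis using that P by blast
qed

subsection \<open>Decomposition into joint eigenvectors\<close>

text \<open>The polynomial \<open>p\<close> in the operator that sends \<open>g\<close> to the
  function with value \<open>g (q * r)\<close> at \<open>r\<close>, applied to \<open>g\<close>.
  Multiplication by \<open>q\<close> acts on functionals through their argument.\<close>

definition poly_act :: "complex poly \<Rightarrow> 'a::comm_ring_1 \<Rightarrow> ('a \<Rightarrow> complex) \<Rightarrow> 'a \<Rightarrow> complex"
  where "poly_act p q g r = (\<Sum>j\<le>degree p. coeff p j * g (q ^ j * r))"

lemma poly_act_linear_factor:
  "poly_act ([:- z, 1:] * p) q g = poly_act p q (\<lambda>r. g (q * r) - z * g r)"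
proof (cases "p = 0")
  case False
  have deg: "degree ([:- z, 1:] * p) = Suc (degree p)"
    using False by (subst degree_mult_eq) auto
  have c: "coeff ([:- z, 1:] * p) j = coeff (pCons 0 p) j - z * coeff p j" for j
    by simp
  show ?thesis
  proof
    fix r
    have "poly_act ([:- z, 1:] * p) q g r =
        (\<Sum>j\<le>Suc (degree p). coeff (pCons 0 p) j * g (q ^ j * r)) - (\<Sum>j\<le>Suc (degree p). z * coeff p j * g (q ^ j * r))"
      unfolding poly_act_def deg c by (simp only: left_diff_distrib sum_subtractf)
    also have "(\<Sum>j\<le>Suc (degree p). coeff (pCons 0 p) j * g (q ^ j * r)) =
        (\<Sum>j\<le>degree p. coeff p j * g (q ^ Suc j * r))"
      by (subst sum.atMost_Suc_shift) simp
    also have "(\<Sum>j\<le>Suc (degree p). z * coeff p j * g (q ^ j * r)) = (\<Sum>j\<le>degree p. z * coeff p j * g (q ^ j * r))"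
      by (simp add: coeff_eq_0)
    finally show "poly_act ([:- z, 1:] * p) q g r = poly_act p q (\<lambda>r. g (q * r) - z * g r) r"
      by (simp add: poly_act_def sum_subtractf[symmetric] algebra_simps)
  qed
qed (simp add: poly_act_def fun_eq_iff)

text \<open>Diagonalisation of an operator annihilated by a product of distinct linear factors, one
  factor at a time. The class \<open>Cl\<close> carries along properties, such as eigenvalues of
  other operators, that the components have to retain.\<close>

lemma eigen_decomposition:
  assumes Cl: "\<And>g. Cl g \<Longrightarrow> Cl (\<lambda>r. g (q * r))" "\<And>c g. Cl g \<Longrightarrow> Cl (\<lambda>r. c * g r)"
      "\<And>g h. Cl g \<Longrightarrow> Cl h \<Longrightarrow> Cl (\<lambda>r. g r + h r)"
    and "finite Z" "Cl g" "poly_act (\<Prod>z\<in>Z. [:- z, 1:]) q g = (\<lambda>_. 0)"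
  shows "\<exists>e. (\<forall>z\<in>Z. Cl (e z) \<and> (\<forall>r. e z (q * r) = z * e z r)) \<and> g = (\<lambda>r. \<Sum>z\<in>Z. e z r)"
  using assms(4-6)
proof (induction Z arbitrary: g)
  case empty
  then have "g = (\<lambda>_. 0)" by (simp add: poly_act_def fun_eq_iff)
  then show ?case by simp
next
  case (insert z Z)
  define g1 where "g1 = (\<lambda>r. g (q * r) + (- z) * g r)"
  have "Cl g1" unfolding g1_def by (intro Cl insert.prems)
  moreover have "poly_act (\<Prod>z\<in>Z. [:- z, 1:]) q g1 = (\<lambda>_. 0)"
    using insert.prems(2) insert.hyps by (simp add: g1_def poly_act_linear_factor[symmetric] del: mult_pCons_left)
  ultimately obtain e where e: "\<And>w. w \<in> Z \<Longrightarrow> Cl (e w)" "\<And>w r. w \<in> Z \<Longrightarrow> e w (q * r) = w * e w r"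
    and g1: "g1 = (\<lambda>r. \<Sum>w\<in>Z. e w r)"
    using insert.IH[of g1] by blast
  have Cl0: "Cl (\<lambda>_. 0)" using Cl(2)[OF insert.prems(1), of 0] by simp
  \<comment> \<open>On the component for \<open>w\<close> the operator \<open>q - z\<close> is
    multiplication by \<open>w - z\<close>, which is inverted by division. So \<open>s\<close> is a
    preimage of \<open>g1\<close> under \<open>q - z\<close>, and \<open>g - s\<close> is left as an
    eigenvector for \<open>z\<close>.\<close>
  define s where "s = (\<lambda>r. \<Sum>w\<in>Z. 1 / (w - z) * e w r)"
  have "Cl s"
  proof -
    have "Cl (\<lambda>r. \<Sum>w\<in>A. 1 / (w - z) * e w r)" if "A \<subseteq> Z" for A
      using finite_subset[OF that insert.hyps(1)] that
    proof (induction A)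
      case (insert w A)
      then show ?case using Cl(3)[OF Cl(2)[OF e(1)[of w], of "1 / (w - z)"]] by simp
    qed (simp add: Cl0)
    then show ?thesis by (simp add: s_def)
  qed
  define e' where "e' w = (if w = z then (\<lambda>r. g r + (- 1) * s r) else (\<lambda>r. 1 / (w - z) * e w r))" for w
  have "Cl (e' w)" if "w \<in> insert z Z" for w
  proof (cases "w = z")
    case True
    then show ?thesis unfolding e'_def using Cl(3)[OF insert.prems(1) Cl(2)[OF \<open>Cl s\<close>, of "- 1"]] by simp
  next
    case False
    then show ?thesis unfolding e'_def using that Cl(2)[OF e(1), of w "1 / (w - z)"] by simp
  qed
  moreover have "e' w (q * r) = w * e' w r" if "w \<in> insert z Z" for w r
  proof (cases "w = z")
    case True
    have "s (q * r) = (\<Sum>w\<in>Z. w / (w - z) * e w r)"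
      unfolding s_def by (rule sum.cong) (auto simp: e)
    also have "\<dots> = (\<Sum>w\<in>Z. e w r + z * (1 / (w - z) * e w r))"
    proof (rule sum.cong)
      fix w assume "w \<in> Z"
      then have "w - z \<noteq> 0" using insert.hyps by auto
      then show "w / (w - z) * e w r = e w r + z * (1 / (w - z) * e w r)"
        by (simp add: field_simps)
    qed simp
    also have "\<dots> = g1 r + z * s r" by (simp add: g1 s_def sum.distrib sum_distrib_left)
    finally show ?thesis using True by (simp add: e'_def g1_def algebra_simps)
  next
    case False
    then show ?thesis using that e by (simp add: e'_def)
  qed
  moreover have "g = (\<lambda>r. \<Sum>w\<in>insert z Z. e' w r)"
  proof
    fix r
    have "(\<Sum>w\<in>Z. e' w r) = s r" unfolding s_def using insert.hyps by (intro sum.cong) (auto simp: e'_def)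
    then show "g r = (\<Sum>w\<in>insert z Z. e' w r)" using insert.hyps by (simp add: e'_def)
  qed
  ultimately show ?case by blast
qed

text \<open>Finite sums of functions satisfying \<open>P\<close>, without an index set, so that a
  decomposition can be refined componentwise by \<open>sum_of_bind\<close>.\<close>

inductive sum_of :: "(('b \<Rightarrow> complex) \<Rightarrow> bool) \<Rightarrow> ('b \<Rightarrow> complex) \<Rightarrow> bool" for P where
  zero: "sum_of P (\<lambda>_. 0)"
| step: "P e \<Longrightarrow> sum_of P g \<Longrightarrow> sum_of P (\<lambda>x. e x + g x)"

lemma sum_of_add: "sum_of P f \<Longrightarrow> sum_of P g \<Longrightarrow> sum_of P (\<lambda>x. f x + g x)"
proof (induction rule: sum_of.induct)
  case (step e f)
  then have "sum_of P (\<lambda>x. e x + (f x + g x))" by (intro sum_of.step[of P e "\<lambda>x. f x + g x"])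
  then show ?case by (simp add: add.assoc)
qed simp

lemma sum_of_single: "P e \<Longrightarrow> sum_of P e"
  using sum_of.step[OF _ sum_of.zero, of P e] by simp

lemma sum_of_bind:
  assumes "sum_of P g" "\<And>e. P e \<Longrightarrow> sum_of P' e"
  shows "sum_of P' g"
  using assms(1) by induction (auto intro: sum_of.zero sum_of_add assms(2))

lemma sum_of_sum: "finite Z \<Longrightarrow> (\<And>z. z \<in> Z \<Longrightarrow> P (e z)) \<Longrightarrow> sum_of P (\<lambda>r. \<Sum>z\<in>Z. e z r)"
  by (induction Z rule: finite_induct) (auto intro: sum_of.intros)

definition joint_eigen :: "'a set \<Rightarrow> ('a::field_char_0 \<Rightarrow> complex) \<Rightarrow> bool"
  where "joint_eigen J e \<longleftrightarrow> Q_linear e \<and> (\<forall>q\<in>J. \<exists>\<mu>. \<forall>r. e (q * r) = \<mu> * e r)"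

text \<open>A squarefree annihilating polynomial of \<open>q\<close> splits over the complex numbers
  into distinct linear factors. Acting on a rational-linear \<open>g\<close> it gives
  \<open>g\<close> at a multiple of \<open>P(q) = 0\<close>; the leading coefficient is divided
  out.\<close>

lemma annihilated:
  fixes \<omega> :: "'k::finite \<Rightarrow> 'a::field_char_0"
  assumes "number_field_basis \<omega>"
  shows "\<exists>Z. finite Z \<and> (\<forall>g. Q_linear g \<longrightarrow> poly_act (\<Prod>z\<in>Z. [:- z, 1:]) (q :: 'a) g = (\<lambda>_. 0))"
proof -
  obtain P where P: "P \<noteq> 0" "rat_eval P q = 0" "rsquarefree (map_poly of_rat P :: complex poly)"
    by (rule squarefree_annihilator[OF assms])
  define C where "C = (map_poly of_rat P :: complex poly)"
  define Z where "Z = {z. poly C z = 0}"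
  have degC: "degree C = degree P" unfolding C_def by (rule degree_map_poly) auto
  have "C \<noteq> 0" using P(3) by (auto simp: C_def rsquarefree_def)
  have fac: "smult (lead_coeff C) (\<Prod>z\<in>Z. [:- z, 1:]) = C"
    unfolding Z_def by (rule complex_poly_decompose_rsquarefree) (use P in \<open>simp add: C_def\<close>)
  show ?thesis
  proof (intro exI conjI allI impI)
    show "finite Z" unfolding Z_def using \<open>C \<noteq> 0\<close> by (rule poly_roots_finite)
    fix g :: "'a \<Rightarrow> complex" assume g: "Q_linear g"
    show "poly_act (\<Prod>z\<in>Z. [:- z, 1:]) q g = (\<lambda>_. 0)"
    proof
      fix r
      have "lead_coeff C * poly_act (\<Prod>z\<in>Z. [:- z, 1:]) q g r = poly_act (smult (lead_coeff C) (\<Prod>z\<in>Z. [:- z, 1:])) q g r"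
        using \<open>C \<noteq> 0\<close> by (simp add: poly_act_def sum_distrib_left mult_ac)
      also have "\<dots> = (\<Sum>j\<le>degree P. of_rat (coeff P j) * g (q ^ j * r))"
        unfolding fac by (simp add: poly_act_def degC) (simp add: C_def coeff_map_poly)
      also have "\<dots> = g (rat_eval P q * r)"
        using Q_linear_sum[OF g, of "coeff P" "\<lambda>j. q ^ j * r" "{..degree P}"]
        by (simp add: rat_eval_altdef sum_distrib_right mult.assoc)
      also have "\<dots> = 0" using g P(2) unfolding Q_linear_def by (metis add_cancel_right_right mult_zero_left)
      finally show "poly_act (\<Prod>z\<in>Z. [:- z, 1:]) q g r = 0" using \<open>C \<noteq> 0\<close> by simp
    qed
  qed
qed

lemma sum_of_joint_eigen:
  fixes \<omega> :: "'k::finite \<Rightarrow> 'a::field_char_0"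
  assumes \<omega>: "number_field_basis \<omega>" and "finite J" and "Q_linear g"
  shows "sum_of (joint_eigen (J :: 'a set)) g"
  using assms(2,3)
proof (induction J arbitrary: g)
  case empty
  then show ?case by (intro sum_of_single) (simp add: joint_eigen_def)
next
  case (insert q J)
  show ?case
  proof (rule sum_of_bind[OF insert.IH[OF insert.prems]])
    fix e assume e: "joint_eigen J e"
    then obtain \<mu> where \<mu>: "\<And>q' r. q' \<in> J \<Longrightarrow> e (q' * r) = \<mu> q' * e r"
      unfolding joint_eigen_def by metis
    \<comment> \<open>Besides linearity the class remembers the eigenvalues already found for
      \<open>J\<close>. It is stable under the action of \<open>q\<close> because field
      multiplication commutes, so splitting by \<open>q\<close> does not destroy them.\<close>
    define Cl where "Cl h \<longleftrightarrow> Q_linear h \<and> (\<forall>q'\<in>J. \<forall>r. h (q' * r) = \<mu> q' * h r)" for h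
    obtain Z where Z: "finite Z" "\<And>g. Q_linear g \<Longrightarrow> poly_act (\<Prod>z\<in>Z. [:- z, 1:]) q g = (\<lambda>_. 0)"
      using annihilated[OF \<omega>, of q] by blast
    have "Cl e" unfolding Cl_def using e[unfolded joint_eigen_def] \<mu> by blast
    have "\<exists>e'. (\<forall>z\<in>Z. Cl (e' z) \<and> (\<forall>r. e' z (q * r) = z * e' z r)) \<and> e = (\<lambda>r. \<Sum>z\<in>Z. e' z r)"
    proof (rule eigen_decomposition[where Cl = Cl and q = q and g = e and Z = Z, OF _ _ _ Z(1) \<open>Cl e\<close>])
      show "Cl (\<lambda>r. g (q * r))" if "Cl g" for g
        unfolding Cl_def Q_linear_def
      proof (intro conjI allI ballI)
        fix x y r
        show "g (q * (x + y)) = g (q * x) + g (q * y)"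
          using that by (simp add: Cl_def Q_linear_def distrib_left)
        show "g (q * (of_rat r * x)) = of_rat r * g (q * x)"
          using that by (simp add: Cl_def Q_linear_def mult.left_commute[of q])
      next
        fix q' x assume "q' \<in> J"
        then show "g (q * (q' * x)) = \<mu> q' * g (q * x)"
          using that by (simp add: Cl_def mult.left_commute[of q])
      qed
      show "Cl (\<lambda>r. c * g r)" if "Cl g" for c g
        using that by (simp add: Cl_def Q_linear_def distrib_left mult.left_commute[of c])
      show "Cl (\<lambda>r. g r + h r)" if "Cl g" "Cl h" for g h
        using that by (simp add: Cl_def Q_linear_def distrib_left add_ac)
      show "poly_act (\<Prod>z\<in>Z. [:- z, 1:]) q e = (\<lambda>_. 0)"
        by (rule Z(2)) (use e in \<open>simp add: joint_eigen_def\<close>)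
    qed
    then obtain e' where e': "\<And>z. z \<in> Z \<Longrightarrow> Cl (e' z)" "\<And>z r. z \<in> Z \<Longrightarrow> e' z (q * r) = z * e' z r"
      and eq: "e = (\<lambda>r. \<Sum>z\<in>Z. e' z r)" by blast
    show "sum_of (joint_eigen (insert q J)) e"
      unfolding eq
    proof (rule sum_of_sum[OF Z(1)])
      show "joint_eigen (insert q J) (e' z)" if "z \<in> Z" for z
        using e'[OF that] unfolding joint_eigen_def Cl_def by blast
    qed
  qed
qed

text \<open>The eigenvalues on the basis extend linearly to a function \<open>\<sigma>\<close> with
  \<open>e (x * r) = \<sigma> x * e r\<close>. At \<open>r = 1\<close> this says that
  \<open>e\<close> is a multiple of \<open>\<sigma>\<close>, and multiplicativity follows by
  applying it twice.\<close>

lemma joint_eigen_embedding: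
  fixes \<omega> :: "'k::finite \<Rightarrow> 'a::field_char_0"
  assumes \<omega>: "number_field_basis \<omega>" and e: "joint_eigen (range \<omega>) e" "e \<noteq> (\<lambda>_. 0)"
  obtains c \<sigma> where "\<sigma> \<in> embeddings" "e = (\<lambda>x. c * \<sigma> x)"
proof -
  obtain \<mu> where \<mu>: "\<And>j r. e (\<omega> j * r) = \<mu> j * e r"
  proof -
    have "\<forall>j. \<exists>m. \<forall>r. e (\<omega> j * r) = m * e r"
      using e(1) unfolding joint_eigen_def by blast
    then show thesis using that by metis
  qed
  have Ql: "Q_linear e" using e by (simp add: joint_eigen_def)
  define \<sigma> where "\<sigma> x = (\<Sum>j\<in>UNIV. of_rat (coord \<omega> x j) * \<mu> j)" for x
  have mul: "e (x * r) = \<sigma> x * e r" for x r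
  proof -
    have "e (x * r) = e (\<Sum>j\<in>UNIV. of_rat (coord \<omega> x j) * (\<omega> j * r))"
      by (subst (1) coord_sum[OF \<omega>, of x, symmetric]) (simp add: sum_distrib_right mult.assoc)
    then show ?thesis
      by (simp add: Q_linear_sum[OF Ql] \<mu> \<sigma>_def sum_distrib_right mult.assoc)
  qed
  have e1: "e x = e 1 * \<sigma> x" for x using mul[of x 1] by simp
  have "e 1 \<noteq> 0"
  proof
    assume "e 1 = 0"
    then have "e x = 0" for x using e1[of x] by simp
    then show False using e(2) by auto
  qed
  have "\<sigma> \<in> embeddings"
    unfolding embeddings_def
  proof (intro CollectI conjI allI)
    show "\<sigma> 1 = 1" using e1[of 1] \<open>e 1 \<noteq> 0\<close> by simp
    show "\<sigma> (x + y) = \<sigma> x + \<sigma> y" for x y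
    proof -
      have "e 1 * \<sigma> (x + y) = e 1 * (\<sigma> x + \<sigma> y)"
        using Ql unfolding distrib_left e1[symmetric] by (simp add: Q_linear_def)
      then show ?thesis using \<open>e 1 \<noteq> 0\<close> by simp
    qed
    show "\<sigma> (x * y) = \<sigma> x * \<sigma> y" for x y
      using mul[of x y] e1[of "x * y"] e1[of y] \<open>e 1 \<noteq> 0\<close> by simp
  qed
  then show thesis by (rule that) (rule ext, rule e1)
qed

subsection \<open>The matrix of embeddings\<close>

text \<open>Because embeddings span all functionals, \<open>k\<close> of them have independent value
  vectors; linear independence of characters then excludes any further embedding. \<open>W\<close>
  is the inverse of the matrix of values, and its columns later supply the dual directions.\<close>

lemma embedding_matrix:
  fixes \<omega> :: "'k::finite \<Rightarrow> 'a::field_char_0"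
  assumes \<omega>: "number_field_basis \<omega>"
  obtains e :: "'k \<Rightarrow> 'a \<Rightarrow> complex" and W :: "complex^'k^'k"
  where "bij_betw e UNIV embeddings"
    "\<And>i l. (\<Sum>j\<in>UNIV. e i (\<omega> j) * W $ j $ l) = (if i = l then 1 else 0)"
    "\<And>j l. (\<Sum>i\<in>UNIV. W $ j $ i * e i (\<omega> l)) = (if j = l then 1 else 0)"
proof -
  define V where "V \<sigma> = (\<chi> j. \<sigma> (\<omega> j))" for \<sigma> :: "'a \<Rightarrow> complex"
  define P where "P e \<longleftrightarrow> (\<exists>c \<sigma>. \<sigma> \<in> embeddings \<and> e = (\<lambda>x. c * \<sigma> x))" for e :: "'a \<Rightarrow> complex"
  have dec: "sum_of P g" if "Q_linear g" for g
  proof (rule sum_of_bind[OF sum_of_joint_eigen[OF \<omega> _ that, of "range \<omega>"]])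
    show "sum_of P e" if eig: "joint_eigen (range \<omega>) e" for e
    proof (cases "e = (\<lambda>_. 0)")
      case False
      obtain c \<sigma> where "\<sigma> \<in> embeddings" "e = (\<lambda>x. c * \<sigma> x)"
        by (rule joint_eigen_embedding[OF \<omega> eig False])
      then have "P e" unfolding P_def by blast
      then show ?thesis by (rule sum_of_single)
    qed (simp add: sum_of.zero)
  qed simp
  have inspan: "V g \<in> vec.span (V ` embeddings)" if "sum_of P g" for g
    using that
  proof induction
    case zero
    have "V (\<lambda>_. 0) = 0" by (simp add: V_def vec_eq_iff)
    then show ?case by (simp add: vec.span_zero)
  next
    case (step e g)
    then obtain c \<sigma> where e: "\<sigma> \<in> embeddings" "e = (\<lambda>x. c * \<sigma> x)" by (auto simp: P_def)
    have "V (\<lambda>x. e x + g x) = c *s V \<sigma> + V g" by (simp add: V_def vec_eq_iff e)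
    then show ?case using step.IH e(1) by (simp add: vec.span_add vec.span_scale vec.span_base)
  qed
  \<comment> \<open>Any vector \<open>y\<close> consists of the values on the basis of some
    rational-linear functional. Decomposing that functional into multiples of embeddings puts
    \<open>y\<close> into the span.\<close>
  have span: "vec.span (V ` embeddings) = UNIV"
  proof (intro set_eqI iffI UNIV_I)
    fix y :: "complex^'k"
    define g where "g x = (\<Sum>j\<in>UNIV. of_rat (coord \<omega> x j) * y $ j)" for x
    have "Q_linear g"
      unfolding Q_linear_def
    proof (intro conjI allI)
      fix x z r
      have "coord \<omega> (x + z) j = coord \<omega> x j + coord \<omega> z j" for j
        using coord_linear[OF \<omega>, of "UNIV :: bool set" "\<lambda>_. 1" "\<lambda>b. if b then x else z" j] by (simp add: UNIV_bool add.commute)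
      then show "g (x + z) = g x + g z" by (simp add: g_def of_rat_add distrib_right sum.distrib)
      have "coord \<omega> (of_rat r * x) j = r * coord \<omega> x j" for j
        using coord_linear[OF \<omega>, of "{()}" "\<lambda>_. r" "\<lambda>_. x" j] by simp
      then show "g (of_rat r * x) = of_rat r * g x"
        by (simp add: g_def of_rat_mult sum_distrib_left mult.assoc)
    qed
    moreover have "V g = y"
      by (simp add: V_def g_def vec_eq_iff coord_basis[OF \<omega>] if_distrib[of of_rat] sum_delta_mult cong: if_cong)
    ultimately show "y \<in> vec.span (V ` embeddings)" using inspan dec by metis
  qed
  obtain B where B: "B \<subseteq> V ` embeddings" "vec.independent B" "V ` embeddings \<subseteq> vec.span B"
    using vec.maximal_independent_subset by blast
  have spanB: "vec.span B = UNIV"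
    using vec.span_mono[OF B(3)] by (simp add: span vec.span_span) auto
  have finB: "finite B" using B(2) by (rule vec.finiteI_independent)
  have "card B = vec.dim (UNIV :: (complex^'k) set)"
    using vec.dim_eq_card[of B UNIV] B(2) spanB by simp
  then have "card B = CARD('k)" by (simp add: card_cart_basis vec.dimension_def vec.dim_UNIV)
  then obtain b where b: "bij_betw b (UNIV :: 'k set) B"
    using finite_same_card_bij[of "UNIV :: 'k set" B] finB by auto
  have "\<forall>i. \<exists>\<sigma>. \<sigma> \<in> embeddings \<and> V \<sigma> = b i"
    using b B(1) by (metis (no_types, lifting) UNIV_I bij_betw_apply imageE subset_iff)
  then obtain e where e: "\<And>i. e i \<in> embeddings" "\<And>i. V (e i) = b i" by metis
  have inj: "inj e" using e(2) b by (metis bij_betw_imp_inj_on injI inj_eq)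
  define A where "A = (\<chi> i j. e i (\<omega> j))"
  have rowA: "row i A = b i" for i
    using e(2)[of i] by (simp add: A_def row_def V_def vec_eq_iff)
  have indep: "c i = 0" if "(\<Sum>i\<in>UNIV. c i *s b i) = 0" for c i
  proof -
    have injb: "inj b" using b by (rule bij_betw_imp_inj_on)
    have "(\<Sum>v\<in>B. c (inv b v) *s v) = (\<Sum>i\<in>UNIV. c i *s b i)"
      using sum.reindex_bij_betw[OF b, of "\<lambda>v. c (inv b v) *s v"] by (simp add: inv_f_f[OF injb])
    then have "(\<Sum>v\<in>B. c (inv b v) *s v) = 0" using that by simp
    from vec.independentD[OF B(2) finB order_refl this, of "b i"] show ?thesis
      using b by (simp add: inv_f_f[OF injb] bij_betw_apply)
  qed
  then obtain W where W: "A ** W = mat 1"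
    using matrix_right_invertible_independent_rows[of A] by (auto simp: rowA)
  then have W': "W ** A = mat 1" by (simp add: matrix_left_right_inverse)
  have AW: "(\<Sum>j\<in>UNIV. e i (\<omega> j) * W $ j $ l) = (if i = l then 1 else 0)" for i l
    using W by (simp add: vec_eq_iff matrix_matrix_mult_def mat_def A_def)
  have WA: "(\<Sum>i\<in>UNIV. W $ j $ i * e i (\<omega> l)) = (if j = l then 1 else 0)" for j l
    using W' by (simp add: vec_eq_iff matrix_matrix_mult_def mat_def A_def)
  have "\<tau> \<in> range e" if \<tau>: "\<tau> \<in> embeddings" for \<tau>
  proof -
    \<comment> \<open>The coefficients of \<open>\<tau>\<close> in the chosen \<open>k\<close>
      embeddings, found by applying the inverse matrix.\<close>
    define c where "c i = (\<Sum>j\<in>UNIV. \<tau> (\<omega> j) * W $ j $ i)" for i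
    have "(\<Sum>i\<in>UNIV. c i * e i (\<omega> l)) = \<tau> (\<omega> l)" for l
    proof -
      have "(\<Sum>i\<in>UNIV. c i * e i (\<omega> l)) = (\<Sum>j\<in>UNIV. \<tau> (\<omega> j) * (\<Sum>i\<in>UNIV. W $ j $ i * e i (\<omega> l)))"
        unfolding c_def sum_distrib_left sum_distrib_right by (subst sum.swap) (simp add: mult.assoc)
      also have "\<dots> = \<tau> (\<omega> l)" unfolding WA by (simp add: sum_delta_mult)
      finally show ?thesis .
    qed
    then have expand: "(\<Sum>i\<in>UNIV. c i * e i x) = \<tau> x" for x
    proof -
      assume *: "\<And>l. (\<Sum>i\<in>UNIV. c i * e i (\<omega> l)) = \<tau> (\<omega> l)"
      have "(\<Sum>i\<in>UNIV. c i * e i x) = (\<Sum>i\<in>UNIV. c i * (\<Sum>j\<in>UNIV. of_rat (coord \<omega> x j) * e i (\<omega> j)))"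
        by (intro sum.cong refl arg_cong2[where f = "(*)"] Q_linear_expand[OF \<omega> embedding_Q_linear[OF e(1)]])
      also have "\<dots> = (\<Sum>j\<in>UNIV. of_rat (coord \<omega> x j) * (\<Sum>i\<in>UNIV. c i * e i (\<omega> j)))"
        unfolding sum_distrib_left by (subst sum.swap) (simp add: mult_ac)
      also have "\<dots> = \<tau> x" unfolding * by (rule Q_linear_expand[OF \<omega> embedding_Q_linear[OF \<tau>], symmetric])
      finally show ?thesis .
    qed
    have mult: "\<tau> (x * y) = \<tau> x * \<tau> y" "e i (x * y) = e i x * e i y" for x y i
      using \<tau> e(1)[of i] by (auto simp: embeddings_def)
    \<comment> \<open>Dedekind's argument: expanding \<open>\<tau>\<close> at
      \<open>x * \<omega> l\<close> in two ways gives a relation between independent rows with these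
      coefficients. An embedding with \<open>c i \<noteq> 0\<close> must then agree with
      \<open>\<tau>\<close> everywhere.\<close>
    have zero: "c i * (e i x - \<tau> x) = 0" for i x
    proof (rule indep[of "\<lambda>i. c i * (e i x - \<tau> x)"])
      have "(\<Sum>i\<in>UNIV. c i * (e i x - \<tau> x) * e i (\<omega> l)) = (\<Sum>i\<in>UNIV. c i * e i (x * \<omega> l)) - \<tau> x * (\<Sum>i\<in>UNIV. c i * e i (\<omega> l))" for l
        by (simp add: mult algebra_simps sum_subtractf sum_distrib_left)
      also have "\<dots> l = 0" for l unfolding expand mult(1) by simp
      finally show "(\<Sum>i\<in>UNIV. (c i * (e i x - \<tau> x)) *s b i) = 0"
        by (simp add: vec_eq_iff e(2)[symmetric] V_def)
    qed
    have "\<exists>i. c i \<noteq> 0"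
    proof (rule ccontr)
      assume "\<not> ?thesis"
      then have "\<tau> 1 = 0" using expand[of 1] by simp
      then show False using \<tau> by (simp add: embeddings_def)
    qed
    then obtain i where "c i \<noteq> 0" by blast
    then have "e i = \<tau>" using zero[of i] by auto
    then show ?thesis by blast
  qed
  then have "bij_betw e UNIV embeddings" using inj e(1) by (auto simp: bij_betw_def)
  then show thesis using that AW WA by blast
qed

lemma finite_embeddings:
  assumes "number_field_basis (\<omega> :: 'k::finite \<Rightarrow> 'a::field_char_0)"
  shows "finite (embeddings :: ('a \<Rightarrow> complex) set)"
  proof -
  obtain e :: "'k \<Rightarrow> 'a \<Rightarrow> complex" and W where "bij_betw e UNIV embeddings"
    by (rule embedding_matrix[OF assms])
  then show ?thesis using bij_betw_finite[of e UNIV embeddings] by simp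
qed

text \<open>A column of the inverse matrix is dual to one embedding but complex; its real and
  imaginary parts are real vectors \<open>a\<close> and \<open>b\<close>, and the duality holds for
  \<open>a + \<i> b\<close>.\<close>

lemma dual_direction:
  fixes \<omega> :: "'k::finite \<Rightarrow> 'a::field_char_0"
  assumes "number_field_basis \<omega>" "\<sigma> \<in> embeddings"
  obtains a b where "\<And>\<tau>. \<tau> \<in> embeddings \<Longrightarrow>
    emb_coord \<omega> \<tau> a + \<i> * emb_coord \<omega> \<tau> b = (if \<tau> = \<sigma> then 1 else 0)"
proof -
  obtain e :: "'k \<Rightarrow> 'a \<Rightarrow> complex" and W where e: "bij_betw e UNIV embeddings"
    and W: "\<And>i l. (\<Sum>j\<in>UNIV. e i (\<omega> j) * W $ j $ l) = (if i = l then 1 else 0)"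
    using embedding_matrix[OF assms(1)] by metis
  obtain l where l: "\<sigma> = e l" using e assms(2) by (auto simp: bij_betw_def)
  show thesis
  proof (rule that[of "\<chi> j. Re (W $ j $ l)" "\<chi> j. Im (W $ j $ l)"])
    fix \<tau> :: "'a \<Rightarrow> complex" assume "\<tau> \<in> embeddings"
    then obtain i where i: "\<tau> = e i" using e by (auto simp: bij_betw_def)
    have "emb_coord \<omega> \<tau> (\<chi> j. Re (W $ j $ l)) + \<i> * emb_coord \<omega> \<tau> (\<chi> j. Im (W $ j $ l)) =
        (\<Sum>j\<in>UNIV. (of_real (Re (W $ j $ l)) + \<i> * of_real (Im (W $ j $ l))) * \<tau> (\<omega> j))"
      by (simp add: emb_coord_def sum_distrib_left sum.distrib distrib_right mult.assoc)
    also have "\<dots> = (\<Sum>j\<in>UNIV. e i (\<omega> j) * W $ j $ l)"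
      by (simp add: complex_eq[symmetric] i mult.commute)
    also have "\<dots> = (if \<tau> = \<sigma> then 1 else 0)"
      using bij_betw_imp_inj_on[OF e] by (simp add: W i l inj_eq)
    finally show "emb_coord \<omega> \<tau> (\<chi> j. Re (W $ j $ l)) + \<i> * emb_coord \<omega> \<tau> (\<chi> j. Im (W $ j $ l)) =
      (if \<tau> = \<sigma> then 1 else 0)" .
  qed
qed

subsection \<open>The phase as a sum over embeddings\<close>

text \<open>The row of values \<open>\<sigma> (\<omega> j)\<close> is a left eigenvector of
  \<open>M\<close>. The row is the same for all matrices, so eigenvalues add and multiply under sums
  and products.\<close>

definition has_eigenvalue :: "('k::finite \<Rightarrow> 'a::field_char_0) \<Rightarrow> ('a \<Rightarrow> complex) \<Rightarrow> real^'k^'k \<Rightarrow> complex \<Rightarrow> bool"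
  where "has_eigenvalue \<omega> \<sigma> M z \<longleftrightarrow> (\<forall>l. (\<Sum>j\<in>UNIV. \<sigma> (\<omega> j) * of_real (M $ j $ l)) = z * \<sigma> (\<omega> l))"

lemma has_eigenvalue_mult:
  assumes "has_eigenvalue \<omega> \<sigma> M z" "has_eigenvalue \<omega> \<sigma> N w"
  shows "has_eigenvalue \<omega> \<sigma> (M ** N) (z * w)"
  unfolding has_eigenvalue_def
proof
  fix l
  have "(\<Sum>j\<in>UNIV. \<sigma> (\<omega> j) * of_real ((M ** N) $ j $ l)) =
      (\<Sum>m\<in>UNIV. (\<Sum>j\<in>UNIV. \<sigma> (\<omega> j) * of_real (M $ j $ m)) * of_real (N $ m $ l))"
    unfolding matrix_matrix_mult_def sum_distrib_right
    by (subst sum.swap) (simp add: sum_distrib_left mult.assoc)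
  also have "\<dots> = z * (\<Sum>m\<in>UNIV. \<sigma> (\<omega> m) * of_real (N $ m $ l))"
    using assms(1) by (simp add: has_eigenvalue_def sum_distrib_left mult.assoc)
  also have "\<dots> = z * w * \<sigma> (\<omega> l)" using assms(2) by (simp add: has_eigenvalue_def)
  finally show "(\<Sum>j\<in>UNIV. \<sigma> (\<omega> j) * of_real ((M ** N) $ j $ l)) = z * w * \<sigma> (\<omega> l)" .
qed

lemma has_eigenvalue_one: "has_eigenvalue \<omega> \<sigma> (mat 1) 1"
  by (simp add: has_eigenvalue_def mat_def if_distrib[of of_real] sum_delta_mult cong: if_cong)

lemma has_eigenvalue_sum:
  assumes "\<And>i. i \<in> I \<Longrightarrow> has_eigenvalue \<omega> \<sigma> (M i) (z i)"
  shows "has_eigenvalue \<omega> \<sigma> (\<Sum>i\<in>I. M i) (\<Sum>i\<in>I. z i)"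
  unfolding has_eigenvalue_def
proof
  fix l
  have "(\<Sum>j\<in>UNIV. \<sigma> (\<omega> j) * of_real ((\<Sum>i\<in>I. M i) $ j $ l)) =
      (\<Sum>i\<in>I. \<Sum>j\<in>UNIV. \<sigma> (\<omega> j) * of_real (M i $ j $ l))"
    by (subst sum.swap) (simp add: sum_distrib_left)
  then show "(\<Sum>j\<in>UNIV. \<sigma> (\<omega> j) * of_real ((\<Sum>i\<in>I. M i) $ j $ l)) = (\<Sum>i\<in>I. z i) * \<sigma> (\<omega> l)"
    using assms by (simp add: has_eigenvalue_def sum_distrib_right)
qed

lemma has_eigenvalue_A_star:
  assumes "number_field_basis \<omega>" "\<sigma> \<in> embeddings"
  shows "has_eigenvalue \<omega> \<sigma> (A_star \<omega> x) (emb_coord \<omega> \<sigma> x)"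
  unfolding has_eigenvalue_def
proof
  fix l
  have re: "complex_of_real (of_rat r) = of_rat r" for r
    by (cases r) (simp add: of_rat_rat)
  have "(\<Sum>j\<in>UNIV. \<sigma> (\<omega> j) * of_real (A_star \<omega> x $ j $ l)) =
      (\<Sum>m\<in>UNIV. of_real (x $ m) * (\<Sum>j\<in>UNIV. of_rat (coord \<omega> (\<omega> m * \<omega> l) j) * \<sigma> (\<omega> j)))"
    unfolding sum_distrib_left
    by (subst sum.swap) (simp add: A_star_def mult_matrix_def sum_distrib_left re mult_ac)
  also have "\<dots> = (\<Sum>m\<in>UNIV. of_real (x $ m) * \<sigma> (\<omega> m * \<omega> l))"
    by (intro sum.cong refl arg_cong2[where f = "(*)"] Q_linear_expand[OF assms(1) embedding_Q_linear[OF assms(2)], symmetric])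
  also have "\<dots> = emb_coord \<omega> \<sigma> x * \<sigma> (\<omega> l)"
    using assms(2) by (simp add: embeddings_def emb_coord_def sum_distrib_right mult.assoc)
  finally show "(\<Sum>j\<in>UNIV. \<sigma> (\<omega> j) * of_real (A_star \<omega> x $ j $ l)) = emb_coord \<omega> \<sigma> x * \<sigma> (\<omega> l)" .
qed

text \<open>The left eigenvectors of all embeddings form a basis, with inverse \<open>W\<close>, so
  the entries are recovered from the eigenvalues. Commutativity of the real algebra follows, since
  products in either order have equal eigenvalues.\<close>

lemma eigenvalues_determine:
  fixes \<omega> :: "'k::finite \<Rightarrow> 'a::field_char_0"
  assumes "number_field_basis \<omega>"
    and "\<And>\<sigma>. \<sigma> \<in> embeddings \<Longrightarrow> has_eigenvalue \<omega> \<sigma> M (z \<sigma>)"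
    and "\<And>\<sigma>. \<sigma> \<in> embeddings \<Longrightarrow> has_eigenvalue \<omega> \<sigma> N (z \<sigma>)"
  shows "M = N"
proof -
  obtain e :: "'k \<Rightarrow> 'a \<Rightarrow> complex" and W where e: "bij_betw e UNIV embeddings"
    and W: "\<And>j l. (\<Sum>i\<in>UNIV. W $ j $ i * e i (\<omega> l)) = (if j = l then 1 else 0)"
    using embedding_matrix[OF assms(1)] by metis
  have ei: "e i \<in> embeddings" for i using e bij_betw_apply by fastforce
  have *: "complex_of_real (M $ j $ l) = (\<Sum>i\<in>UNIV. W $ j $ i * (z (e i) * e i (\<omega> l)))"
    if "\<And>\<sigma>. \<sigma> \<in> embeddings \<Longrightarrow> has_eigenvalue \<omega> \<sigma> M (z \<sigma>)" for M j l
  proof -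
    have "complex_of_real (M $ j $ l) = (\<Sum>m\<in>UNIV. (\<Sum>i\<in>UNIV. W $ j $ i * e i (\<omega> m)) * of_real (M $ m $ l))"
      unfolding W by (simp add: sum_delta_mult)
    also have "\<dots> = (\<Sum>i\<in>UNIV. W $ j $ i * (\<Sum>m\<in>UNIV. e i (\<omega> m) * of_real (M $ m $ l)))"
      unfolding sum_distrib_left sum_distrib_right by (subst sum.swap) (simp add: mult.assoc)
    finally show ?thesis using that[OF ei] by (simp add: has_eigenvalue_def)
  qed
  show ?thesis
  proof (intro vec_eq_iff[THEN iffD2] allI)
    fix j l
    show "M $ j $ l = N $ j $ l"
    proof -
      have "complex_of_real (M $ j $ l) = complex_of_real (N $ j $ l)"
        by (rule trans[OF *[OF assms(2)] *[OF assms(3), symmetric]])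
      then show ?thesis by (simp only: of_real_eq_iff)
    qed
  qed
qed

text \<open>In the basis of left eigenvectors the matrix is diagonal, and conjugation by
  \<open>W\<close> preserves the trace.\<close>

lemma trace_eq_sum_eigenvalues:
  fixes \<omega> :: "'k::finite \<Rightarrow> 'a::field_char_0"
  assumes "number_field_basis \<omega>"
    and "\<And>\<sigma>. \<sigma> \<in> embeddings \<Longrightarrow> has_eigenvalue \<omega> \<sigma> M (z \<sigma>)"
  shows "complex_of_real (trace M) = (\<Sum>\<sigma>\<in>embeddings. z \<sigma>)"
proof -
  obtain e :: "'k \<Rightarrow> 'a \<Rightarrow> complex" and W where e: "bij_betw e UNIV embeddings"
    and W: "\<And>i l. (\<Sum>j\<in>UNIV. e i (\<omega> j) * W $ j $ l) = (if i = l then 1 else 0)"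
      "\<And>j l. (\<Sum>i\<in>UNIV. W $ j $ i * e i (\<omega> l)) = (if j = l then 1 else 0)"
    by (rule embedding_matrix[OF assms(1)]) blast
  have ei: "e i \<in> embeddings" for i using e bij_betw_apply by fastforce
  have "complex_of_real (M $ l $ l) = (\<Sum>i\<in>UNIV. W $ l $ i * (z (e i) * e i (\<omega> l)))" for l
  proof -
    have "complex_of_real (M $ l $ l) = (\<Sum>m\<in>UNIV. (\<Sum>i\<in>UNIV. W $ l $ i * e i (\<omega> m)) * of_real (M $ m $ l))"
      unfolding W by (simp add: sum_delta_mult)
    also have "\<dots> = (\<Sum>i\<in>UNIV. W $ l $ i * (\<Sum>m\<in>UNIV. e i (\<omega> m) * of_real (M $ m $ l)))"
      unfolding sum_distrib_left sum_distrib_right by (subst sum.swap) (simp add: mult.assoc)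
    finally show ?thesis using assms(2)[OF ei] by (simp add: has_eigenvalue_def)
  qed
  then have "complex_of_real (trace M) = (\<Sum>l\<in>UNIV. \<Sum>i\<in>UNIV. W $ l $ i * (z (e i) * e i (\<omega> l)))"
    by (simp add: trace_def)
  also have "\<dots> = (\<Sum>i\<in>UNIV. z (e i) * (\<Sum>l\<in>UNIV. e i (\<omega> l) * W $ l $ i))"
    unfolding sum_distrib_left by (subst sum.swap) (simp add: mult_ac)
  also have "\<dots> = (\<Sum>\<sigma>\<in>embeddings. z \<sigma>)"
    unfolding W using sum.reindex_bij_betw[OF e, of z] by simp
  finally show ?thesis .
qed

lemma emb_star_A_star: "number_field_basis \<omega> \<Longrightarrow> emb_star \<omega> \<sigma> (A_star \<omega> x) = emb_coord \<omega> \<sigma> x"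
  by (simp add: emb_star_def inv_f_f[OF inj_A_star])

lemma has_eigenvalue_mat_eval:
  fixes \<omega> :: "'k::finite \<Rightarrow> 'a::field_char_0" and f :: "('n::finite, real^'k^'k) mpoly"
  assumes \<omega>: "number_field_basis \<omega>" and \<sigma>: "\<sigma> \<in> embeddings"
    and f: "\<And>\<beta>. Poly_Mapping.lookup f \<beta> \<in> real_algebra \<omega>"
  shows "has_eigenvalue \<omega> \<sigma> (mat_eval f (\<lambda>l. A_star \<omega> (x $ l))) (ceval (emb_poly \<omega> \<sigma> f) (emb_vec \<omega> \<sigma> x))"
proof -
  define X where "X l = A_star \<omega> (x $ l)" for l
  \<comment> \<open>Commutation makes the fold in the evaluation of monomials independent of the
    order of the variables.\<close>
  have comm: "X i ** X j = X j ** X i" for i j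
  proof (rule eigenvalues_determine[OF \<omega>])
    fix \<sigma> :: "'a \<Rightarrow> complex" assume \<sigma>: "\<sigma> \<in> embeddings"
    show "has_eigenvalue \<omega> \<sigma> (X i ** X j) (emb_coord \<omega> \<sigma> (x $ i) * emb_coord \<omega> \<sigma> (x $ j))"
      using has_eigenvalue_A_star[OF \<omega> \<sigma>] unfolding X_def by (intro has_eigenvalue_mult)
    show "has_eigenvalue \<omega> \<sigma> (X j ** X i) (emb_coord \<omega> \<sigma> (x $ i) * emb_coord \<omega> \<sigma> (x $ j))"
      using has_eigenvalue_A_star[OF \<omega> \<sigma>] unfolding X_def
      by (subst mult.commute) (intro has_eigenvalue_mult)
  qed
  have eX: "has_eigenvalue \<omega> \<sigma> (X l) (emb_vec \<omega> \<sigma> x $ l)" for l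
    using has_eigenvalue_A_star[OF \<omega> \<sigma>] by (simp add: X_def emb_vec_def emb_star_A_star[OF \<omega>])
  have pow: "has_eigenvalue \<omega> \<sigma> (((**) (X l) ^^ m) N) ((emb_vec \<omega> \<sigma> x $ l) ^ m * w)"
    if "has_eigenvalue \<omega> \<sigma> N w" for l m N w
    by (induction m) (use that has_eigenvalue_mult[OF eX] in \<open>auto simp: mult.assoc\<close>)
  have mon: "has_eigenvalue \<omega> \<sigma> (Finite_Set.fold (\<lambda>i. (**) (X i) ^^ Poly_Mapping.lookup \<beta> i) (mat 1) A)
      (\<Prod>i\<in>A. (emb_vec \<omega> \<sigma> x $ i) ^ Poly_Mapping.lookup \<beta> i)" if "finite A" for \<beta> :: "'n \<Rightarrow>\<^sub>0 nat" and A
  proof -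
    have cf: "((**) (X j) ^^ m) \<circ> ((**) (X i) ^^ n) = ((**) (X i) ^^ n) \<circ> ((**) (X j) ^^ m)" for i j m n
    proof -
      have 0: "X j ** (X i ** N) = X i ** (X j ** N)" for N by (simp add: matrix_mul_assoc comm[of i j])
      have 1: "X j ** ((**) (X i) ^^ n) N = ((**) (X i) ^^ n) (X j ** N)" for N
        by (induction n) (auto simp: 0)
      have "((**) (X j) ^^ m) (((**) (X i) ^^ n) N) = ((**) (X i) ^^ n) (((**) (X j) ^^ m) N)" for N
        by (induction m) (auto simp: 1)
      then show ?thesis by (intro ext) (simp only: o_apply)
    qed
    interpret comp_fun_commute "\<lambda>i. (**) (X i) ^^ Poly_Mapping.lookup \<beta> i"
      by unfold_locales (rule cf)
    show ?thesis using that
      by (induction A) (auto simp: has_eigenvalue_one intro!: pow)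
  qed
  have coef: "has_eigenvalue \<omega> \<sigma> (Poly_Mapping.lookup f \<beta>) (emb_star \<omega> \<sigma> (Poly_Mapping.lookup f \<beta>))" for \<beta>
    using f[of \<beta>] has_eigenvalue_A_star[OF \<omega> \<sigma>] by (auto simp: real_algebra_def emb_star_A_star[OF \<omega>])
  have "A_star \<omega> 0 = 0" by (simp add: A_star_def)
  then have "emb_star \<omega> \<sigma> 0 = 0" using emb_star_A_star[OF \<omega>, of \<sigma> 0] by (simp add: emb_coord_def)
  then have lk: "Poly_Mapping.lookup (emb_poly \<omega> \<sigma> f) \<beta> = emb_star \<omega> \<sigma> (Poly_Mapping.lookup f \<beta>)" for \<beta>
    by (simp add: emb_poly_def Poly_Mapping.map.rep_eq when_def)
  have "Poly_Mapping.keys (emb_poly \<omega> \<sigma> f) \<subseteq> Poly_Mapping.keys f"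
    using \<open>emb_star \<omega> \<sigma> 0 = 0\<close> by (auto simp: in_keys_iff lk)
  from ceval_superset[OF _ this] have "ceval (emb_poly \<omega> \<sigma> f) (emb_vec \<omega> \<sigma> x) =
      (\<Sum>\<beta>\<in>Poly_Mapping.keys f. emb_star \<omega> \<sigma> (Poly_Mapping.lookup f \<beta>) *
        (\<Prod>i\<in>UNIV. (emb_vec \<omega> \<sigma> x $ i) ^ Poly_Mapping.lookup \<beta> i))"
    by (simp add: lk)
  then show ?thesis
    unfolding mat_eval_def X_def[symmetric]
    by (auto intro!: has_eigenvalue_sum has_eigenvalue_mult coef mon)
qed

lemma phase_eq_sum:
  fixes \<omega> :: "'k::finite \<Rightarrow> 'a::field_char_0" and f :: "('n::finite, real^'k^'k) mpoly"
  assumes "number_field_basis \<omega>" "\<And>\<beta>. Poly_Mapping.lookup f \<beta> \<in> real_algebra \<omega>"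
  shows "complex_of_real (phase \<omega> f x) = (\<Sum>\<sigma>\<in>embeddings. ceval (emb_poly \<omega> \<sigma> f) (emb_vec \<omega> \<sigma> x))"
  unfolding phase_def
  by (rule trace_eq_sum_eigenvalues[OF assms(1)]) (use has_eigenvalue_mat_eval[OF assms(1) _ assms(2)] in auto)

section \<open>Derivatives of smooth functions\<close>

lemma times_cont_diff_continuous: "times_cont_diff m g \<Longrightarrow> continuous_on UNIV g"
  by (cases m) (auto simp: continuous_on_eq_continuous_at intro: differentiable_imp_continuous_within)

lemma frechet_derivative_add_pt:
  assumes "f differentiable (at x)" "g differentiable (at x)"
  shows "frechet_derivative (\<lambda>x. f x + g x) (at x) v = frechet_derivative f (at x) v + frechet_derivative g (at x) v"
  using frechet_derivative_at[OF has_derivative_add[OF assms[unfolded frechet_derivative_works]]] by metis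

lemma frechet_derivative_cmult_pt:
  fixes f :: "'v::euclidean_space \<Rightarrow> complex"
  assumes "f differentiable (at x)"
  shows "frechet_derivative (\<lambda>x. c * f x) (at x) v = c * frechet_derivative f (at x) v"
  using frechet_derivative_at[OF has_derivative_mult_right[OF assms[unfolded frechet_derivative_works]]] by metis

lemma times_cont_diff_add:
  "times_cont_diff m f \<Longrightarrow> times_cont_diff m g \<Longrightarrow> times_cont_diff m (\<lambda>x. f x + g x)"
proof (induction m arbitrary: f g)
  case (Suc m)
  then show ?case by (auto simp: frechet_derivative_add_pt intro: differentiable_add)
qed (auto intro: continuous_on_add)

lemma times_cont_diff_cmult:
  fixes f :: "'v::euclidean_space \<Rightarrow> complex"
  shows "times_cont_diff m f \<Longrightarrow> times_cont_diff m (\<lambda>x. c * f x)"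
proof (induction m arbitrary: f)
  case (Suc m)
  then show ?case by (auto simp: frechet_derivative_cmult_pt intro: differentiable_mult)
qed (auto intro: continuous_on_mult_left)

lemma smooth_frechet: "smooth g \<Longrightarrow> smooth (\<lambda>x. frechet_derivative g (at x) v)"
  unfolding smooth_def by (metis times_cont_diff.simps(2))

lemma smooth_differentiable: "smooth g \<Longrightarrow> g differentiable (at x)"
  unfolding smooth_def by (metis times_cont_diff.simps(2))

lemma smooth_continuous: "smooth g \<Longrightarrow> continuous_on UNIV g"
  unfolding smooth_def by (metis times_cont_diff_continuous)

lemma dird_smooth:
  assumes "smooth \<psi>"
  shows "dird v \<psi> (\<lambda>x. frechet_derivative \<psi> (at x) v)"
  unfolding dird_def
proof
  fix x
  have d: "(\<psi> has_derivative frechet_derivative \<psi> (at x)) (at (x + 0 *\<^sub>R v))"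
    using smooth_differentiable[OF assms] by (simp add: frechet_derivative_works[symmetric])
  have "((\<lambda>t. x + t *\<^sub>R v) has_derivative (\<lambda>t. t *\<^sub>R v)) (at 0)"
    by (auto intro!: derivative_eq_intros)
  from has_derivative_compose[OF this d]
  have "((\<lambda>t. \<psi> (x + t *\<^sub>R v)) has_derivative (\<lambda>t. frechet_derivative \<psi> (at x) (t *\<^sub>R v))) (at 0)" .
  moreover have "frechet_derivative \<psi> (at x) (t *\<^sub>R v) = t *\<^sub>R frechet_derivative \<psi> (at x) v" for t
    using linear_frechet_derivative[OF smooth_differentiable[OF assms]] by (simp add: linear_scale)
  ultimately show "((\<lambda>t. \<psi> (x + t *\<^sub>R v)) has_vector_derivative frechet_derivative \<psi> (at x) v) (at 0)"
    by (simp add: has_vector_derivative_def)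
qed

section \<open>Derivatives of the amplitude along complexified directions\<close>

definition cdiff :: "'v::euclidean_space \<Rightarrow> 'v \<Rightarrow> ('v \<Rightarrow> complex) \<Rightarrow> 'v \<Rightarrow> complex"
  where "cdiff a b \<psi> x = frechet_derivative \<psi> (at x) a + \<i> * frechet_derivative \<psi> (at x) b"

lemma smooth_cdiff:
  assumes "smooth \<psi>"
  shows "smooth (cdiff a b \<psi>)"
  using smooth_frechet[OF assms] times_cont_diff_add times_cont_diff_cmult
  unfolding smooth_def cdiff_def[abs_def] by blast

lemma cder_smooth:
  assumes "smooth \<psi>"
  shows "cder a b \<psi> (cdiff a b \<psi>)"
  by (rule cderI[OF smooth_continuous[OF assms] _ _ dird_smooth[OF assms] dird_smooth[OF assms]])
    (auto simp: cdiff_def intro: smooth_continuous smooth_frechet assms)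

lemma cdiff_vanish:
  assumes "smooth \<psi>" "closed K" "\<And>x. x \<notin> K \<Longrightarrow> \<psi> x = 0" "x \<notin> K"
  shows "cdiff a b \<psi> x = 0"
  using dird_vanish[OF dird_smooth[OF assms(1)] assms(2-4)] by (simp add: cdiff_def)

text \<open>A fixed compact \<open>K\<close> in place of the support: every derivative of the
  amplitude is a test function for the same \<open>K\<close>.\<close>

definition test_function :: "'v::euclidean_space set \<Rightarrow> ('v \<Rightarrow> complex) \<Rightarrow> bool"
  where "test_function K \<psi> \<longleftrightarrow> compact K \<and> smooth \<psi> \<and> (\<forall>x. x \<notin> K \<longrightarrow> \<psi> x = 0)"

lemma test_function_cdiff: "test_function K \<psi> \<Longrightarrow> test_function K (cdiff a b \<psi>)"
  unfolding test_function_def using smooth_cdiff cdiff_vanish compact_imp_closed by metis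

text \<open>\<open>None\<close> stands for no derivative. The first component is the variable of a
  derivative along \<open>a + \<i> b\<close> that has fallen on the amplitude, the second that of
  one along \<open>a - \<i> b\<close>. Real places share the index type, with weight zero when the
  second component is \<open>Some\<close>, so both kinds of places can be iterated alike.\<close>

definition place_op :: "('n \<Rightarrow> 'v::euclidean_space) \<Rightarrow> ('n \<Rightarrow> 'v) \<Rightarrow> 'n option \<times> 'n option \<Rightarrow> ('v \<Rightarrow> complex) \<Rightarrow> 'v \<Rightarrow> complex"
  where "place_op a b i \<psi> =
    (case snd i of None \<Rightarrow> id | Some m \<Rightarrow> cdiff (a m) (- b m))
    ((case fst i of None \<Rightarrow> id | Some l \<Rightarrow> cdiff (a l) (b l)) \<psi>)"

lemma test_function_place_op: "test_function K \<psi> \<Longrightarrow> test_function K (place_op a b i \<psi>)"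
  by (auto simp: place_op_def intro: test_function_cdiff split: option.split)

lemma sum_UNIV_option_pair:
  fixes f :: "'n::finite option \<times> 'n option \<Rightarrow> 'b::comm_monoid_add"
  shows "(\<Sum>i\<in>UNIV. f i) = f (None, None) + (\<Sum>l\<in>UNIV. f (Some l, None)) +
    ((\<Sum>m\<in>UNIV. f (None, Some m)) + (\<Sum>l\<in>UNIV. \<Sum>m\<in>UNIV. f (Some l, Some m)))"
proof -
  have opt: "(\<Sum>i\<in>UNIV. g i) = g None + (\<Sum>l\<in>UNIV. g (Some l))" for g :: "'n option \<Rightarrow> 'b"
    by (simp add: UNIV_option_conv sum.reindex)
  have "(\<Sum>i\<in>UNIV. f i) = (\<Sum>i\<in>UNIV. \<Sum>j\<in>UNIV. f (i, j))"
    by (simp add: sum.cartesian_product UNIV_Times_UNIV[symmetric] del: UNIV_Times_UNIV)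
  then show ?thesis by (simp add: opt sum.distrib ac_simps)
qed

section \<open>A smooth cutoff\<close>

text \<open>
  \<open>s\<^sup>2 * cut0 s = 1 - (1 - s\<^sup>2)\<^sup>3\<close> for \<open>s \<le> 1\<close> and \<open>1\<close> for \<open>s \<ge> 1\<close>; the exponent \<open>3\<close> makes
  \<open>cut0\<close> twice continuously differentiable.
\<close>

definition cut0 :: "real \<Rightarrow> real" where "cut0 s = (if s \<le> 1 then 3 - 3 * s^2 + s^4 else 1 / s^2)"
definition cut1 :: "real \<Rightarrow> real" where "cut1 s = (if s \<le> 1 then - 6 * s + 4 * s^3 else - 2 / s^3)"
definition cut2 :: "real \<Rightarrow> real" where "cut2 s = (if s \<le> 1 then - 6 + 12 * s^2 else 6 / s^4)"

lemma DERIV_glue: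
  fixes f g :: "real \<Rightarrow> real"
  assumes "\<And>s. (f has_real_derivative f' s) (at s)" "\<And>s. s \<ge> 1 \<Longrightarrow> (g has_real_derivative g' s) (at s)"
    and "f 1 = g 1" "f' 1 = g' 1"
  shows "((\<lambda>s. if s \<le> 1 then f s else g s) has_real_derivative (if t \<le> 1 then f' t else g' t)) (at t)"
proof -
  have "((\<lambda>s. if s \<in> {..1} then f s else g s) has_vector_derivative (if t \<in> {..1} then f' t else g' t)) (at t within UNIV)"
  proof (rule has_vector_derivative_If_within_closures[where T = "{1<..}"])
    show "(f has_vector_derivative f' t) (at t within {..1} \<union> closure {..1} \<inter> closure {1<..})"
      using assms(1) by (simp add: has_real_derivative_iff_has_vector_derivative has_vector_derivative_at_within)
    show "(g has_vector_derivative g' t) (at t within {1<..} \<union> closure {..1} \<inter> closure {1<..})"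
      if "t \<in> {1<..} \<union> closure {..1} \<inter> closure {1<..}"
      using assms(2) that by (auto simp: has_real_derivative_iff_has_vector_derivative has_vector_derivative_at_within)
  qed (use assms(3,4) in auto)
  then show ?thesis by (simp add: has_real_derivative_iff_has_vector_derivative)
qed

lemma DERIV_cut0: "(cut0 has_real_derivative cut1 t) (at t)"
  unfolding cut0_def[abs_def] cut1_def
  by (rule DERIV_glue) (auto intro!: derivative_eq_intros simp: divide_simps power_numeral_reduce)

lemma DERIV_cut1: "(cut1 has_real_derivative cut2 t) (at t)"
  unfolding cut1_def[abs_def] cut2_def
  by (rule DERIV_glue) (auto intro!: derivative_eq_intros simp: divide_simps power_numeral_reduce)

lemma continuous_cut2: "continuous_on UNIV cut2"
proof -
  have "continuous_on ({..1} \<union> {1..}) (\<lambda>s. if s \<le> 1 then - 6 + 12 * s^2 else 6 / s^4 :: real)"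
    by (rule continuous_on_cases_le) (auto intro!: continuous_intros)
  also have "{..1} \<union> {1..} = (UNIV :: real set)" by auto
  finally show ?thesis by (simp add: cut2_def[abs_def])
qed

lemma continuous_cut: "continuous_on UNIV cut0" "continuous_on UNIV cut1"
  by (simp_all add: continuous_on_eq_continuous_at DERIV_isCont[OF DERIV_cut0] DERIV_isCont[OF DERIV_cut1])

lemmas continuous_cut_comp [continuous_intros] =
  continuous_on_compose2[OF continuous_cut(1) _ subset_UNIV]
  continuous_on_compose2[OF continuous_cut(2) _ subset_UNIV]
  continuous_on_compose2[OF continuous_cut2 _ subset_UNIV]

text \<open>For \<open>s > 1\<close> these are the decay rates of \<open>1 / s^2\<close> and its
  first two derivatives; below 1 polynomial bounds suffice. The last quantity is
  \<open>(1 - s^2)^3\<close> up to 1 and zero from there on, so it localises to small gradients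
  exactly.\<close>

lemma cut_bounds:
  assumes "0 \<le> s"
  shows "\<bar>cut0 s\<bar> \<le> 3 / (max 1 s)^2" "\<bar>cut1 s\<bar> \<le> 6 / (max 1 s)^3" "\<bar>cut2 s\<bar> \<le> 12 / (max 1 s)^4"
    "\<bar>1 - s^2 * cut0 s\<bar> \<le> (if s < 1 then 1 else 0)"
proof -
  have "\<bar>cut0 s\<bar> \<le> 3 / (max 1 s)^2 \<and> \<bar>cut1 s\<bar> \<le> 6 / (max 1 s)^3 \<and> \<bar>cut2 s\<bar> \<le> 12 / (max 1 s)^4 \<and>
    \<bar>1 - s^2 * cut0 s\<bar> \<le> (if s < 1 then 1 else 0)"
  proof (cases "s > 1")
    case True
    then show ?thesis
      by (auto simp: cut0_def cut1_def cut2_def divide_simps max_def)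
  next
    case False
  then have s: "s \<le> 1" by simp
  have p: "0 \<le> s^2" "s^2 \<le> 1" "s^4 = s^2 * s^2" "s^3 = s^2 * s" using assms s
    using power_le_one[of s 2] by (auto simp: power_numeral_reduce)
  have p4: "0 \<le> s^2 * s^2" "s^2 * s^2 \<le> s^2" using p mult_left_le[of "s^2" "s^2"] by auto
  have p3: "0 \<le> s^2 * s" "s^2 * s \<le> s" using p assms mult_left_le_one_le[of s "s^2"] by auto
  have "cut0 s = 3 - 3 * s^2 + s^2 * s^2" using s p(3) by (simp add: cut0_def)
  then have "\<bar>cut0 s\<bar> \<le> 3" using p(1,2) p4 by linarith
  moreover have "max 1 s = 1" using s by simp
  ultimately have r0: "\<bar>cut0 s\<bar> \<le> 3 / (max 1 s)^2" by simp
  have "cut1 s = - 6 * s + 4 * (s^2 * s)" using s p(4) by (simp add: cut1_def)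
  then have "\<bar>cut1 s\<bar> \<le> 6" using s assms p3 by linarith
  then have r1: "\<bar>cut1 s\<bar> \<le> 6 / (max 1 s)^3" using \<open>max 1 s = 1\<close> by simp
  have "cut2 s = - 6 + 12 * s^2" using s by (simp add: cut2_def)
  then have "\<bar>cut2 s\<bar> \<le> 12" using p(1,2) by linarith
  then have r2: "\<bar>cut2 s\<bar> \<le> 12 / (max 1 s)^4" using \<open>max 1 s = 1\<close> by simp
  have e: "1 - s^2 * cut0 s = (1 - s^2)^3" using s by (simp add: cut0_def power_numeral_reduce algebra_simps)
  have "0 \<le> (1 - s^2)^3" "(1 - s^2)^3 \<le> 1" using p by (auto intro: power_le_one)
  then have "\<bar>1 - s^2 * cut0 s\<bar> \<le> (if s < 1 then 1 else 0)"
    unfolding e using s by (cases "s = 1") auto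
  with r0 r1 r2 show ?thesis by blast
  qed
  then show "\<bar>cut0 s\<bar> \<le> 3 / (max 1 s)^2" "\<bar>cut1 s\<bar> \<le> 6 / (max 1 s)^3" "\<bar>cut2 s\<bar> \<le> 12 / (max 1 s)^4"
    "\<bar>1 - s^2 * cut0 s\<bar> \<le> (if s < 1 then 1 else 0)" by blast+
qed

section \<open>Partition of unity by the size of the gradient\<close>

section \<open>Decomposition of the amplitude at one place\<close>

lemma cmod_mult_le: "cmod a \<le> A \<Longrightarrow> cmod b \<le> B \<Longrightarrow> cmod (a * b) \<le> A * B"
  unfolding norm_mult by (rule mult_mono) (auto intro: order_trans[OF norm_ge_zero])

lemma cmod_add_le: "cmod a \<le> A \<Longrightarrow> cmod b \<le> B \<Longrightarrow> cmod (a + b) \<le> A + B"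
  by (rule norm_triangle_mono)

text \<open>Everything is measured in powers of \<open>w\<close>, which is at least 1 and bounds
  every \<open>q r\<close>. The three cutoff functions decay like \<open>w^-4\<close>,
  \<open>w^-6\<close> and \<open>w^-8\<close>, while a derivative of \<open>s\<close> costs a factor
  of order \<open>w * Y\<close>.\<close>

lemma place_bounds:
  fixes q :: "'n::finite \<Rightarrow> complex" and y :: "'n \<Rightarrow> 'n \<Rightarrow> complex"
  assumes s_def: "s = (\<Sum>r\<in>UNIV. (cmod (q r))\<^sup>2)" and Y_def: "Y = (\<Sum>l\<in>UNIV. \<Sum>r\<in>UNIV. cmod (y l r))"
    and w_def: "w = sqrt (max 1 s)"
  shows "s \<ge> 0" "w \<ge> 1" "w\<^sup>2 = max 1 s" "s \<le> w\<^sup>2" "cmod (q r) \<le> w" "cmod (y l r) \<le> Y" "Y \<ge> 0"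
    "cmod (\<Sum>r\<in>UNIV. cnj (q r) * y l r) \<le> w * Y"
    "cmod (\<Sum>r\<in>UNIV. cnj (y l r) * y m r) \<le> Y * Y"
    "cmod (of_real (cut0 s)) \<le> 3 / w^4" "cmod (of_real (cut1 s)) \<le> 6 / w^6" "cmod (of_real (cut2 s)) \<le> 12 / w^8"
proof -
  show s0: "s \<ge> 0" unfolding s_def by (intro sum_nonneg) auto
  show "w \<ge> 1" by (simp add: w_def)
  show w2: "w\<^sup>2 = max 1 s" by (simp add: w_def)
  then show "s \<le> w\<^sup>2" by simp
  have w0: "w \<ge> 0" using \<open>w \<ge> 1\<close> by linarith
  show qw: "cmod (q r) \<le> w" for r
  proof (rule power2_le_imp_le[OF _ w0])
    have "(cmod (q r))\<^sup>2 \<le> s" unfolding s_def by (rule member_le_sum) auto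
    then show "(cmod (q r))\<^sup>2 \<le> w\<^sup>2" using w2 by simp
  qed
  show Y0: "Y \<ge> 0" unfolding Y_def by (intro sum_nonneg) auto
  have row: "(\<Sum>r\<in>UNIV. cmod (y l r)) \<le> Y" for l
    unfolding Y_def by (rule member_le_sum) (auto intro: sum_nonneg)
  show yY: "cmod (y l r) \<le> Y" for l r
    using row[of l] member_le_sum[of r UNIV "\<lambda>r. cmod (y l r)"] by simp
  have "cmod (\<Sum>r\<in>UNIV. cnj (q r) * y l r) \<le> (\<Sum>r\<in>UNIV. w * cmod (y l r))"
    by (rule sum_norm_le) (simp add: norm_mult mult_right_mono qw)
  also have "\<dots> \<le> w * Y" using row[of l] w0 by (simp add: sum_distrib_left[symmetric] mult_left_mono)
  finally show "cmod (\<Sum>r\<in>UNIV. cnj (q r) * y l r) \<le> w * Y" .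
  have "cmod (\<Sum>r\<in>UNIV. cnj (y l r) * y m r) \<le> (\<Sum>r\<in>UNIV. Y * cmod (y m r))"
    by (rule sum_norm_le) (simp add: norm_mult mult_right_mono yY)
  also have "\<dots> \<le> Y * Y" using row[of m] Y0 by (simp add: sum_distrib_left[symmetric] mult_left_mono)
  finally show "cmod (\<Sum>r\<in>UNIV. cnj (y l r) * y m r) \<le> Y * Y" .
  have w46: "w^4 = (max 1 s)^2" "w^6 = (max 1 s)^3" "w^8 = (max 1 s)^4"
    unfolding w2[symmetric] by (simp_all add: power_mult[symmetric])
  show "cmod (of_real (cut0 s)) \<le> 3 / w^4" "cmod (of_real (cut1 s)) \<le> 6 / w^6" "cmod (of_real (cut2 s)) \<le> 12 / w^8"
    unfolding w46 norm_of_real using cut_bounds[OF s0] by auto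
qed

definition sq_sum :: "('n::finite \<Rightarrow> 'v \<Rightarrow> complex) \<Rightarrow> 'v \<Rightarrow> real"
  where "sq_sum q x = (\<Sum>r\<in>UNIV. (cmod (q r x))\<^sup>2)"

text \<open>The size of \<open>q'\<close> relative to \<open>1 + |q|^2\<close>, up to a factor 2:
  the weight left behind by an integration by parts.\<close>

definition deriv_ratio :: "('n::finite \<Rightarrow> 'v \<Rightarrow> complex) \<Rightarrow> ('n \<Rightarrow> 'n \<Rightarrow> 'v \<Rightarrow> complex) \<Rightarrow> 'v \<Rightarrow> real"
  where "deriv_ratio q y x = (\<Sum>l\<in>UNIV. \<Sum>r\<in>UNIV. cmod (y l r x)) / max 1 (sq_sum q x)"

lemma integrable_prod_test_function:
  assumes "continuous_on UNIV h" "test_function K \<psi>"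
  shows "integrable lborel (\<lambda>x. h x * \<psi> x)"
  by (rule compact_supported_integrable[where K = K])
    (use assms smooth_continuous in \<open>auto simp: test_function_def intro!: continuous_intros\<close>)

text \<open>A vector field \<open>V\<close> with \<open>\<Sum> q l * V l = 1 - eta\<close> is used,
  where \<open>eta\<close> lives on small gradients. The factor \<open>q l\<close> is traded for a
  derivative of \<open>E\<close>, which gains \<open>1 / c\<close>. The derivative then falls on
  \<open>V\<close> or on the amplitude, and not on \<open>g\<close>, which is constant in these
  directions.\<close>

lemma real_place:
  fixes E :: "'v::euclidean_space \<Rightarrow> complex" and q :: "'n::finite \<Rightarrow> 'v \<Rightarrow> complex"
  assumes E: "\<And>l. cder (a l) (b l) E (\<lambda>x. c * q l x * E x)"
    and q: "\<And>l r. cder (a l) (b l) (q r) (y l r)" and real: "\<And>r x. cnj (q r x) = q r x"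
    and c: "cmod c \<ge> h" "h > 0"
  obtains A :: "'n option \<times> 'n option \<Rightarrow> 'v \<Rightarrow> complex"
  where "\<And>i. continuous_on UNIV (A i)"
    and "\<And>i U. (\<And>r. invariant U (q r)) \<Longrightarrow> (\<And>l r. invariant U (y l r)) \<Longrightarrow> invariant U (A i)"
    and "\<And>g \<psi> K. (\<And>l. cder (a l) (b l) g (\<lambda>_. 0)) \<Longrightarrow> test_function K \<psi> \<Longrightarrow>
      (LINT x|lborel. E x * g x * \<psi> x) = (\<Sum>i\<in>UNIV. LINT x|lborel. E x * (g x * A i x) * place_op a b i \<psi> x)"
    and "\<And>x. (\<Sum>i\<in>UNIV. cmod (A i x)) \<le> (if sq_sum q x < 1 then 1 else 0) +
      CARD('n) / h * (3 + 21 * deriv_ratio q y x)"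
proof -
  define s where "s = sq_sum q"
  define S where "S l x = (\<Sum>r\<in>UNIV. cnj (q r x) * y l r x)" for l x
  \<comment> \<open>\<open>G\<close> is \<open>1 / t\<close> for \<open>t \<ge> 1\<close>, so
    \<open>V l\<close> is the field \<open>q l / |q|^2\<close> wherever the gradient is large,
    continued without a singularity to its zeros.\<close>
  define G where "G t = t * cut0 t" for t
  define G' where "G' t = cut0 t + t * cut1 t" for t
  have cq: "continuous_on UNIV (q r)" "continuous_on UNIV (y l r)" for l r
    using cder_continuous[OF q] by auto
  have cs: "continuous_on UNIV s" unfolding s_def sq_sum_def[abs_def] by (intro continuous_intros cq)
  have sq: "complex_of_real (s x) = (\<Sum>r\<in>UNIV. q r x * q r x)" for x
  proof -
    have "complex_of_real ((cmod (q r x))\<^sup>2) = q r x * q r x" for r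
      using complex_norm_square[of "q r x"] by (simp add: real)
    then show ?thesis by (simp add: s_def sq_sum_def del: of_real_power)
  qed
  have Ds: "cder (a l) (b l) (\<lambda>x. complex_of_real (s x)) (\<lambda>x. 2 * S l x)" for l
    unfolding sq S_def
    by (rule cder_cong[OF cder_sum[OF cder_mult[OF q q]]]) (simp add: real sum_distrib_left sum.distrib[symmetric] algebra_simps)
  have DG: "(G has_real_derivative G' t) (at t)" for t
    unfolding G_def[abs_def] G'_def by (auto intro!: derivative_eq_intros DERIV_cut0 simp: algebra_simps)
  have DGs: "cder (a l) (b l) (\<lambda>x. complex_of_real (G (s x))) (\<lambda>x. of_real (G' (s x)) * (2 * S l x))" for l
    by (rule cder_chain_real[OF Ds DG]) (auto simp: G'_def intro!: continuous_intros cs)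
  define V where "V l x = q l x * of_real (G (s x))" for l x
  define DV where "DV l x = q l x * (of_real (G' (s x)) * (2 * S l x)) + y l l x * of_real (G (s x))" for l x
  have V: "cder (a l) (b l) (V l) (DV l)" for l
    unfolding V_def[abs_def] DV_def[abs_def] by (intro cder_mult q DGs)
  define eta where "eta x = complex_of_real (1 - (s x)^2 * cut0 (s x))" for x
  have part: "1 = eta x + (\<Sum>l\<in>UNIV. q l x * V l x)" for x
  proof -
    have "(\<Sum>l\<in>UNIV. q l x * V l x) = of_real (s x) * of_real (G (s x))"
      unfolding sq V_def sum_distrib_right by (simp add: mult_ac)
    then show ?thesis by (simp add: eta_def G_def power2_eq_square)
  qed
  define A :: "'n option \<times> 'n option \<Rightarrow> 'v \<Rightarrow> complex" where "A i x = (case i of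
      (None, None) \<Rightarrow> eta x - 1 / c * (\<Sum>l\<in>UNIV. DV l x)
    | (Some l, None) \<Rightarrow> - (1 / c * V l x)
    | _ \<Rightarrow> 0)" for i x
  have ceta: "continuous_on UNIV eta" unfolding eta_def by (intro continuous_intros cs)
  have cV: "continuous_on UNIV (V l)" "continuous_on UNIV (DV l)" for l using cder_continuous[OF V] by auto
  have c0: "c \<noteq> 0" using c by auto
  show thesis
  proof (rule that[of A])
    fix i :: "'n option \<times> 'n option"
    show "continuous_on UNIV (A i)"
      unfolding A_def[abs_def] by (cases i; cases "fst i"; cases "snd i") (auto simp: c0 intro!: continuous_intros ceta cV)
    fix U
    assume inv: "\<And>r. invariant U (q r)" "\<And>l r. invariant U (y l r)"
    have e: "q r (x + t *\<^sub>R v) = q r x" "y l r (x + t *\<^sub>R v) = y l r x" if "v \<in> U" for x t v l r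
      using inv that unfolding invariant_def by auto
    show "invariant U (A i)"
      unfolding invariant_def
      by (cases i; cases "fst i"; cases "snd i") (auto simp: A_def eta_def DV_def V_def S_def s_def sq_sum_def e)
  next
    fix g \<psi> :: "'v \<Rightarrow> complex" and K
    assume g: "\<And>l. cder (a l) (b l) g (\<lambda>_. 0)" and \<psi>: "test_function K \<psi>"
    have sm: "smooth \<psi>" and K: "compact K" "\<And>x. x \<notin> K \<Longrightarrow> \<psi> x = 0" using \<psi> by (auto simp: test_function_def)
    have cE: "continuous_on UNIV E" and cg: "continuous_on UNIV g"
      using cder_continuous(1)[OF E] cder_continuous(1)[OF g] .
    note int = integrable_prod_test_function[OF _ \<psi>]
    note int' = integrable_prod_test_function[OF _ test_function_cdiff[OF \<psi>]]
    define I0 where "I0 l = (LINT x|lborel. E x * (g x * DV l x) * \<psi> x)" for l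
    define I1 where "I1 l = (LINT x|lborel. E x * (g x * V l x) * cdiff (a l) (b l) \<psi> x)" for l
    have i0: "integrable lborel (\<lambda>x. E x * (g x * DV l x) * \<psi> x)"
      and i1: "integrable lborel (\<lambda>x. E x * (g x * V l x) * cdiff (a l) (b l) \<psi> x)"
      and iq: "integrable lborel (\<lambda>x. E x * g x * (q l x * V l x) * \<psi> x)"
      and ie: "integrable lborel (\<lambda>x. E x * (g x * eta x) * \<psi> x)" for l
      by (intro int int' continuous_intros cE cg cV ceta cq)+
    have ibp: "(LINT x|lborel. E x * g x * (q l x * V l x) * \<psi> x) = - (1 / c * (I0 l + I1 l))" for l
    proof -
      have "cder (a l) (b l) (\<lambda>x. E x * g x * V l x * \<psi> x)
        (\<lambda>x. c * (E x * g x * (q l x * V l x) * \<psi> x) + (E x * (g x * DV l x) * \<psi> x + E x * (g x * V l x) * cdiff (a l) (b l) \<psi> x))"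
        by (rule cder_cong[OF cder_mult[OF cder_mult[OF cder_mult[OF E g] V] cder_smooth[OF sm]]])
          (simp add: algebra_simps)
      from integral_cder_zero[OF this K(1)] K(2)
      have "(LINT x|lborel. c * (E x * g x * (q l x * V l x) * \<psi> x) +
        (E x * (g x * DV l x) * \<psi> x + E x * (g x * V l x) * cdiff (a l) (b l) \<psi> x)) = 0" by simp
      then have "c * (LINT x|lborel. E x * g x * (q l x * V l x) * \<psi> x) + (I0 l + I1 l) = 0"
        unfolding I0_def I1_def using i0 i1 iq by simp
      then show ?thesis using c0 by (simp add: field_simps eq_neg_iff_add_eq_0 add.commute)
    qed
    have "(LINT x|lborel. E x * g x * \<psi> x) =
        (LINT x|lborel. E x * (g x * eta x) * \<psi> x + (\<Sum>l\<in>UNIV. E x * g x * (q l x * V l x) * \<psi> x))"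
    proof (rule Bochner_Integration.integral_cong[OF refl])
      fix x
      have "E x * g x * \<psi> x = E x * g x * (eta x + (\<Sum>l\<in>UNIV. q l x * V l x)) * \<psi> x"
        using part[of x] by simp
      also have "\<dots> = E x * (g x * eta x) * \<psi> x + (\<Sum>l\<in>UNIV. E x * g x * (q l x * V l x) * \<psi> x)"
        by (simp only: distrib_left distrib_right sum_distrib_left sum_distrib_right mult.assoc)
      finally show "E x * g x * \<psi> x = E x * (g x * eta x) * \<psi> x + (\<Sum>l\<in>UNIV. E x * g x * (q l x * V l x) * \<psi> x)" .
    qed
    also have "\<dots> = (LINT x|lborel. E x * (g x * eta x) * \<psi> x) + (\<Sum>l\<in>UNIV. - (1 / c * (I0 l + I1 l)))"
      using ie iq by (simp add: ibp)
    also have "(\<Sum>l\<in>UNIV. - (1 / c * (I0 l + I1 l))) = - (1 / c) * (\<Sum>l\<in>UNIV. I0 l) + (\<Sum>l\<in>UNIV. - (1 / c * I1 l))"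
      by (simp only: sum.distrib[symmetric] sum_distrib_left) (auto intro!: sum.cong simp: algebra_simps)
    also have "(LINT x|lborel. E x * (g x * eta x) * \<psi> x) + (- (1 / c) * (\<Sum>l\<in>UNIV. I0 l) + (\<Sum>l\<in>UNIV. - (1 / c * I1 l)))
      = ((LINT x|lborel. E x * (g x * eta x) * \<psi> x) - 1 / c * (\<Sum>l\<in>UNIV. I0 l)) + (\<Sum>l\<in>UNIV. - (1 / c * I1 l))"
      by simp
    also have "(LINT x|lborel. E x * (g x * eta x) * \<psi> x) - 1 / c * (\<Sum>l\<in>UNIV. I0 l) =
        (LINT x|lborel. E x * (g x * A (None, None) x) * place_op a b (None, None) \<psi> x)"
    proof -
      have "(LINT x|lborel. E x * (g x * A (None, None) x) * place_op a b (None, None) \<psi> x) =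
        (LINT x|lborel. E x * (g x * eta x) * \<psi> x - 1 / c * (\<Sum>l\<in>UNIV. E x * (g x * DV l x) * \<psi> x))"
        by (simp add: A_def place_op_def algebra_simps sum_distrib_left)
      then show ?thesis unfolding I0_def using ie i0 by simp
    qed
    finally have main: "(LINT x|lborel. E x * g x * \<psi> x) =
        (LINT x|lborel. E x * (g x * A (None, None) x) * place_op a b (None, None) \<psi> x) + (\<Sum>l\<in>UNIV. - (1 / c * I1 l))" .
    have e1: "- (1 / c * I1 l) = (LINT x|lborel. E x * (g x * A (Some l, None) x) * place_op a b (Some l, None) \<psi> x)" for l
    proof -
      have "(LINT x|lborel. E x * (g x * A (Some l, None) x) * place_op a b (Some l, None) \<psi> x) =
        (LINT x|lborel. - (1 / c) * (E x * (g x * V l x) * cdiff (a l) (b l) \<psi> x))"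
        by (simp add: A_def place_op_def mult_ac)
      then show ?thesis unfolding I1_def by simp
    qed
    have "(LINT x|lborel. E x * (g x * A (i, Some m) x) * place_op a b (i, Some m) \<psi> x) = 0" for i m
      by (cases i) (simp_all add: A_def)
    then show "(LINT x|lborel. E x * g x * \<psi> x) = (\<Sum>i\<in>UNIV. LINT x|lborel. E x * (g x * A i x) * place_op a b i \<psi> x)"
      unfolding main sum_UNIV_option_pair e1 by simp
  next
    fix x
    define w where "w = sqrt (max 1 (s x))"
    define Y where "Y = (\<Sum>l\<in>UNIV. \<Sum>r\<in>UNIV. cmod (y l r x))"
    have sx_eq: "s x = (\<Sum>r\<in>UNIV. (cmod (q r x))\<^sup>2)" by (simp add: s_def sq_sum_def)
    note B = place_bounds[OF sx_eq Y_def w_def]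
    have w0: "w > 0" using B(2) by linarith
    have ratio: "deriv_ratio q y x = Y / w\<^sup>2" by (simp add: deriv_ratio_def Y_def B(3) s_def)
    have sx: "cmod (of_real (s x)) \<le> w\<^sup>2" using B(1,4) by (simp del: of_real_power)
    have G: "cmod (of_real (G (s x))) \<le> w\<^sup>2 * (3 / w^4)"
      unfolding G_def of_real_mult by (intro cmod_mult_le sx B)
    have G': "cmod (of_real (G' (s x))) \<le> 3 / w^4 + w\<^sup>2 * (6 / w^6)"
      unfolding G'_def of_real_mult of_real_add by (intro cmod_add_le cmod_mult_le sx B)
    have S: "cmod (2 * S l x) \<le> 2 * (w * Y)" for l
      unfolding S_def by (intro cmod_mult_le B) auto
    have bV: "cmod (V l x) \<le> 3" for l
    proof -
      have "cmod (V l x) \<le> w * (w\<^sup>2 * (3 / w^4))" unfolding V_def by (intro cmod_mult_le G B)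
      also have "\<dots> = 3 / w" using w0 by (simp add: field_simps power_numeral_reduce)
      also have "\<dots> \<le> 3" using B(2) by (simp add: divide_le_eq)
      finally show ?thesis .
    qed
    have bDV: "cmod (DV l x) \<le> 21 * (Y / w\<^sup>2)" for l
    proof -
      have "cmod (DV l x) \<le> w * ((3 / w^4 + w\<^sup>2 * (6 / w^6)) * (2 * (w * Y))) + Y * (w\<^sup>2 * (3 / w^4))"
        unfolding DV_def by (intro cmod_add_le cmod_mult_le G G' S B)
      \<comment> \<open>The constant is \<open>2 * (3 + 6)\<close> from differentiating
        \<open>G (s x)\<close>, plus 3 from differentiating the factor \<open>q l\<close>.\<close>
      also have "\<dots> = 21 * (Y / w\<^sup>2)" using w0 by (simp add: field_simps power_numeral_reduce)
      finally show ?thesis .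
    qed
    have ci: "cmod (1 / c) \<le> 1 / h" using c by (simp add: norm_divide frac_le)
    have A0: "cmod (A (None, None) x) \<le> (if s x < 1 then 1 else 0) + 1 / h * (CARD('n) * (21 * (Y / w\<^sup>2)))"
    proof -
      have "cmod (eta x) \<le> (if s x < 1 then 1 else 0)"
        unfolding eta_def norm_of_real by (rule cut_bounds(4)[OF B(1)])
      moreover have "cmod (1 / c * (\<Sum>l\<in>UNIV. DV l x)) \<le> 1 / h * (CARD('n) * (21 * (Y / w\<^sup>2)))"
        by (intro cmod_mult_le ci order_trans[OF norm_sum] order_trans[OF sum_bounded_above[OF bDV]]) simp
      ultimately show ?thesis
        unfolding A_def using norm_triangle_ineq4[of "eta x" "1 / c * (\<Sum>l\<in>UNIV. DV l x)"] by (simp del: divide_const_simps)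
    qed
    have A1: "cmod (A (Some l, None) x) \<le> 1 / h * 3" for l
      unfolding A_def using cmod_mult_le[OF ci bV] by (simp del: divide_const_simps)
    have "(\<Sum>i\<in>UNIV. cmod (A i x)) = cmod (A (None, None) x) + (\<Sum>l\<in>UNIV. cmod (A (Some l, None) x))"
      by (simp add: sum_UNIV_option_pair A_def)
    also have "\<dots> \<le> ((if s x < 1 then 1 else 0) + 1 / h * (CARD('n) * (21 * (Y / w\<^sup>2)))) + CARD('n) * (1 / h * 3)"
      by (intro add_mono A0 order_trans[OF sum_bounded_above[OF A1]]) simp
    also have "\<dots> = (if sq_sum q x < 1 then 1 else 0) + CARD('n) / h * (3 + 21 * deriv_ratio q y x)"
      unfolding ratio s_def using c(2) w0 by (simp add: field_simps)
    finally show "(\<Sum>i\<in>UNIV. cmod (A i x)) \<le> (if sq_sum q x < 1 then 1 else 0) + CARD('n) / h * (3 + 21 * deriv_ratio q y x)" .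
  qed
qed


text \<open>Two integrations by parts gain \<open>1 / c\<close> each. The derivative along
  \<open>a + \<i> b\<close> annihilates \<open>cnj (q r)\<close>, the one along
  \<open>a - \<i> b\<close> annihilates \<open>q r\<close> and \<open>y l r\<close>, so the
  coefficients involve only first derivatives of \<open>q\<close>. The partition is quadratic,
  \<open>1 = eta + \<Sum> q l * cnj (q m) * U l m\<close>, with one factor for each kind of
  derivative.\<close>

lemma complex_place:
  fixes E :: "'v::euclidean_space \<Rightarrow> complex" and q :: "'n::finite \<Rightarrow> 'v \<Rightarrow> complex"
  assumes E: "\<And>l. cder (a l) (b l) E (\<lambda>x. c * q l x * E x)"
      "\<And>l. cder (a l) (- b l) E (\<lambda>x. c * cnj (q l x) * E x)"
    and q: "\<And>l r. cder (a l) (b l) (q r) (y l r)" "\<And>l r. cder (a l) (- b l) (q r) (\<lambda>_. 0)"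
    and y: "\<And>l r m. cder (a m) (- b m) (y l r) (\<lambda>_. 0)"
    and c: "cmod c \<ge> h" "h > 0"
  obtains A :: "'n option \<times> 'n option \<Rightarrow> 'v \<Rightarrow> complex"
  where "\<And>i. continuous_on UNIV (A i)"
    and "\<And>i U. (\<And>r. invariant U (q r)) \<Longrightarrow> (\<And>l r. invariant U (y l r)) \<Longrightarrow> invariant U (A i)"
    and "\<And>g \<psi> K. (\<And>l. cder (a l) (b l) g (\<lambda>_. 0)) \<Longrightarrow> (\<And>l. cder (a l) (- b l) g (\<lambda>_. 0)) \<Longrightarrow> test_function K \<psi> \<Longrightarrow>
      (LINT x|lborel. E x * g x * \<psi> x) = (\<Sum>i\<in>UNIV. LINT x|lborel. E x * (g x * A i x) * place_op a b i \<psi> x)"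
    and "\<And>x. (\<Sum>i\<in>UNIV. cmod (A i x)) \<le> (if sq_sum q x < 1 then 1 else 0) +
      (CARD('n) / h)\<^sup>2 * (12 + 42 * (deriv_ratio q y x)\<^sup>2)"
proof -
  define s where "s = sq_sum q"
  define S where "S l x = (\<Sum>r\<in>UNIV. cnj (q r x) * y l r x)" for l x
  define R where "R m l x = (\<Sum>r\<in>UNIV. cnj (y m r x) * y l r x)" for m l x
  define c0 where "c0 x = complex_of_real (cut0 (s x))" for x
  define c1 where "c1 x = complex_of_real (cut1 (s x))" for x
  define c2 where "c2 x = complex_of_real (cut2 (s x))" for x
  have cq: "continuous_on UNIV (q r)" "continuous_on UNIV (y l r)" for l r
    using cder_continuous[OF q(1)] by auto
  have cs: "continuous_on UNIV s" unfolding s_def sq_sum_def[abs_def] by (intro continuous_intros cq)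
  have q': "cder (a l) (b l) (\<lambda>x. cnj (q r x)) (\<lambda>_. 0)" for l r
    using cder_cnj[OF q(2), of l r] by simp
  have q'': "cder (a m) (- b m) (\<lambda>x. cnj (q r x)) (\<lambda>x. cnj (y m r x))" for m r
    using cder_cnj[OF q(1)] .
  have sq: "complex_of_real (s x) = (\<Sum>r\<in>UNIV. q r x * cnj (q r x))" for x
    by (simp add: s_def sq_sum_def complex_norm_square del: of_real_power)
  have Ds: "cder (a l) (b l) (\<lambda>x. complex_of_real (s x)) (\<lambda>x. S l x)" for l
    unfolding sq S_def by (rule cder_cong[OF cder_sum[OF cder_mult[OF q(1) q']]]) (simp add: mult.commute)
  have Ds': "cder (a m) (- b m) (\<lambda>x. complex_of_real (s x)) (\<lambda>x. cnj (S m x))" for m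
    unfolding sq S_def by (rule cder_cong[OF cder_sum[OF cder_mult[OF q(2) q'']]]) simp
  have c01: "cder (a l) (b l) c0 (\<lambda>x. c1 x * S l x)" for l
    unfolding c0_def c1_def by (rule cder_chain_real[OF Ds DERIV_cut0]) (intro continuous_intros cs)
  have c01': "cder (a l) (- b l) c0 (\<lambda>x. c1 x * cnj (S l x))" for l
    unfolding c0_def c1_def by (rule cder_chain_real[OF Ds' DERIV_cut0]) (intro continuous_intros cs)
  have c12': "cder (a l) (- b l) c1 (\<lambda>x. c2 x * cnj (S l x))" for l
    unfolding c1_def c2_def by (rule cder_chain_real[OF Ds' DERIV_cut1]) (intro continuous_intros cs)
  have DS: "cder (a m) (- b m) (S l) (\<lambda>x. R m l x)" for l m
    unfolding S_def R_def by (rule cder_cong[OF cder_sum[OF cder_mult[OF q'' y]]]) simp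
  \<comment> \<open>\<open>DU\<close> and \<open>BU\<close> below are its derivatives along
    \<open>a l + \<i> b l\<close> and along \<open>a m - \<i> b m\<close>; \<open>DDU\<close> is the
    second derivative applied after the first.\<close>
  define U where "U l m x = cnj (q l x) * (q m x * c0 x)" for l m x
  define DU where "DU l m x = cnj (q l x) * (q m x * (c1 x * S l x) + y l m x * c0 x)" for l m x
  define BU where "BU l m x = q m x * (cnj (q l x) * (c1 x * cnj (S m x)) + cnj (y m l x) * c0 x)" for l m x
  define DDU where "DDU l m x = cnj (q l x) * (q m x * (c1 x * R m l x + (c2 x * cnj (S m x)) * S l x) + y l m x * (c1 x * cnj (S m x)))
      + cnj (y m l x) * (q m x * (c1 x * S l x) + y l m x * c0 x)" for l m x
  have U1: "cder (a l) (b l) (U l m) (DU l m)" for l m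
    unfolding U_def[abs_def] DU_def[abs_def]
    by (rule cder_cong[OF cder_mult[OF q' cder_mult[OF q(1) c01]]]) simp
  have U2: "cder (a m) (- b m) (U l m) (BU l m)" for l m
    unfolding U_def[abs_def] BU_def[abs_def]
    by (rule cder_cong[OF cder_mult[OF q'' cder_mult[OF q(2) c01']]]) (simp add: algebra_simps)
  have U3: "cder (a m) (- b m) (DU l m) (DDU l m)" for l m
    unfolding DU_def[abs_def] DDU_def[abs_def]
    by (rule cder_cong[OF cder_mult[OF q'' cder_add[OF cder_mult[OF q(2) cder_mult[OF c12' DS]] cder_mult[OF y c01']]]])
      simp
  define eta where "eta x = complex_of_real (1 - (s x)^2 * cut0 (s x))" for x
  have part: "1 = eta x + (\<Sum>l\<in>UNIV. \<Sum>m\<in>UNIV. q l x * (cnj (q m x) * U l m x))" for x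
  proof -
    have "(\<Sum>l\<in>UNIV. \<Sum>m\<in>UNIV. q l x * (cnj (q m x) * U l m x)) =
        (\<Sum>l\<in>UNIV. q l x * cnj (q l x)) * (\<Sum>m\<in>UNIV. q m x * cnj (q m x)) * c0 x"
      by (subst sum_product) (simp add: U_def sum_distrib_right sum_distrib_left mult_ac)
    also have "\<dots> = of_real (s x) * of_real (s x) * c0 x" unfolding sq ..
    finally show ?thesis by (simp add: eta_def c0_def power2_eq_square)
  qed
  define k where "k = 1 / c\<^sup>2"
  define A :: "'n option \<times> 'n option \<Rightarrow> 'v \<Rightarrow> complex" where "A i x = (case i of
      (None, None) \<Rightarrow> eta x + k * (\<Sum>l\<in>UNIV. \<Sum>m\<in>UNIV. DDU l m x)
    | (Some l, None) \<Rightarrow> k * (\<Sum>m\<in>UNIV. BU l m x)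
    | (None, Some m) \<Rightarrow> k * (\<Sum>l\<in>UNIV. DU l m x)
    | (Some l, Some m) \<Rightarrow> k * U l m x)" for i x
  have ceta: "continuous_on UNIV eta" unfolding eta_def by (intro continuous_intros cs)
  have cU: "continuous_on UNIV (U l m)" "continuous_on UNIV (DU l m)" "continuous_on UNIV (BU l m)" "continuous_on UNIV (DDU l m)" for l m
    using cder_continuous[OF U1] cder_continuous[OF U2] cder_continuous[OF U3] by auto
  have cn0: "c \<noteq> 0" using c by auto
  show thesis
  proof (rule that[of A])
    fix i :: "'n option \<times> 'n option"
    show "continuous_on UNIV (A i)"
      unfolding A_def[abs_def] by (cases i; cases "fst i"; cases "snd i") (auto intro!: continuous_intros ceta cU)
    fix V
    assume inv: "\<And>r. invariant V (q r)" "\<And>l r. invariant V (y l r)"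
    have e: "q r (x + t *\<^sub>R v) = q r x" "y l r (x + t *\<^sub>R v) = y l r x" if "v \<in> V" for x t v l r
      using inv that unfolding invariant_def by auto
    have e': "U l m (x + t *\<^sub>R v) = U l m x" "DU l m (x + t *\<^sub>R v) = DU l m x" "BU l m (x + t *\<^sub>R v) = BU l m x"
      "DDU l m (x + t *\<^sub>R v) = DDU l m x" "eta (x + t *\<^sub>R v) = eta x" if "v \<in> V" for x t v l m
      using e[OF that] by (simp_all add: U_def DU_def BU_def DDU_def eta_def c0_def c1_def c2_def S_def R_def s_def sq_sum_def)
    show "invariant V (A i)"
      unfolding invariant_def by (cases i; cases "fst i"; cases "snd i") (auto simp: A_def e')
  next
    fix g \<psi> :: "'v \<Rightarrow> complex" and K
    assume g: "\<And>l. cder (a l) (b l) g (\<lambda>_. 0)" "\<And>l. cder (a l) (- b l) g (\<lambda>_. 0)" and \<psi>: "test_function K \<psi>"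
    have sm: "smooth \<psi>" and K: "compact K" "\<And>x. x \<notin> K \<Longrightarrow> \<psi> x = 0" using \<psi> by (auto simp: test_function_def)
    define D1 where "D1 l = cdiff (a l) (b l) \<psi>" for l
    define D2 where "D2 m = cdiff (a m) (- b m) \<psi>" for m
    define D12 where "D12 l m = cdiff (a m) (- b m) (D1 l)" for l m
    have t1: "test_function K (D1 l)" and t2: "test_function K (D2 m)" and t12: "test_function K (D12 l m)" for l m
      unfolding D1_def D2_def D12_def by (intro test_function_cdiff \<psi>)+
    have d1: "cder (a l) (b l) \<psi> (D1 l)" and d2: "cder (a m) (- b m) \<psi> (D2 m)" and d12: "cder (a m) (- b m) (D1 l) (D12 l m)" for l m
      using t1[of l] unfolding D1_def D2_def D12_def by (auto intro: cder_smooth sm simp: test_function_def)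
    have v1: "D1 l x = 0" if "x \<notin> K" for l x using t1 that by (auto simp: test_function_def)
    have cE: "continuous_on UNIV E" and cg: "continuous_on UNIV g"
      using cder_continuous(1)[OF E(1)] cder_continuous(1)[OF g(1)] .
    define I0 where "I0 l m = (LINT x|lborel. E x * (g x * DDU l m x) * \<psi> x)" for l m
    define I1 where "I1 l m = (LINT x|lborel. E x * (g x * BU l m x) * D1 l x)" for l m
    define I2 where "I2 l m = (LINT x|lborel. E x * (g x * DU l m x) * D2 m x)" for l m
    define I3 where "I3 l m = (LINT x|lborel. E x * (g x * U l m x) * D12 l m x)" for l m
    note int = integrable_prod_test_function
    have i: "integrable lborel (\<lambda>x. E x * (g x * DDU l m x) * \<psi> x)" "integrable lborel (\<lambda>x. E x * (g x * BU l m x) * D1 l x)"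
      "integrable lborel (\<lambda>x. E x * (g x * DU l m x) * D2 m x)" "integrable lborel (\<lambda>x. E x * (g x * U l m x) * D12 l m x)"
      "integrable lborel (\<lambda>x. E x * (g x * eta x) * \<psi> x)"
      "integrable lborel (\<lambda>x. E x * g x * (q l x * (cnj (q m x) * U l m x)) * \<psi> x)"
      "integrable lborel (\<lambda>x. E x * (cnj (q m x) * (g x * DU l m x)) * \<psi> x)"
      "integrable lborel (\<lambda>x. E x * (cnj (q m x) * (g x * U l m x)) * D1 l x)" for l m
      by (rule int[OF _ \<psi>] int[OF _ t1] int[OF _ t2] int[OF _ t12]; intro continuous_intros cE cg cU ceta cq)+
    have ibp: "(LINT x|lborel. E x * g x * (q l x * (cnj (q m x) * U l m x)) * \<psi> x) = k * (I0 l m + I1 l m + I2 l m + I3 l m)" for l m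
    proof -
      define J0 where "J0 = (LINT x|lborel. E x * g x * (q l x * (cnj (q m x) * U l m x)) * \<psi> x)"
      define J1 where "J1 = (LINT x|lborel. E x * (cnj (q m x) * (g x * DU l m x)) * \<psi> x)"
      define J2 where "J2 = (LINT x|lborel. E x * (cnj (q m x) * (g x * U l m x)) * D1 l x)"
      \<comment> \<open>First the factor \<open>q l\<close> is integrated away;
        \<open>cnj (q m)\<close> passes through like a constant and is kept for the second
        integration.\<close>
      have "cder (a l) (b l) (\<lambda>x. E x * (cnj (q m x) * g x) * U l m x * \<psi> x)
        (\<lambda>x. c * (E x * g x * (q l x * (cnj (q m x) * U l m x)) * \<psi> x) +
          (E x * (cnj (q m x) * (g x * DU l m x)) * \<psi> x + E x * (cnj (q m x) * (g x * U l m x)) * D1 l x))"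
        by (rule cder_cong[OF cder_mult[OF cder_mult[OF cder_mult[OF E(1) cder_mult[OF q' g(1)]] U1] d1]])
          (simp add: algebra_simps)
      from integral_cder_zero[OF this K(1)] K(2)
      have "(LINT x|lborel. c * (E x * g x * (q l x * (cnj (q m x) * U l m x)) * \<psi> x) +
          (E x * (cnj (q m x) * (g x * DU l m x)) * \<psi> x + E x * (cnj (q m x) * (g x * U l m x)) * D1 l x)) = 0" by simp
      then have "c * J0 + (J1 + J2) = 0"
        unfolding J0_def J1_def J2_def using i by simp
      then have 1: "c * J0 = - (J1 + J2)" by (simp only: eq_neg_iff_add_eq_0)
      \<comment> \<open>Both remaining terms carry \<open>cnj (q m)\<close> and are integrated
        together. The four products of derivatives of \<open>U\<close> and of the amplitude give
        \<open>I0\<close> to \<open>I3\<close>.\<close>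
      have "cder (a m) (- b m) (\<lambda>x. E x * g x * (DU l m x * \<psi> x + U l m x * D1 l x))
        (\<lambda>x. c * (E x * (cnj (q m x) * (g x * DU l m x)) * \<psi> x + E x * (cnj (q m x) * (g x * U l m x)) * D1 l x) +
          (E x * (g x * DDU l m x) * \<psi> x + E x * (g x * BU l m x) * D1 l x +
           E x * (g x * DU l m x) * D2 m x + E x * (g x * U l m x) * D12 l m x))"
        by (rule cder_cong[OF cder_mult[OF cder_mult[OF E(2) g(2)] cder_add[OF cder_mult[OF U3 d2] cder_mult[OF U2 d12]]]])
          (simp add: algebra_simps)
      from integral_cder_zero[OF this K(1)] K(2) v1
      have "(LINT x|lborel. c * (E x * (cnj (q m x) * (g x * DU l m x)) * \<psi> x + E x * (cnj (q m x) * (g x * U l m x)) * D1 l x) +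
          (E x * (g x * DDU l m x) * \<psi> x + E x * (g x * BU l m x) * D1 l x +
           E x * (g x * DU l m x) * D2 m x + E x * (g x * U l m x) * D12 l m x)) = 0" by simp
      then have "c * (J1 + J2) + (I0 l m + I1 l m + I2 l m + I3 l m) = 0"
        unfolding J1_def J2_def I0_def I1_def I2_def I3_def using i by simp
      then have 2: "c * (J1 + J2) = - (I0 l m + I1 l m + I2 l m + I3 l m)" by (simp only: eq_neg_iff_add_eq_0)
      have "c * (c * J0) = - (c * (J1 + J2))" unfolding 1 by (simp only: mult_minus_right)
      also have "\<dots> = I0 l m + I1 l m + I2 l m + I3 l m" unfolding 2 by simp
      finally have "c * (c * J0) = I0 l m + I1 l m + I2 l m + I3 l m" .
      then show ?thesis using cn0 unfolding J0_def[symmetric] k_def by (simp add: field_simps power2_eq_square)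
    qed
    have "(LINT x|lborel. E x * g x * \<psi> x) = (LINT x|lborel. E x * (g x * eta x) * \<psi> x +
        (\<Sum>l\<in>UNIV. \<Sum>m\<in>UNIV. E x * g x * (q l x * (cnj (q m x) * U l m x)) * \<psi> x))"
    proof (rule Bochner_Integration.integral_cong[OF refl])
      fix x
      have "E x * g x * \<psi> x = E x * g x * (eta x + (\<Sum>l\<in>UNIV. \<Sum>m\<in>UNIV. q l x * (cnj (q m x) * U l m x))) * \<psi> x"
        using part[of x] by simp
      also have "\<dots> = E x * (g x * eta x) * \<psi> x +
        (\<Sum>l\<in>UNIV. \<Sum>m\<in>UNIV. E x * g x * (q l x * (cnj (q m x) * U l m x)) * \<psi> x)"
        by (simp only: distrib_left distrib_right sum_distrib_left sum_distrib_right mult.assoc)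
      finally show "E x * g x * \<psi> x = E x * (g x * eta x) * \<psi> x +
        (\<Sum>l\<in>UNIV. \<Sum>m\<in>UNIV. E x * g x * (q l x * (cnj (q m x) * U l m x)) * \<psi> x)" .
    qed
    also have "\<dots> = (LINT x|lborel. E x * (g x * eta x) * \<psi> x) +
        (\<Sum>l\<in>UNIV. \<Sum>m\<in>UNIV. k * (I0 l m + I1 l m + I2 l m + I3 l m))"
      using i by (simp add: ibp)
    also have "\<dots> = ((LINT x|lborel. E x * (g x * eta x) * \<psi> x) + k * (\<Sum>l\<in>UNIV. \<Sum>m\<in>UNIV. I0 l m)) +
        (\<Sum>l\<in>UNIV. k * (\<Sum>m\<in>UNIV. I1 l m)) +
        ((\<Sum>m\<in>UNIV. k * (\<Sum>l\<in>UNIV. I2 l m)) + (\<Sum>l\<in>UNIV. \<Sum>m\<in>UNIV. k * I3 l m))"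
      unfolding sum_distrib_left distrib_left sum.distrib sum.swap[of "\<lambda>m l. k * I2 l m"] by (simp only: add_ac)
    also have "(LINT x|lborel. E x * (g x * eta x) * \<psi> x) + k * (\<Sum>l\<in>UNIV. \<Sum>m\<in>UNIV. I0 l m) =
        (LINT x|lborel. E x * (g x * A (None, None) x) * place_op a b (None, None) \<psi> x)"
    proof -
      have "(LINT x|lborel. E x * (g x * A (None, None) x) * place_op a b (None, None) \<psi> x) =
        (LINT x|lborel. E x * (g x * eta x) * \<psi> x + k * (\<Sum>l\<in>UNIV. \<Sum>m\<in>UNIV. E x * (g x * DDU l m x) * \<psi> x))"
        by (simp add: A_def place_op_def algebra_simps sum_distrib_left)
      then show ?thesis unfolding I0_def using i by simp
    qed
    finally have main: "(LINT x|lborel. E x * g x * \<psi> x) =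
        (LINT x|lborel. E x * (g x * A (None, None) x) * place_op a b (None, None) \<psi> x) +
        (\<Sum>l\<in>UNIV. k * (\<Sum>m\<in>UNIV. I1 l m)) +
        ((\<Sum>m\<in>UNIV. k * (\<Sum>l\<in>UNIV. I2 l m)) + (\<Sum>l\<in>UNIV. \<Sum>m\<in>UNIV. k * I3 l m))" .
    have e1: "k * (\<Sum>m\<in>UNIV. I1 l m) = (LINT x|lborel. E x * (g x * A (Some l, None) x) * place_op a b (Some l, None) \<psi> x)" for l
    proof -
      have "(LINT x|lborel. E x * (g x * A (Some l, None) x) * place_op a b (Some l, None) \<psi> x) =
        (LINT x|lborel. k * (\<Sum>m\<in>UNIV. E x * (g x * BU l m x) * D1 l x))"
        by (simp add: A_def place_op_def D1_def mult_ac sum_distrib_left)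
      then show ?thesis unfolding I1_def using i by simp
    qed
    have e2: "k * (\<Sum>l\<in>UNIV. I2 l m) = (LINT x|lborel. E x * (g x * A (None, Some m) x) * place_op a b (None, Some m) \<psi> x)" for m
    proof -
      have "(LINT x|lborel. E x * (g x * A (None, Some m) x) * place_op a b (None, Some m) \<psi> x) =
        (LINT x|lborel. k * (\<Sum>l\<in>UNIV. E x * (g x * DU l m x) * D2 m x))"
        by (simp add: A_def place_op_def D2_def mult_ac sum_distrib_left)
      then show ?thesis unfolding I2_def using i by simp
    qed
    have e3: "k * I3 l m = (LINT x|lborel. E x * (g x * A (Some l, Some m) x) * place_op a b (Some l, Some m) \<psi> x)" for l m
    proof -
      have "(LINT x|lborel. E x * (g x * A (Some l, Some m) x) * place_op a b (Some l, Some m) \<psi> x) =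
        (LINT x|lborel. k * (E x * (g x * U l m x) * D12 l m x))"
        by (simp add: A_def place_op_def D12_def D1_def mult_ac)
      then show ?thesis unfolding I3_def by simp
    qed
    show "(LINT x|lborel. E x * g x * \<psi> x) = (\<Sum>i\<in>UNIV. LINT x|lborel. E x * (g x * A i x) * place_op a b i \<psi> x)"
      unfolding main sum_UNIV_option_pair e1 e2 e3 ..
  next
    fix x
    define w where "w = sqrt (max 1 (s x))"
    define Y where "Y = (\<Sum>l\<in>UNIV. \<Sum>r\<in>UNIV. cmod (y l r x))"
    define t where "t = Y / w\<^sup>2"
    have sx_eq: "s x = (\<Sum>r\<in>UNIV. (cmod (q r x))\<^sup>2)" by (simp add: s_def sq_sum_def)
    note B = place_bounds[OF sx_eq Y_def w_def]
    have w0: "w > 0" using B(2) by linarith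
    have ratio: "deriv_ratio q y x = t" by (simp add: deriv_ratio_def Y_def B(3) s_def t_def)
    have t0: "t \<ge> 0" using B(7) by (simp add: t_def)
    have S: "cmod (S l x) \<le> w * Y" "cmod (cnj (S l x)) \<le> w * Y" for l
      unfolding complex_mod_cnj S_def by (rule B)+
    have R: "cmod (R m l x) \<le> Y * Y" for m l unfolding R_def by (rule B)
    have cc: "cmod (c0 x) \<le> 3 / w^4" "cmod (c1 x) \<le> 6 / w^6" "cmod (c2 x) \<le> 12 / w^8"
      unfolding c0_def c1_def c2_def by (rule B)+
    have qc: "cmod (cnj (q r x)) \<le> w" "cmod (cnj (y l r x)) \<le> Y" for l r unfolding complex_mod_cnj by (rule B)+
    have bU: "cmod (U l m x) \<le> 3" for l m
    proof -
      have "cmod (U l m x) \<le> w * (w * (3 / w^4))" unfolding U_def by (intro cmod_mult_le cc qc B)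
      also have "\<dots> = 3 / w\<^sup>2" using w0 by (simp add: field_simps power_numeral_reduce)
      also have "\<dots> \<le> 3" using B(2) by (simp add: divide_le_eq)
      finally show ?thesis .
    qed
    \<comment> \<open>Since \<open>w \<ge> 1\<close>, the third power may be weakened to the second,
      which makes the mixed terms linear in \<open>t\<close>.\<close>
    have le: "9 * (Y / w ^ 3) \<le> 9 * t"
    proof -
      have "w\<^sup>2 \<le> w ^ 3" using B(2) by (intro power_increasing) auto
      then show ?thesis unfolding t_def using w0 B(7) by (intro mult_left_mono divide_left_mono) auto
    qed
    have bDU: "cmod (DU l m x) \<le> 9 * t" for l m
    proof -
      have "cmod (DU l m x) \<le> w * (w * ((6 / w^6) * (w * Y)) + Y * (3 / w^4))"
        unfolding DU_def by (intro cmod_mult_le cmod_add_le cc qc S B)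
      also have "\<dots> = 9 * (Y / w ^ 3)" using w0 by (simp add: field_simps power_numeral_reduce)
      finally show ?thesis using le by simp
    qed
    have bBU: "cmod (BU l m x) \<le> 9 * t" for l m
    proof -
      have "cmod (BU l m x) \<le> w * (w * ((6 / w^6) * (w * Y)) + Y * (3 / w^4))"
        unfolding BU_def by (intro cmod_mult_le cmod_add_le cc qc S B)
      also have "\<dots> = 9 * (Y / w ^ 3)" using w0 by (simp add: field_simps power_numeral_reduce)
      finally show ?thesis using le by simp
    qed
    have bDDU: "cmod (DDU l m x) \<le> 33 * t\<^sup>2" for l m
    proof -
      have "cmod (DDU l m x) \<le> w * (w * ((6 / w^6) * (Y * Y) + ((12 / w^8) * (w * Y)) * (w * Y)) + Y * ((6 / w^6) * (w * Y)))
        + Y * (w * ((6 / w^6) * (w * Y)) + Y * (3 / w^4))"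
        unfolding DDU_def by (intro cmod_mult_le cmod_add_le cc qc S R B)
      also have "\<dots> = 33 * t\<^sup>2" unfolding t_def using w0 by (simp add: field_simps power_numeral_reduce)
      finally show ?thesis .
    qed
    define n where "n = real CARD('n)"
    have kb: "cmod k \<le> 1 / h\<^sup>2"
      unfolding k_def using c by (simp add: norm_divide norm_power frac_le power_mono)
    have dsum: "cmod (\<Sum>l\<in>UNIV. \<Sum>m\<in>UNIV. F l m) \<le> n * (n * M)" if "\<And>l m. cmod (F l m) \<le> M" for F :: "'n \<Rightarrow> 'n \<Rightarrow> complex" and M
    proof -
      have "cmod (\<Sum>m\<in>UNIV. F l m) \<le> n * M" for l
        using order_trans[OF norm_sum sum_bounded_above[OF that]] by (simp add: n_def)
      then show ?thesis
        using order_trans[OF norm_sum sum_bounded_above[of UNIV "\<lambda>l. cmod (\<Sum>m\<in>UNIV. F l m)" "n * M"]] by (simp add: n_def)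
    qed
    have ssum: "cmod (\<Sum>l\<in>UNIV. F l) \<le> n * M" if "\<And>l. cmod (F l) \<le> M" for F :: "'n \<Rightarrow> complex" and M
      using order_trans[OF norm_sum sum_bounded_above[OF that]] by (simp add: n_def)
    have A0: "cmod (A (None, None) x) \<le> (if s x < 1 then 1 else 0) + 1 / h\<^sup>2 * (n * (n * (33 * t\<^sup>2)))"
      unfolding A_def prod.case option.case
      by (intro cmod_add_le cmod_mult_le kb dsum bDDU) (simp only: eta_def norm_of_real cut_bounds(4)[OF B(1)])
    have A1: "cmod (A (Some l, None) x) \<le> 1 / h\<^sup>2 * (n * (9 * t))" "cmod (A (None, Some l) x) \<le> 1 / h\<^sup>2 * (n * (9 * t))"
      "cmod (A (Some l, Some m) x) \<le> 1 / h\<^sup>2 * 3" for l m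
      unfolding A_def prod.case option.case by (intro cmod_mult_le kb ssum bDU bBU bU)+
    have r1: "(\<Sum>l\<in>UNIV. F l) \<le> n * M" if "\<And>l. F l \<le> M" for F :: "'n \<Rightarrow> real" and M
      using sum_bounded_above[of UNIV F M] that by (simp add: n_def)
    have "(\<Sum>i\<in>UNIV. cmod (A i x)) \<le> ((if s x < 1 then 1 else 0) + 1 / h\<^sup>2 * (n * (n * (33 * t\<^sup>2)))) + n * (1 / h\<^sup>2 * (n * (9 * t))) +
        (n * (1 / h\<^sup>2 * (n * (9 * t))) + n * (n * (1 / h\<^sup>2 * 3)))"
      unfolding sum_UNIV_option_pair by (intro add_mono A0 r1 A1)
    also have "\<dots> = (if s x < 1 then 1 else 0) + (n / h)\<^sup>2 * (3 + 18 * t + 33 * t\<^sup>2)"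
      using c by (simp add: field_simps power2_eq_square)
    also have "\<dots> \<le> (if s x < 1 then 1 else 0) + (n / h)\<^sup>2 * (12 + 42 * t\<^sup>2)"
    proof -
      \<comment> \<open>The linear term is absorbed through \<open>2 * t \<le> 1 + t^2\<close>, as
        averages at a complex place are available for constants and for squares of the
        ratio.\<close>
      have "0 \<le> 9 * (t - 1)\<^sup>2" by simp
      then have "3 + 18 * t + 33 * t\<^sup>2 \<le> 12 + 42 * t\<^sup>2" by (simp add: power2_eq_square algebra_simps)
      then show ?thesis by (intro add_left_mono mult_left_mono) auto
    qed
    finally show "(\<Sum>i\<in>UNIV. cmod (A i x)) \<le> (if sq_sum q x < 1 then 1 else 0) +
      (CARD('n) / h)\<^sup>2 * (12 + 42 * (deriv_ratio q y x)\<^sup>2)"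
      unfolding ratio s_def n_def .
  qed
qed

section \<open>Integration by parts at several places\<close>

lemma invariant_mult: "invariant U f \<Longrightarrow> invariant U g \<Longrightarrow> invariant U (\<lambda>x. f x * g x)"
  by (simp add: invariant_def)

lemma measurable_ennreal_cmod:
  "continuous_on UNIV (f :: 'v::euclidean_space \<Rightarrow> complex) \<Longrightarrow> (\<lambda>x. ennreal (cmod (f x))) \<in> borel_measurable borel"
  by (intro measurable_compose[OF borel_measurable_continuous_onI measurable_ennreal])
    (auto intro!: continuous_intros)

text \<open>The order of quantifiers is the point: the constant precedes \<open>E\<close>,
  \<open>g\<close> and \<open>A\<close>. Treating one place replaces the amplitude by one of
  finitely many \<open>op p i \<psi>\<close> and multiplies \<open>g\<close> by
  \<open>A p i\<close>. The new \<open>g\<close> is still constant in the directions of the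
  remaining places, while the amplitudes never depend on \<open>E\<close>, \<open>g\<close> or
  \<open>A\<close>.\<close>

lemma iterate_places:
  fixes op :: "'p \<Rightarrow> 'i::finite \<Rightarrow> ('v::euclidean_space \<Rightarrow> complex) \<Rightarrow> 'v \<Rightarrow> complex" and U :: "'p \<Rightarrow> 'v set"
  assumes "finite T" and op: "\<And>p i \<psi>. test_function K \<psi> \<Longrightarrow> test_function K (op p i \<psi>)"
    and "test_function K \<psi>"
  shows "\<exists>C\<ge>0. \<forall>E g A. continuous_on UNIV E \<longrightarrow> (\<forall>x. cmod (E x) \<le> 1) \<longrightarrow>
    continuous_on UNIV g \<longrightarrow> (\<forall>p\<in>T. invariant (U p) g) \<longrightarrow>
    (\<forall>p\<in>T. \<forall>i. continuous_on UNIV (A p i)) \<longrightarrow>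
    (\<forall>p\<in>T. \<forall>p'\<in>T. p \<noteq> p' \<longrightarrow> (\<forall>i. invariant (U p') (A p i))) \<longrightarrow>
    (\<forall>p\<in>T. \<forall>g \<psi>. continuous_on UNIV g \<longrightarrow> invariant (U p) g \<longrightarrow> test_function K \<psi> \<longrightarrow>
      (LINT x|lborel. E x * g x * \<psi> x) = (\<Sum>i\<in>UNIV. LINT x|lborel. E x * (g x * A p i x) * op p i \<psi> x)) \<longrightarrow>
    ennreal (cmod (LINT x|lborel. E x * g x * \<psi> x)) \<le>
      ennreal C * (\<integral>\<^sup>+x. indicator K x * (ennreal (cmod (g x)) * (\<Prod>p\<in>T. ennreal (\<Sum>i\<in>UNIV. cmod (A p i x)))) \<partial>lborel)"
  using assms(1,3)
proof (induction T arbitrary: \<psi>)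
  case empty
  have sm: "smooth \<psi>" and K: "compact K" "\<And>x. x \<notin> K \<Longrightarrow> \<psi> x = 0"
    using empty by (auto simp: test_function_def)
  have "bounded (\<psi> ` K)"
    using smooth_continuous[OF sm] K by (intro compact_imp_bounded compact_continuous_image) (auto intro: continuous_on_subset)
  then obtain C where C: "\<And>x. x \<in> K \<Longrightarrow> cmod (\<psi> x) \<le> C" unfolding bounded_iff by auto
  show ?case
  proof (intro exI[of _ "max C 0"] conjI allI impI)
    fix E g :: "'v \<Rightarrow> complex" and A :: "'p \<Rightarrow> 'i \<Rightarrow> 'v \<Rightarrow> complex"
    assume E: "continuous_on UNIV E" "\<forall>x. cmod (E x) \<le> 1" and g: "continuous_on UNIV g"
    have "integrable lborel (\<lambda>x. E x * g x * \<psi> x)"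
      by (rule integrable_prod_test_function[OF _ empty]) (intro continuous_intros E g)
    then have "ennreal (cmod (LINT x|lborel. E x * g x * \<psi> x)) \<le> (\<integral>\<^sup>+x. ennreal (cmod (E x * g x * \<psi> x)) \<partial>lborel)"
      by (rule integral_norm_bound_ennreal)
    also have "\<dots> \<le> (\<integral>\<^sup>+x. ennreal (max C 0) * (indicator K x * ennreal (cmod (g x))) \<partial>lborel)"
    proof (rule nn_integral_mono)
      fix x
      show "ennreal (cmod (E x * g x * \<psi> x)) \<le> ennreal (max C 0) * (indicator K x * ennreal (cmod (g x)))"
      proof (cases "x \<in> K")
        case True
        have "cmod (E x * g x * \<psi> x) \<le> (1 * cmod (g x)) * max C 0"
          using C[OF True] E by (intro cmod_mult_le) (auto simp: le_max_iff_disj)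
        then have "ennreal (cmod (E x * g x * \<psi> x)) \<le> ennreal (max C 0 * cmod (g x))"
          by (intro ennreal_leI) (simp add: mult.commute)
        then show ?thesis using True by (simp add: ennreal_mult)
      qed (simp add: K)
    qed
    also have "\<dots> = ennreal (max C 0) * (\<integral>\<^sup>+x. indicator K x * ennreal (cmod (g x)) \<partial>lborel)"
      using measurable_ennreal_cmod[OF g] borel_compact[OF K(1)] by (intro nn_integral_cmult) auto
    finally show "ennreal (cmod (LINT x|lborel. E x * g x * \<psi> x)) \<le> ennreal (max C 0) *
        (\<integral>\<^sup>+x. indicator K x * (ennreal (cmod (g x)) * (\<Prod>p\<in>{}. ennreal (\<Sum>i\<in>UNIV. cmod (A p i x)))) \<partial>lborel)"
      by simp
  qed simp
next
  case (insert p T)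
  have K: "compact K" using insert.prems by (simp add: test_function_def)
  define Bd where "Bd \<psi> C \<longleftrightarrow> C \<ge> 0 \<and> (\<forall>E g A. continuous_on UNIV E \<longrightarrow> (\<forall>x. cmod (E x) \<le> 1) \<longrightarrow>
    continuous_on UNIV g \<longrightarrow> (\<forall>p\<in>T. invariant (U p) g) \<longrightarrow>
    (\<forall>p\<in>T. \<forall>i. continuous_on UNIV (A p i)) \<longrightarrow>
    (\<forall>p\<in>T. \<forall>p'\<in>T. p \<noteq> p' \<longrightarrow> (\<forall>i. invariant (U p') (A p i))) \<longrightarrow>
    (\<forall>p\<in>T. \<forall>g \<psi>. continuous_on UNIV g \<longrightarrow> invariant (U p) g \<longrightarrow> test_function K \<psi> \<longrightarrow>
      (LINT x|lborel. E x * g x * \<psi> x) = (\<Sum>i\<in>UNIV. LINT x|lborel. E x * (g x * A p i x) * op p i \<psi> x)) \<longrightarrow>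
    ennreal (cmod (LINT x|lborel. E x * g x * \<psi> x)) \<le>
      ennreal C * (\<integral>\<^sup>+x. indicator K x * (ennreal (cmod (g x)) * (\<Prod>p\<in>T. ennreal (\<Sum>i\<in>UNIV. cmod (A p i x)))) \<partial>lborel))" for \<psi> C
  have "\<forall>i. \<exists>C. Bd (op p i \<psi>) C"
    unfolding Bd_def by (intro allI insert.IH op insert.prems)
  then obtain C where C: "\<And>i. Bd (op p i \<psi>) (C i)" by metis
  have C0: "C i \<ge> 0" for i using C[of i] by (simp add: Bd_def)
  \<comment> \<open>Each derived amplitude has its own constant from the induction hypothesis; their
    sum serves for all of them.\<close>
  define D where "D = (\<Sum>i\<in>UNIV. C i)"
  have CD: "C i \<le> D" for i unfolding D_def by (rule member_le_sum) (auto simp: C0)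
  show ?case
  proof (intro exI[of _ D] conjI allI impI)
    show "D \<ge> 0" unfolding D_def by (intro sum_nonneg C0)
    fix E g :: "'v \<Rightarrow> complex" and A :: "'p \<Rightarrow> 'i \<Rightarrow> 'v \<Rightarrow> complex"
    assume E: "continuous_on UNIV E" "\<forall>x. cmod (E x) \<le> 1" and g: "continuous_on UNIV g" "\<forall>p\<in>insert p T. invariant (U p) g"
      and A: "\<forall>p\<in>insert p T. \<forall>i. continuous_on UNIV (A p i)"
        "\<forall>r\<in>insert p T. \<forall>p'\<in>insert p T. r \<noteq> p' \<longrightarrow> (\<forall>i. invariant (U p') (A r i))"
      and id: "\<forall>p\<in>insert p T. \<forall>g \<psi>. continuous_on UNIV g \<longrightarrow> invariant (U p) g \<longrightarrow> test_function K \<psi> \<longrightarrow>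
        (LINT x|lborel. E x * g x * \<psi> x) = (\<Sum>i\<in>UNIV. LINT x|lborel. E x * (g x * A p i x) * op p i \<psi> x)"
    define P where "P x = (\<Prod>p\<in>T. ennreal (\<Sum>i\<in>UNIV. cmod (A p i x)))" for x
    have mA: "(\<lambda>x. ennreal (cmod (A p i x))) \<in> borel_measurable borel" for i
      using A(1) by (intro measurable_ennreal_cmod) auto
    have mg: "(\<lambda>x. ennreal (cmod (g x))) \<in> borel_measurable borel"
      by (intro measurable_ennreal_cmod g)
    have mP: "P \<in> borel_measurable borel"
      unfolding P_def
    proof (rule borel_measurable_prod_ennreal)
      fix p' assume "p' \<in> T"
      then have "(\<lambda>x. \<Sum>i\<in>UNIV. ennreal (cmod (A p' i x))) \<in> borel_measurable borel"
        using A(1) by (intro borel_measurable_sum measurable_ennreal_cmod) auto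
      then show "(\<lambda>x. ennreal (\<Sum>i\<in>UNIV. cmod (A p' i x))) \<in> borel_measurable borel"
        by (simp add: sum_ennreal)
    qed
    have mK: "K \<in> sets borel" using K by (rule borel_compact)
    have each: "ennreal (cmod (LINT x|lborel. E x * (g x * A p i x) * op p i \<psi> x)) \<le>
        ennreal D * (\<integral>\<^sup>+x. indicator K x * (ennreal (cmod (g x)) * (ennreal (cmod (A p i x)) * P x)) \<partial>lborel)" for i
    proof -
      have inv: "\<forall>p'\<in>T. invariant (U p') (\<lambda>x. g x * A p i x)"
        using g(2) A(2) insert.hyps by (intro ballI invariant_mult) auto
      have cont: "continuous_on UNIV (\<lambda>x. g x * A p i x)" using g(1) A(1) by (intro continuous_intros) auto
      have "ennreal (cmod (LINT x|lborel. E x * (g x * A p i x) * op p i \<psi> x)) \<le>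
        ennreal (C i) * (\<integral>\<^sup>+x. indicator K x * (ennreal (cmod (g x * A p i x)) * P x) \<partial>lborel)"
        unfolding P_def
        by (rule C[of i, unfolded Bd_def, THEN conjunct2, rule_format]) (use E A id inv cont in auto)
      also have "\<dots> \<le> ennreal D * (\<integral>\<^sup>+x. indicator K x * (ennreal (cmod (g x * A p i x)) * P x) \<partial>lborel)"
        by (intro mult_right_mono ennreal_leI CD) auto
      finally show ?thesis by (simp add: norm_mult ennreal_mult mult.assoc)
    qed
    have "(LINT x|lborel. E x * g x * \<psi> x) = (\<Sum>i\<in>UNIV. LINT x|lborel. E x * (g x * A p i x) * op p i \<psi> x)"
      using id g insert.prems by simp
    then have "ennreal (cmod (LINT x|lborel. E x * g x * \<psi> x)) \<le>
        ennreal (\<Sum>i\<in>UNIV. cmod (LINT x|lborel. E x * (g x * A p i x) * op p i \<psi> x))"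
      by (simp add: ennreal_leI norm_sum)
    also have "\<dots> = (\<Sum>i\<in>UNIV. ennreal (cmod (LINT x|lborel. E x * (g x * A p i x) * op p i \<psi> x)))"
      by (simp add: sum_ennreal)
    also have "\<dots> \<le> (\<Sum>i\<in>UNIV. ennreal D * (\<integral>\<^sup>+x. indicator K x * (ennreal (cmod (g x)) * (ennreal (cmod (A p i x)) * P x)) \<partial>lborel))"
      by (intro sum_mono each)
    also have "\<dots> = ennreal D * (\<Sum>i\<in>UNIV. \<integral>\<^sup>+x. indicator K x * (ennreal (cmod (g x)) * (ennreal (cmod (A p i x)) * P x)) \<partial>lborel)"
      by (rule sum_distrib_left[symmetric])
    also have "(\<Sum>i\<in>UNIV. \<integral>\<^sup>+x. indicator K x * (ennreal (cmod (g x)) * (ennreal (cmod (A p i x)) * P x)) \<partial>lborel) =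
        (\<integral>\<^sup>+x. (\<Sum>i\<in>UNIV. indicator K x * (ennreal (cmod (g x)) * (ennreal (cmod (A p i x)) * P x))) \<partial>lborel)"
      by (rule nn_integral_sum[symmetric])
        (simp add: mA mg mP mK borel_measurable_times_ennreal borel_measurable_indicator)
    also have "\<dots> = (\<integral>\<^sup>+x. indicator K x * (ennreal (cmod (g x)) * (\<Prod>p\<in>insert p T. ennreal (\<Sum>i\<in>UNIV. cmod (A p i x)))) \<partial>lborel)"
    proof (rule nn_integral_cong)
      fix x
      have "(\<Sum>i\<in>UNIV. indicator K x * (ennreal (cmod (g x)) * (ennreal (cmod (A p i x)) * P x))) =
          indicator K x * (ennreal (cmod (g x)) * ((\<Sum>i\<in>UNIV. ennreal (cmod (A p i x))) * P x))"
        by (simp only: sum_distrib_left sum_distrib_right)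
      also have "(\<Sum>i\<in>UNIV. ennreal (cmod (A p i x))) * P x = (\<Prod>p\<in>insert p T. ennreal (\<Sum>i\<in>UNIV. cmod (A p i x)))"
        using insert.hyps by (simp add: P_def sum_ennreal)
      finally show "(\<Sum>i\<in>UNIV. indicator K x * (ennreal (cmod (g x)) * (ennreal (cmod (A p i x)) * P x))) =
          indicator K x * (ennreal (cmod (g x)) * (\<Prod>p\<in>insert p T. ennreal (\<Sum>i\<in>UNIV. cmod (A p i x))))" .
    qed
    finally show "ennreal (cmod (LINT x|lborel. E x * g x * \<psi> x)) \<le> ennreal D * (\<integral>\<^sup>+x. indicator K x *
        (ennreal (cmod (g x)) * (\<Prod>p\<in>insert p T. ennreal (\<Sum>i\<in>UNIV. cmod (A p i x)))) \<partial>lborel)" .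
  qed
qed

section \<open>Replacing weights by their averages along the directions of a place\<close>

section \<open>Averaging over translations\<close>

lemma measurable_ball_times:
  fixes g :: "'v::euclidean_space \<Rightarrow> ennreal"
  assumes "g \<in> borel_measurable borel"
  shows "(\<lambda>x. indicator (ball 0 R) x * g x) \<in> borel_measurable borel"
  using assms by (intro borel_measurable_times_ennreal borel_measurable_indicator) auto

text \<open>
  \<open>averaged \<rho> U G M\<close>: against any function that does not depend on the variables of \<open>U\<close>, the
  weight \<open>G\<close> may be replaced by its bound \<open>M\<close>, at the cost of enlarging the domain by \<open>\<rho>\<close>.
\<close>

definition averaged :: "real \<Rightarrow> 'v::euclidean_space set \<Rightarrow> ('v \<Rightarrow> ennreal) \<Rightarrow> ennreal \<Rightarrow> bool"
  where "averaged \<rho> U G M \<longleftrightarrow> G \<in> borel_measurable borel \<and>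
    (\<forall>R g. g \<in> borel_measurable borel \<longrightarrow> invariant U g \<longrightarrow>
      (\<integral>\<^sup>+x. indicator (ball 0 R) x * (G x * g x) \<partial>lborel) \<le> M * (\<integral>\<^sup>+x. indicator (ball 0 (R + \<rho>)) x * g x \<partial>lborel))"

lemma averaged_measurable: "averaged \<rho> U G M \<Longrightarrow> G \<in> borel_measurable borel"
  by (simp add: averaged_def)

lemma averaged_const:
  assumes "\<rho> \<ge> 0"
  shows "averaged \<rho> U (\<lambda>_. c) c"
  unfolding averaged_def
proof (intro conjI allI impI)
  fix R and g :: "'a \<Rightarrow> ennreal" assume g: "g \<in> borel_measurable borel"
  have "(\<integral>\<^sup>+x. indicator (ball 0 R) x * (c * g x) \<partial>lborel) \<le> (\<integral>\<^sup>+x. c * (indicator (ball 0 (R + \<rho>)) x * g x) \<partial>lborel)"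
    by (rule nn_integral_mono) (use assms in \<open>auto simp: indicator_def\<close>)
  also have "\<dots> = c * (\<integral>\<^sup>+x. indicator (ball 0 (R + \<rho>)) x * g x \<partial>lborel)"
    using g by (intro nn_integral_cmult) (simp add: measurable_ball_times)
  finally show "(\<integral>\<^sup>+x. indicator (ball 0 R) x * (c * g x) \<partial>lborel) \<le> c * (\<integral>\<^sup>+x. indicator (ball 0 (R + \<rho>)) x * g x \<partial>lborel)" .
qed simp

lemma averaged_add:
  assumes "averaged \<rho> U G M" "averaged \<rho> U G' M'"
  shows "averaged \<rho> U (\<lambda>x. G x + G' x) (M + M')"
  unfolding averaged_def
proof (intro conjI allI impI)
  have m: "G \<in> borel_measurable borel" "G' \<in> borel_measurable borel" using assms averaged_measurable by auto
  show "(\<lambda>x. G x + G' x) \<in> borel_measurable borel" using m by measurable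
  fix R and g :: "'a \<Rightarrow> ennreal" assume g: "g \<in> borel_measurable borel" "invariant U g"
  have "(\<integral>\<^sup>+x. indicator (ball 0 R) x * ((G x + G' x) * g x) \<partial>lborel) =
      (\<integral>\<^sup>+x. indicator (ball 0 R) x * (G x * g x) + indicator (ball 0 R) x * (G' x * g x) \<partial>lborel)"
    by (simp add: distrib_left distrib_right)
  also have "\<dots> = (\<integral>\<^sup>+x. indicator (ball 0 R) x * (G x * g x) \<partial>lborel) + (\<integral>\<^sup>+x. indicator (ball 0 R) x * (G' x * g x) \<partial>lborel)"
    using m g by (intro nn_integral_add) (simp_all add: measurable_ball_times borel_measurable_times_ennreal)
  also have "\<dots> \<le> (M + M') * (\<integral>\<^sup>+x. indicator (ball 0 (R + \<rho>)) x * g x \<partial>lborel)"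
    unfolding distrib_right using assms g unfolding averaged_def by (intro add_mono) auto
  finally show "(\<integral>\<^sup>+x. indicator (ball 0 R) x * ((G x + G' x) * g x) \<partial>lborel) \<le>
      (M + M') * (\<integral>\<^sup>+x. indicator (ball 0 (R + \<rho>)) x * g x \<partial>lborel)" .
qed

lemma averaged_cmult:
  assumes "averaged \<rho> U G M"
  shows "averaged \<rho> U (\<lambda>x. c * G x) (c * M)"
  unfolding averaged_def
proof (intro conjI allI impI)
  have m: "G \<in> borel_measurable borel" using assms averaged_measurable by auto
  show "(\<lambda>x. c * G x) \<in> borel_measurable borel" using m by measurable
  fix R and g :: "'a \<Rightarrow> ennreal" assume g: "g \<in> borel_measurable borel" "invariant U g"
  have "(\<integral>\<^sup>+x. indicator (ball 0 R) x * (c * G x * g x) \<partial>lborel) = (\<integral>\<^sup>+x. c * (indicator (ball 0 R) x * (G x * g x)) \<partial>lborel)"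
    by (simp add: mult_ac)
  also have "\<dots> = c * (\<integral>\<^sup>+x. indicator (ball 0 R) x * (G x * g x) \<partial>lborel)"
    using m g by (intro nn_integral_cmult) (simp add: measurable_ball_times borel_measurable_times_ennreal)
  also have "\<dots> \<le> c * (M * (\<integral>\<^sup>+x. indicator (ball 0 (R + \<rho>)) x * g x \<partial>lborel))"
    using assms g unfolding averaged_def by (intro mult_left_mono) auto
  finally show "(\<integral>\<^sup>+x. indicator (ball 0 R) x * (c * G x * g x) \<partial>lborel) \<le>
      c * M * (\<integral>\<^sup>+x. indicator (ball 0 (R + \<rho>)) x * g x \<partial>lborel)" by (simp add: mult.assoc)
qed

lemma averaged_sum:
  assumes "\<rho> \<ge> 0" "\<And>j. j \<in> J \<Longrightarrow> averaged \<rho> U (G j) (M j)"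
  shows "averaged \<rho> U (\<lambda>x. \<Sum>j\<in>J. G j x) (\<Sum>j\<in>J. M j)"
  using assms(2) by (induction J rule: infinite_finite_induct) (auto intro: averaged_add averaged_const assms(1))

text \<open>The factors are replaced by their bounds one at a time; the remaining product plays the
  role of the function that is constant in the directions concerned. Each replacement enlarges the
  radius by \<open>\<rho>\<close>.\<close>

lemma averaged_prod:
  fixes G :: "'p \<Rightarrow> 'v::euclidean_space \<Rightarrow> ennreal" and \<rho> R :: real
  assumes "finite T" "\<rho> \<ge> 0" "\<And>p. p \<in> T \<Longrightarrow> averaged \<rho> (U p) (G p) (M p)"
    and "\<And>p p'. p \<in> T \<Longrightarrow> p' \<in> T \<Longrightarrow> p \<noteq> p' \<Longrightarrow> invariant (U p) (G p')"
  shows "(\<integral>\<^sup>+x. indicator (ball 0 R) x * (\<Prod>p\<in>T. G p x) \<partial>lborel) \<le>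
    (\<Prod>p\<in>T. M p) * emeasure lborel (ball (0::'v) (R + card T * \<rho>))"
  using assms(1,3,4)
proof (induction T arbitrary: R)
  case (insert p T)
  have inv: "invariant (U p) (\<lambda>x. \<Prod>p'\<in>T. G p' x)"
  proof -
    have "G p' (x + t *\<^sub>R v) = G p' x" if "p' \<in> T" "v \<in> U p" for p' x t v
      using insert.prems(2)[of p p'] insert.hyps that by (auto simp: invariant_def)
    then show ?thesis unfolding invariant_def by (auto intro!: prod.cong)
  qed
  have "(\<integral>\<^sup>+x. indicator (ball 0 R) x * (\<Prod>p\<in>insert p T. G p x) \<partial>lborel) =
      (\<integral>\<^sup>+x. indicator (ball 0 R) x * (G p x * (\<Prod>p\<in>T. G p x)) \<partial>lborel)"
    using insert.hyps by simp
  also have "\<dots> \<le> M p * (\<integral>\<^sup>+x. indicator (ball 0 (R + \<rho>)) x * (\<Prod>p\<in>T. G p x) \<partial>lborel)"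
    using insert.prems(1)[of p] inv averaged_measurable[OF insert.prems(1)]
    unfolding averaged_def by (auto intro!: borel_measurable_prod_ennreal)
  also have "\<dots> \<le> M p * ((\<Prod>p\<in>T. M p) * emeasure lborel (ball (0::'v) (R + \<rho> + card T * \<rho>)))"
    using insert.prems by (intro mult_left_mono insert.IH) auto
  also have "R + \<rho> + card T * \<rho> = R + card (insert p T) * \<rho>"
    using insert.hyps by (simp add: algebra_simps)
  finally show ?case using insert.hyps by (simp add: mult.assoc)
qed simp

lemma nn_integral_translate:
  fixes f :: "'v::euclidean_space \<Rightarrow> ennreal"
  assumes "f \<in> borel_measurable borel"
  shows "(\<integral>\<^sup>+x. f (x + v) \<partial>lborel) = (\<integral>\<^sup>+x. f x \<partial>lborel)"
proof -
  have "(\<integral>\<^sup>+x. f x \<partial>lborel) = (\<integral>\<^sup>+x. f x \<partial>distr lborel borel ((+) v))"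
    by (simp add: lborel_distr_plus)
  also have "\<dots> = (\<integral>\<^sup>+x. f (v + x) \<partial>lborel)"
    by (rule nn_integral_distr) (use assms in auto)
  finally show ?thesis by (simp add: add.commute)
qed

text \<open>Translation by \<open>L \<tau>\<close> changes neither Lebesgue measure nor
  \<open>g\<close>. After integration over \<open>\<tau>\<close> the weight appears only through its
  integral along a translated piece, which is bounded uniformly in \<open>x\<close>; the shift by at
  most \<open>\<rho>\<close> accounts for the larger ball.\<close>

lemma averaged_line:
  fixes L :: "'t::euclidean_space \<Rightarrow> 'v::euclidean_space" and G :: "'v \<Rightarrow> ennreal"
  assumes L: "linear L" "\<And>\<tau>. \<tau> \<in> ball 0 1 \<Longrightarrow> norm (L \<tau>) \<le> \<rho>"
    and inv: "\<And>(g :: 'v \<Rightarrow> ennreal) x \<tau>. invariant U g \<Longrightarrow> g (x + L \<tau>) = g x"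
    and G: "G \<in> borel_measurable borel"
    and vol: "emeasure lborel (ball (0::'t) 1) \<ge> 1"
    and M: "\<And>x. (\<integral>\<^sup>+\<tau>. indicator (ball 0 1) \<tau> * G (x + L \<tau>) \<partial>lborel) \<le> M"
  shows "averaged \<rho> U G M"
  unfolding averaged_def
proof (intro conjI allI impI)
  fix R and g :: "'v \<Rightarrow> ennreal" assume g: "g \<in> borel_measurable borel" "invariant U g"
  have cL: "continuous_on UNIV L" using L(1) by (rule linear_continuous_on[OF linear_conv_bounded_linear[THEN iffD1]])
  define I where "I = (\<integral>\<^sup>+x. indicator (ball 0 R) x * (G x * g x) \<partial>lborel)"
  \<comment> \<open>A parameter ball of volume at least 1 replaces the normalising factor of an
    average.\<close>
  have "I \<le> emeasure lborel (ball (0::'t) 1) * I"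
    using mult_right_mono[OF vol, of I] by simp
  also have "\<dots> = (\<integral>\<^sup>+\<tau>. indicator (ball (0::'t) 1) \<tau> * I \<partial>lborel)"
    by (subst nn_integral_multc) (auto intro!: borel_measurable_indicator)
  also have "\<dots> \<le> (\<integral>\<^sup>+\<tau>. (\<integral>\<^sup>+x. indicator (ball (0::'t) 1) \<tau> * (indicator (ball 0 (R + \<rho>)) x * (G (x + L \<tau>) * g x)) \<partial>lborel) \<partial>lborel)"
  proof (rule nn_integral_mono)
    fix \<tau> :: 't
    show "indicator (ball 0 1) \<tau> * I \<le> (\<integral>\<^sup>+x. indicator (ball (0::'t) 1) \<tau> * (indicator (ball 0 (R + \<rho>)) x * (G (x + L \<tau>) * g x)) \<partial>lborel)"
    proof (cases "\<tau> \<in> ball 0 1")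
      case True
      have "I = (\<integral>\<^sup>+x. indicator (ball 0 R) (x + L \<tau>) * (G (x + L \<tau>) * g (x + L \<tau>)) \<partial>lborel)"
        unfolding I_def using G g by (intro nn_integral_translate[symmetric] measurable_ball_times borel_measurable_times_ennreal)
      also have "\<dots> \<le> (\<integral>\<^sup>+x. indicator (ball 0 (R + \<rho>)) x * (G (x + L \<tau>) * g x) \<partial>lborel)"
      proof (rule nn_integral_mono)
        fix x
        have "x \<in> ball 0 (R + \<rho>)" if "x + L \<tau> \<in> ball 0 R"
          using that L(2)[OF True] norm_triangle_ineq4[of "x + L \<tau>" "L \<tau>"] by simp
        then show "indicator (ball 0 R) (x + L \<tau>) * (G (x + L \<tau>) * g (x + L \<tau>)) \<le> indicator (ball 0 (R + \<rho>)) x * (G (x + L \<tau>) * g x)"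
          using inv[OF g(2)] by (auto simp: indicator_def)
      qed
      finally show ?thesis using True by simp
    qed simp
  qed
  also have "\<dots> = (\<integral>\<^sup>+x. (\<integral>\<^sup>+\<tau>. indicator (ball (0::'t) 1) \<tau> * (indicator (ball 0 (R + \<rho>)) x * (G (x + L \<tau>) * g x)) \<partial>lborel) \<partial>lborel)"
  proof (rule lborel_pair.Fubini')
    have mg: "(\<lambda>z::'v \<times> 't. g (fst z)) \<in> borel_measurable (borel \<Otimes>\<^sub>M borel)"
      by (rule measurable_compose[OF measurable_fst g(1)])
    have mi: "(\<lambda>z::'v \<times> 't. indicator (ball 0 1) (snd z) :: ennreal) \<in> borel_measurable (borel \<Otimes>\<^sub>M borel)"
      "(\<lambda>z::'v \<times> 't. indicator (ball 0 (R + \<rho>)) (fst z) :: ennreal) \<in> borel_measurable (borel \<Otimes>\<^sub>M borel)"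
      by (rule measurable_compose[OF measurable_snd borel_measurable_indicator], simp,
          rule measurable_compose[OF measurable_fst borel_measurable_indicator], simp)
    have mG': "(\<lambda>z. G (fst z + L (snd z))) \<in> borel_measurable (borel \<Otimes>\<^sub>M borel)"
    proof -
      have "(\<lambda>z. fst z + L (snd z)) \<in> borel_measurable (borel \<Otimes>\<^sub>M borel)"
        unfolding borel_prod
        by (intro borel_measurable_continuous_onI continuous_intros continuous_on_compose2[OF cL]) auto
      from measurable_compose[OF this G] show ?thesis .
    qed
    show "(\<lambda>(x, \<tau>). indicator (ball (0::'t) 1) \<tau> * (indicator (ball 0 (R + \<rho>)) x * (G (x + L \<tau>) * g x)))
        \<in> borel_measurable (lborel \<Otimes>\<^sub>M lborel)"
    proof -
      have "(\<lambda>z. indicator (ball (0::'t) 1) (snd z) * (indicator (ball 0 (R + \<rho>)) (fst z) * (G (fst z + L (snd z)) * g (fst z))))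
          \<in> borel_measurable (borel \<Otimes>\<^sub>M borel)"
        by (intro borel_measurable_times_ennreal mg mG' mi)
      moreover have "sets (lborel \<Otimes>\<^sub>M lborel) = sets (borel \<Otimes>\<^sub>M (borel :: 't measure) :: ('v \<times> 't) measure)"
        by (intro sets_pair_measure_cong) simp_all
      ultimately show ?thesis
        unfolding case_prod_beta by (simp cong: measurable_cong_sets)
    qed
  qed
  also have "\<dots> \<le> (\<integral>\<^sup>+x. M * (indicator (ball 0 (R + \<rho>)) x * g x) \<partial>lborel)"
  proof (rule nn_integral_mono)
    fix x
    have m: "(\<lambda>\<tau>. G (x + L \<tau>)) \<in> borel_measurable borel"
      by (rule measurable_compose[OF _ G]) (intro borel_measurable_continuous_onI continuous_intros cL)
    have "(\<integral>\<^sup>+\<tau>. indicator (ball (0::'t) 1) \<tau> * (indicator (ball 0 (R + \<rho>)) x * (G (x + L \<tau>) * g x)) \<partial>lborel) =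
      (\<integral>\<^sup>+\<tau>. (indicator (ball (0::'t) 1) \<tau> * G (x + L \<tau>)) * (indicator (ball 0 (R + \<rho>)) x * g x) \<partial>lborel)"
      by (simp add: mult_ac)
    also have "\<dots> = (\<integral>\<^sup>+\<tau>. indicator (ball (0::'t) 1) \<tau> * G (x + L \<tau>) \<partial>lborel) * (indicator (ball 0 (R + \<rho>)) x * g x)"
      using m by (intro nn_integral_multc) (simp add: measurable_ball_times)
    also have "\<dots> \<le> M * (indicator (ball 0 (R + \<rho>)) x * g x)" by (intro mult_right_mono M) simp
    finally show "(\<integral>\<^sup>+\<tau>. indicator (ball (0::'t) 1) \<tau> * (indicator (ball 0 (R + \<rho>)) x * (G (x + L \<tau>) * g x)) \<partial>lborel) \<le>
      M * (indicator (ball 0 (R + \<rho>)) x * g x)" .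
  qed
  also have "\<dots> = M * (\<integral>\<^sup>+x. indicator (ball 0 (R + \<rho>)) x * g x \<partial>lborel)"
    using g by (intro nn_integral_cmult) (simp add: measurable_ball_times)
  finally show "(\<integral>\<^sup>+x. indicator (ball 0 R) x * (G x * g x) \<partial>lborel) \<le> M * (\<integral>\<^sup>+x. indicator (ball 0 (R + \<rho>)) x * g x \<partial>lborel)"
    by (simp add: I_def)
qed (rule G)

lemma emeasure_unit_ball_ge_1:
  "emeasure lborel (ball (0::real) 1) \<ge> 1" "emeasure lborel (ball (0::complex) 1) \<ge> 1"
  using pi_ge_two by (simp_all add: emeasure_ball unit_ball_vol_2)

section \<open>Estimates at one place\<close>

lemma norm_axis: "norm (axis i (x :: 'b::real_inner) :: 'b^'n::finite) = norm x"
  by (simp add: norm_eq_sqrt_inner inner_axis_axis)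

lemma emb_vec_nth: "number_field_basis \<omega> \<Longrightarrow> emb_vec \<omega> \<sigma> x $ l = emb_coord \<omega> \<sigma> (x $ l)"
  by (simp add: emb_vec_def emb_star_A_star)

lemma linear_emb_vec:
  assumes "number_field_basis \<omega>"
  shows "linear (emb_vec \<omega> \<sigma> :: (real^'k::finite)^'n::finite \<Rightarrow> complex^'n)"
proof (rule linearI)
  fix x y :: "(real^'k)^'n" and c :: real
  show "emb_vec \<omega> \<sigma> (x + y) = emb_vec \<omega> \<sigma> x + emb_vec \<omega> \<sigma> y"
    by (simp add: vec_eq_iff emb_vec_nth[OF assms] emb_coord_def distrib_right sum.distrib)
  show "emb_vec \<omega> \<sigma> (c *\<^sub>R x) = c *\<^sub>R emb_vec \<omega> \<sigma> x"
    by (simp add: vec_eq_iff emb_vec_nth[OF assms] emb_coord_def sum_distrib_left scaleR_conv_of_real[where 'a = complex] mult.assoc)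
qed

lemma emb_vec_axis:
  assumes "number_field_basis \<omega>"
  shows "emb_vec \<omega> \<sigma> (axis l a) = axis l (emb_coord \<omega> \<sigma> a)"
proof -
  have "emb_coord \<omega> \<sigma> 0 = 0" by (simp add: emb_coord_def)
  then show ?thesis by (simp add: vec_eq_iff emb_vec_nth[OF assms] axis_def)
qed

lemma continuous_on_emb_vec:
  assumes "number_field_basis \<omega>"
  shows "continuous_on A (emb_vec \<omega> \<sigma> :: (real^'k::finite)^'n::finite \<Rightarrow> complex^'n)"
  using linear_emb_vec[OF assms] by (rule linear_continuous_on[OF linear_conv_bounded_linear[THEN iffD1]])

section \<open>Directions dual to an embedding\<close>

definition is_dual :: "('k::finite \<Rightarrow> 'a::field_char_0) \<Rightarrow> ('a \<Rightarrow> complex) \<Rightarrow> real^'k \<Rightarrow> real^'k \<Rightarrow> bool"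
  where "is_dual \<omega> \<sigma> a b \<longleftrightarrow> (\<forall>\<tau>\<in>embeddings. emb_coord \<omega> \<tau> a + \<i> * emb_coord \<omega> \<tau> b = (if \<tau> = \<sigma> then 1 else 0))"

lemma embeddings_cnj: "\<sigma> \<in> embeddings \<Longrightarrow> cnj \<circ> \<sigma> \<in> embeddings"
  by (simp add: embeddings_def)

lemma real_embedding_cnj: "\<not> strictly_complex \<sigma> \<Longrightarrow> cnj \<circ> \<sigma> = \<sigma>"
  by (auto simp: strictly_complex_def fun_eq_iff Reals_cnj_iff[symmetric])

lemma strictly_complex_cnj_neq: "strictly_complex \<sigma> \<Longrightarrow> cnj \<circ> \<sigma> \<noteq> \<sigma>"
  by (force simp: strictly_complex_def fun_eq_iff Reals_cnj_iff)

text \<open>Neither \<open>\<tau>\<close> nor its conjugate is \<open>\<sigma>\<close>, so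
  \<open>\<tau>\<close> annihilates both \<open>a + \<i> b\<close> and \<open>a - \<i> b\<close>,
  hence the real vectors \<open>a\<close> and \<open>b\<close> separately. This is the independence
  of distinct places.\<close>

lemma dual_zero:
  assumes "is_dual \<omega> \<sigma> a b" "\<tau> \<in> embeddings" "\<tau> \<noteq> \<sigma>" "\<tau> \<noteq> cnj \<circ> \<sigma>"
  shows "emb_coord \<omega> \<tau> a = 0" "emb_coord \<omega> \<tau> b = 0"
proof -
  have 1: "emb_coord \<omega> \<tau> a + \<i> * emb_coord \<omega> \<tau> b = 0"
    using assms by (simp add: is_dual_def)
  have "cnj \<circ> \<tau> \<noteq> \<sigma>"
  proof
    assume "cnj \<circ> \<tau> = \<sigma>"
    then have "\<tau> = cnj \<circ> \<sigma>" by (simp add: fun_eq_iff) (metis complex_cnj_cnj)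
    with assms(4) show False by simp
  qed
  then have "cnj (emb_coord \<omega> \<tau> a) + \<i> * cnj (emb_coord \<omega> \<tau> b) = 0"
    using assms(1)[unfolded is_dual_def, rule_format, OF embeddings_cnj[OF assms(2)]] by (simp add: emb_coord_cnj)
  from arg_cong[OF this, of cnj] have 2: "emb_coord \<omega> \<tau> a - \<i> * emb_coord \<omega> \<tau> b = 0" by simp
  have "2 * emb_coord \<omega> \<tau> a = (emb_coord \<omega> \<tau> a + \<i> * emb_coord \<omega> \<tau> b) + (emb_coord \<omega> \<tau> a - \<i> * emb_coord \<omega> \<tau> b)"
    by simp
  then show a: "emb_coord \<omega> \<tau> a = 0" unfolding 1 2 by simp
  then show "emb_coord \<omega> \<tau> b = 0" using 1 by simp
qed

lemma dual_real:
  assumes "is_dual \<omega> \<sigma> a b" "\<sigma> \<in> embeddings" "\<not> strictly_complex \<sigma>"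
  shows "emb_coord \<omega> \<sigma> a = 1"
proof -
  have 1: "emb_coord \<omega> \<sigma> a + \<i> * emb_coord \<omega> \<sigma> b = 1" using assms by (simp add: is_dual_def)
  have c: "cnj (emb_coord \<omega> \<sigma> x) = emb_coord \<omega> \<sigma> x" for x
    using emb_coord_cnj[of \<omega> \<sigma> x] real_embedding_cnj[OF assms(3)] by simp
  from arg_cong[OF 1, of cnj] have 2: "emb_coord \<omega> \<sigma> a - \<i> * emb_coord \<omega> \<sigma> b = 1" by (simp add: c)
  have "2 * emb_coord \<omega> \<sigma> a = (emb_coord \<omega> \<sigma> a + \<i> * emb_coord \<omega> \<sigma> b) + (emb_coord \<omega> \<sigma> a - \<i> * emb_coord \<omega> \<sigma> b)"
    by simp
  then show ?thesis unfolding 1 2 by simp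
qed

text \<open>As \<open>cnj \<circ> \<sigma>\<close> is a second embedding, both
  \<open>a + \<i> b\<close> and \<open>a - \<i> b\<close> have known values under
  \<open>\<sigma>\<close>, which gives \<open>1 / 2\<close> for \<open>a\<close> and
  \<open>- \<i> / 2\<close> for \<open>b\<close>. So the opposite derivative is the Cauchy-Riemann
  operator in the coordinate of \<open>\<sigma>\<close>, which runs through all complex numbers on
  the real plane of \<open>a\<close> and \<open>b\<close>.\<close>

lemma dual_complex:
  assumes "is_dual \<omega> \<sigma> a b" "\<sigma> \<in> embeddings" "strictly_complex \<sigma>"
  shows "emb_coord \<omega> \<sigma> a - \<i> * emb_coord \<omega> \<sigma> b = 0"
    "emb_coord \<omega> \<sigma> ((2 * Re \<tau>) *\<^sub>R a - (2 * Im \<tau>) *\<^sub>R b) = \<tau>"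
proof -
  define u where "u = emb_coord \<omega> \<sigma> a"
  define v where "v = emb_coord \<omega> \<sigma> b"
  have 1: "u + \<i> * v = 1" using assms by (simp add: is_dual_def u_def v_def)
  have "cnj u + \<i> * cnj v = 0"
    using assms(1)[unfolded is_dual_def, rule_format, OF embeddings_cnj[OF assms(2)]]
      strictly_complex_cnj_neq[OF assms(3)] by (simp add: emb_coord_cnj u_def v_def)
  from arg_cong[OF this, of cnj] have 2: "u - \<i> * v = 0" by simp
  then show "emb_coord \<omega> \<sigma> a - \<i> * emb_coord \<omega> \<sigma> b = 0" by (simp add: u_def v_def)
  have "2 * u = (u + \<i> * v) + (u - \<i> * v)" by simp
  then have u: "2 * u = 1" unfolding 1 2 by simp
  have "\<i> * (\<i> * (2 * v)) = \<i> * ((u + \<i> * v) - (u - \<i> * v))" by (simp add: algebra_simps)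
  then have v: "2 * v = - \<i>" unfolding 1 2 by (simp add: mult.assoc[symmetric] minus_equation_iff)
  have "emb_coord \<omega> \<sigma> ((2 * Re \<tau>) *\<^sub>R a - (2 * Im \<tau>) *\<^sub>R b) = of_real (Re \<tau>) * (2 * u) - of_real (Im \<tau>) * (2 * v)"
    by (simp add: u_def v_def emb_coord_def algebra_simps sum_subtractf sum_distrib_left)
  also have "\<dots> = \<tau>" unfolding u v by (simp add: complex_eq_iff)
  finally show "emb_coord \<omega> \<sigma> ((2 * Re \<tau>) *\<^sub>R a - (2 * Im \<tau>) *\<^sub>R b) = \<tau>" .
qed

text \<open>The phase involves all embeddings, but each coordinate other than that of
  \<open>\<sigma>\<close> has derivative zero along \<open>a + \<i> b\<close>, including the
  conjugate one when \<open>\<sigma>\<close> is strictly complex.\<close>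

lemma cder_phase:
  fixes \<omega> :: "'k::finite \<Rightarrow> 'a::field_char_0" and f :: "('n::finite, real^'k^'k) mpoly"
  assumes \<omega>: "number_field_basis \<omega>" and f: "\<And>\<beta>. Poly_Mapping.lookup f \<beta> \<in> real_algebra \<omega>"
    and \<sigma>: "\<sigma> \<in> embeddings" "is_dual \<omega> \<sigma> a b"
  shows "cder (axis l a) (axis l b) (\<lambda>x. complex_of_real (phase \<omega> f x))
    (\<lambda>x. ceval (pdiff l (emb_poly \<omega> \<sigma> f)) (emb_vec \<omega> \<sigma> x))"
  unfolding phase_eq_sum[OF \<omega> f]
proof (rule cder_cong[OF cder_sum[OF cder_ceval[OF linear_emb_vec[OF \<omega>]]]])
  fix x
  have "(\<Sum>i\<in>UNIV. (emb_vec \<omega> \<tau> (axis l a) $ i + \<i> * emb_vec \<omega> \<tau> (axis l b) $ i) * ceval (pdiff i (emb_poly \<omega> \<tau> f)) (emb_vec \<omega> \<tau> x))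
    = (if \<tau> = \<sigma> then ceval (pdiff l (emb_poly \<omega> \<sigma> f)) (emb_vec \<omega> \<sigma> x) else 0)" if "\<tau> \<in> embeddings" for \<tau>
  proof -
    have "emb_vec \<omega> \<tau> (axis l a) $ i + \<i> * emb_vec \<omega> \<tau> (axis l b) $ i = (if i = l then (if \<tau> = \<sigma> then 1 else 0) else 0)" for i
      using \<sigma>(2) that by (simp add: emb_vec_axis[OF \<omega>] is_dual_def) (simp add: axis_def)
    then have "(\<Sum>i\<in>UNIV. (emb_vec \<omega> \<tau> (axis l a) $ i + \<i> * emb_vec \<omega> \<tau> (axis l b) $ i) * ceval (pdiff i (emb_poly \<omega> \<tau> f)) (emb_vec \<omega> \<tau> x))
      = (\<Sum>i\<in>UNIV. if i = l then (if \<tau> = \<sigma> then ceval (pdiff i (emb_poly \<omega> \<tau> f)) (emb_vec \<omega> \<tau> x) else 0) else 0)"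
      by (intro sum.cong) auto
    then show ?thesis by simp
  qed
  then show "(\<Sum>\<tau>\<in>embeddings. \<Sum>i\<in>UNIV. (emb_vec \<omega> \<tau> (axis l a) $ i + \<i> * emb_vec \<omega> \<tau> (axis l b) $ i) * ceval (pdiff i (emb_poly \<omega> \<tau> f)) (emb_vec \<omega> \<tau> x))
    = ceval (pdiff l (emb_poly \<omega> \<sigma> f)) (emb_vec \<omega> \<sigma> x)"
    using finite_embeddings[OF \<omega>] \<sigma>(1) by (simp add: sum.delta)
qed

definition osc :: "('k::finite \<Rightarrow> 'a::field_char_0) \<Rightarrow> ('n::finite, real^'k^'k) mpoly \<Rightarrow> (real^'k)^'n \<Rightarrow> complex"
  where "osc \<omega> f x = exp (2 * of_real pi * \<i> * of_real (phase \<omega> f x))"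

text \<open>The phase is real, so its derivative along \<open>a - \<i> b\<close> is the conjugate of
  the one along \<open>a + \<i> b\<close>. Both integrations by parts at a complex place can use the
  oscillation for this reason.\<close>

lemma cder_osc:
  fixes \<omega> :: "'k::finite \<Rightarrow> 'a::field_char_0" and f :: "('n::finite, real^'k^'k) mpoly"
  assumes "number_field_basis \<omega>" "\<And>\<beta>. Poly_Mapping.lookup f \<beta> \<in> real_algebra \<omega>"
    and "\<sigma> \<in> embeddings" "is_dual \<omega> \<sigma> a b"
  defines "Q \<equiv> \<lambda>l x. ceval (pdiff l (emb_poly \<omega> \<sigma> f)) (emb_vec \<omega> \<sigma> x)"
  shows "cder (axis l a) (axis l b) (osc \<omega> f) (\<lambda>x. 2 * of_real pi * \<i> * Q l x * osc \<omega> f x)"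
    "cder (axis l a) (- axis l b) (osc \<omega> f) (\<lambda>x. 2 * of_real pi * \<i> * cnj (Q l x) * osc \<omega> f x)"
proof -
  note d = cder_phase[OF assms(1-4), of l]
  show "cder (axis l a) (axis l b) (osc \<omega> f) (\<lambda>x. 2 * of_real pi * \<i> * Q l x * osc \<omega> f x)"
    using cder_exp[OF cder_cmult[OF d, of "2 * of_real pi * \<i>"]] unfolding Q_def osc_def[abs_def] .
  have "cder (axis l a) (- axis l b) (\<lambda>x. complex_of_real (phase \<omega> f x)) (\<lambda>x. cnj (Q l x))"
    using cder_cnj[OF d] unfolding Q_def by simp
  from cder_exp[OF cder_cmult[OF this, of "2 * of_real pi * \<i>"]]
  show "cder (axis l a) (- axis l b) (osc \<omega> f) (\<lambda>x. 2 * of_real pi * \<i> * cnj (Q l x) * osc \<omega> f x)"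
    unfolding osc_def[abs_def] .
qed

text \<open>A small gradient and a large H-functional force fast relative growth of some derivative.
  The words have length at most \<open>d\<close>, so a number of sets depending only on
  \<open>n\<close> and \<open>d\<close> covers all such points.\<close>

lemma small_gradient_cover:
  fixes \<omega> :: "'k::finite \<Rightarrow> 'a::field_char_0" and f :: "('n::finite, real^'k^'k) mpoly"
    and \<sigma> :: "'a \<Rightarrow> complex"
  defines "P \<equiv> emb_poly \<omega> \<sigma> f"
  assumes "degree_at_most d P" "0 < h" "h \<le> H_point \<omega> f \<sigma> x"
    and "sq_sum (\<lambda>r x. ceval (pdiff r P) (emb_vec \<omega> \<sigma> x) / of_real h) x < 1"
  obtains js i where "length js \<le> d"
    "h * cmod (ceval (foldr pdiff js P) (emb_vec \<omega> \<sigma> x)) < cmod (ceval (pdiff i (foldr pdiff js P)) (emb_vec \<omega> \<sigma> x))"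
proof -
  define z where "z = emb_vec \<omega> \<sigma> x"
  obtain js where js: "js \<noteq> []" "h ^ length js \<le> cmod (ceval (foldr pdiff js P) z)"
    using H_point_attained[OF assms(2)[unfolded P_def] assms(3,4)] unfolding P_def z_def by blast
  have small: "cmod (ceval (pdiff i P) z) < h" for i
  proof -
    have "(cmod (ceval (pdiff i P) z / of_real h))\<^sup>2 \<le> sq_sum (\<lambda>r x. ceval (pdiff r P) (emb_vec \<omega> \<sigma> x) / of_real h) x"
      unfolding sq_sum_def z_def by (rule member_le_sum[of i UNIV "\<lambda>r. (cmod (ceval (pdiff r P) (emb_vec \<omega> \<sigma> x) / of_real h))\<^sup>2"]) auto
    then have "(cmod (ceval (pdiff i P) z / of_real h))\<^sup>2 < 1\<^sup>2" using assms(5) by simp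
    then have "cmod (ceval (pdiff i P) z / of_real h) < 1" by (rule power2_less_imp_less) simp
    then show ?thesis using assms(3) by (simp add: norm_divide divide_less_eq)
  qed
  obtain i js' where i: "h * cmod (ceval (foldr pdiff js' P) z) < cmod (ceval (pdiff i (foldr pdiff js' P)) z)"
    using derivative_growth_step[OF js(1) assms(3) js(2) small] by blast
  \<comment> \<open>For a longer word both sides of the strict inequality are values of the zero
    polynomial.\<close>
  have "length js' \<le> d"
  proof (rule ccontr)
    assume "\<not> length js' \<le> d"
    then have "foldr pdiff js' P = 0" "foldr pdiff (i # js') P = 0"
      using foldr_pdiff_eq_0[OF assms(2), of js'] foldr_pdiff_eq_0[OF assms(2), of "i # js'"] by auto
    then show False using i by simp
  qed
  with i that show thesis unfolding z_def by blast
qed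

subsection \<open>Averages along the variables of an embedding\<close>

definition place_dirs :: "real^'k \<Rightarrow> real^'k \<Rightarrow> ((real^'k::finite)^'n::finite) set"
  where "place_dirs a b = range (\<lambda>l. axis l a) \<union> range (\<lambda>l. axis l b)"

lemma measurable_bad_set:
  assumes "number_field_basis \<omega>"
  shows "{x. h * cmod (ceval p (emb_vec \<omega> \<sigma> x)) < cmod (ceval p' (emb_vec \<omega> \<sigma> x))} \<in> sets borel"
  by (intro borel_open open_Collect_less continuous_intros continuous_on_emb_vec[OF assms])

lemma measurable_ratio:
  assumes "number_field_basis \<omega>"
  shows "(\<lambda>x. ennreal ((cmod (ceval p' (emb_vec \<omega> \<sigma> x) / of_real h) /
      (1 + (cmod (ceval p (emb_vec \<omega> \<sigma> x) / of_real h))\<^sup>2)) ^ m)) \<in> borel_measurable borel"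
proof -
  have "1 + (cmod z)\<^sup>2 \<noteq> 0" for z by (metis add_nonneg_pos less_irrefl zero_le_power2 zero_less_one add.commute)
  then have "continuous_on UNIV (\<lambda>x. (cmod (ceval p' (emb_vec \<omega> \<sigma> x) * inverse (of_real h)) /
      (1 + (cmod (ceval p (emb_vec \<omega> \<sigma> x) * inverse (of_real h)))\<^sup>2)) ^ m)"
    by (intro continuous_intros continuous_on_emb_vec[OF assms]) auto
  then show ?thesis
    by (intro measurable_compose[OF borel_measurable_continuous_onI measurable_ennreal]) (simp add: divide_inverse)
qed

lemma averaged_line_real:
  fixes \<omega> :: "'k::finite \<Rightarrow> 'a::field_char_0" and G :: "(real^'k)^'n::finite \<Rightarrow> ennreal"
  assumes G: "G \<in> borel_measurable borel" and \<rho>: "norm a \<le> \<rho>"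
    and M: "\<And>x. (\<integral>\<^sup>+t. indicator (ball 0 1) t * G (x + t *\<^sub>R axis l a) \<partial>lborel) \<le> M"
  shows "averaged \<rho> (place_dirs a b) G M"
proof (rule averaged_line[where L = "\<lambda>t. t *\<^sub>R axis l a"])
  show "linear (\<lambda>t::real. t *\<^sub>R (axis l a :: (real^'k)^'n))" by (intro linearI) (auto simp: algebra_simps)
  show "norm (\<tau> *\<^sub>R (axis l a :: (real^'k)^'n)) \<le> \<rho>" if "\<tau> \<in> ball 0 1" for \<tau> :: real
  proof -
    have "\<bar>\<tau>\<bar> * norm a \<le> 1 * norm a" using that by (intro mult_right_mono) auto
    then show ?thesis using \<rho> by (simp add: norm_axis)
  qed
  show "g (x + \<tau> *\<^sub>R axis l a) = g x" if "invariant (place_dirs a b) g" for g :: "(real^'k)^'n \<Rightarrow> ennreal" and x \<tau>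
    using that by (auto simp: invariant_def place_dirs_def)
qed (use G M emeasure_unit_ball_ge_1 in auto)

text \<open>The average is over a disc in the real plane of \<open>a\<close> and \<open>b\<close>.
  For a dual pair at a complex place the factors 2 and the sign make the embedding coordinate move
  by exactly \<open>\<tau>\<close>.\<close>

lemma averaged_line_complex:
  fixes \<omega> :: "'k::finite \<Rightarrow> 'a::field_char_0" and G :: "(real^'k)^'n::finite \<Rightarrow> ennreal"
  assumes G: "G \<in> borel_measurable borel" and \<rho>: "2 * norm a + 2 * norm b \<le> \<rho>"
    and M: "\<And>x. (\<integral>\<^sup>+\<tau>. indicator (ball 0 1) \<tau> * G (x + axis l ((2 * Re \<tau>) *\<^sub>R a - (2 * Im \<tau>) *\<^sub>R b)) \<partial>lborel) \<le> M"
  shows "averaged \<rho> (place_dirs a b) G M"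
proof (rule averaged_line[where L = "\<lambda>\<tau>. axis l ((2 * Re \<tau>) *\<^sub>R a - (2 * Im \<tau>) *\<^sub>R b)"])
  have split: "axis l ((2 * Re \<tau>) *\<^sub>R a - (2 * Im \<tau>) *\<^sub>R b) = (2 * Re \<tau>) *\<^sub>R axis l a + (- 2 * Im \<tau>) *\<^sub>R (axis l b :: (real^'k)^'n)" for \<tau>
    by (simp add: vec_eq_iff axis_def)
  show "linear (\<lambda>\<tau>. axis l ((2 * Re \<tau>) *\<^sub>R a - (2 * Im \<tau>) *\<^sub>R b) :: (real^'k)^'n)"
    unfolding split by (intro linearI) (auto simp: algebra_simps)
  show "norm (axis l ((2 * Re \<tau>) *\<^sub>R a - (2 * Im \<tau>) *\<^sub>R b) :: (real^'k)^'n) \<le> \<rho>" if "\<tau> \<in> ball 0 1" for \<tau> :: complex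
  proof -
    have "norm ((2 * Re \<tau>) *\<^sub>R a - (2 * Im \<tau>) *\<^sub>R b) \<le> norm ((2 * Re \<tau>) *\<^sub>R a) + norm ((2 * Im \<tau>) *\<^sub>R b)"
      by (rule norm_triangle_ineq4)
    also have "\<dots> \<le> 2 * norm a + 2 * norm b"
    proof -
      have "\<bar>Re \<tau>\<bar> \<le> 1" "\<bar>Im \<tau>\<bar> \<le> 1"
        using that abs_Re_le_cmod[of \<tau>] abs_Im_le_cmod[of \<tau>] by auto
      then have "\<bar>Re \<tau>\<bar> * norm a \<le> 1 * norm a" "\<bar>Im \<tau>\<bar> * norm b \<le> 1 * norm b"
        by (intro mult_right_mono; simp)+
      then show ?thesis by (simp add: abs_mult)
    qed
    finally show ?thesis using \<rho> by (simp add: norm_axis)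
  qed
  show "g (x + axis l ((2 * Re \<tau>) *\<^sub>R a - (2 * Im \<tau>) *\<^sub>R b)) = g x"
    if "invariant (place_dirs a b) g" for g :: "(real^'k)^'n \<Rightarrow> ennreal" and x \<tau>
  proof -
    have "g (x + u *\<^sub>R axis l a + v *\<^sub>R axis l b) = g x" for u v
      using that by (auto simp: invariant_def place_dirs_def)
    then show ?thesis unfolding split add.assoc[symmetric] .
  qed
qed (use G M emeasure_unit_ball_ge_1 in auto)

context
  fixes \<omega> :: "'k::finite \<Rightarrow> 'a::field_char_0" and \<sigma> :: "'a \<Rightarrow> complex" and a b :: "real^'k"
    and d :: nat and h \<rho> :: real and p :: "('n::finite, complex) mpoly"
  assumes \<omega>: "number_field_basis \<omega>" and deg: "degree_at_most d p" and h: "h > 0"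
    and \<rho>: "2 * norm a + 2 * norm b \<le> \<rho>"
begin

text \<open>Along \<open>a\<close> the embedding coordinate moves by a real parameter, so
  \<open>p\<close> restricts to a one-variable polynomial of degree at most \<open>d\<close>. Its
  roots control the first set, its total variation the second weight.\<close>

lemma averaged_real:
  assumes "emb_coord \<omega> \<sigma> a = 1"
  shows averaged_bad_real: "averaged \<rho> (place_dirs a b)
      (indicator {x. h * cmod (ceval p (emb_vec \<omega> \<sigma> x)) < cmod (ceval (pdiff l p) (emb_vec \<omega> \<sigma> x))})
      (ennreal (2 * (real d)\<^sup>2 / h))"
    and averaged_ratio_real: "(\<And>x. ceval p (emb_vec \<omega> \<sigma> x) \<in> \<real>) \<Longrightarrow> averaged \<rho> (place_dirs a b)
      (\<lambda>x. ennreal ((cmod (ceval (pdiff l p) (emb_vec \<omega> \<sigma> x) / of_real h) /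
        (1 + (cmod (ceval p (emb_vec \<omega> \<sigma> x) / of_real h))\<^sup>2)) ^ 1)) (ennreal (d * pi))"
proof -
  have line: "emb_vec \<omega> \<sigma> (x + t *\<^sub>R axis l a) = emb_vec \<omega> \<sigma> x + axis l (of_real t)" for x :: "(real^'k)^'n" and t
    by (simp add: linear_add[OF linear_emb_vec[OF \<omega>]] linear_scale[OF linear_emb_vec[OF \<omega>]] emb_vec_axis[OF \<omega>] assms)
      (simp add: vec_eq_iff axis_def scaleR_conv_of_real[where 'a = complex])
  have na: "norm a \<le> \<rho>" using \<rho> norm_ge_zero[of a] norm_ge_zero[of b] by linarith
  show "averaged \<rho> (place_dirs a b)
      (indicator {x. h * cmod (ceval p (emb_vec \<omega> \<sigma> x)) < cmod (ceval (pdiff l p) (emb_vec \<omega> \<sigma> x))})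
      (ennreal (2 * (real d)\<^sup>2 / h))"
  proof (rule averaged_line_real[OF _ na])
    fix x :: "(real^'k)^'n"
    obtain r where r: "degree r \<le> d" "\<And>t. poly r t = ceval p (emb_vec \<omega> \<sigma> x + axis l t)"
      "\<And>t. poly (pderiv r) t = ceval (pdiff l p) (emb_vec \<omega> \<sigma> x + axis l t)"
      using ceval_line[OF deg] by blast
    define B where "B = {t::real. h * cmod (poly r (of_real t)) < cmod (poly (pderiv r) (of_real t))}"
    have "B \<in> sets borel" unfolding B_def by (intro borel_open open_Collect_less continuous_intros)
    have "(\<integral>\<^sup>+t. indicator (ball 0 1) t * indicator {x. h * cmod (ceval p (emb_vec \<omega> \<sigma> x)) < cmod (ceval (pdiff l p) (emb_vec \<omega> \<sigma> x))} (x + t *\<^sub>R axis l a) \<partial>lborel)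
        \<le> (\<integral>\<^sup>+t. indicator B t \<partial>lborel)"
      by (rule nn_integral_mono) (auto simp: indicator_def B_def line r)
    also have "\<dots> = emeasure lborel B" using \<open>B \<in> sets borel\<close> by simp
    also have "\<dots> \<le> ennreal (2 * (real d)\<^sup>2 / h)" unfolding B_def by (rule near_root_real_measure[OF r(1) h])
    finally show "(\<integral>\<^sup>+t. indicator (ball 0 1) t * indicator {x. h * cmod (ceval p (emb_vec \<omega> \<sigma> x)) < cmod (ceval (pdiff l p) (emb_vec \<omega> \<sigma> x))} (x + t *\<^sub>R axis l a) \<partial>lborel)
        \<le> ennreal (2 * (real d)\<^sup>2 / h)" .
  qed (intro borel_measurable_indicator measurable_bad_set \<omega>)
  assume real: "\<And>x. ceval p (emb_vec \<omega> \<sigma> x) \<in> \<real>"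
  show "averaged \<rho> (place_dirs a b)
      (\<lambda>x. ennreal ((cmod (ceval (pdiff l p) (emb_vec \<omega> \<sigma> x) / of_real h) /
        (1 + (cmod (ceval p (emb_vec \<omega> \<sigma> x) / of_real h))\<^sup>2)) ^ 1)) (ennreal (d * pi))"
  proof (rule averaged_line_real[OF measurable_ratio[OF \<omega>] na])
    fix x :: "(real^'k)^'n"
    obtain r where r: "degree r \<le> d" "\<And>t. poly r t = ceval p (emb_vec \<omega> \<sigma> x + axis l t)"
      "\<And>t. poly (pderiv r) t = ceval (pdiff l p) (emb_vec \<omega> \<sigma> x + axis l t)"
      using ceval_line[OF deg] by blast
    \<comment> \<open>Dividing by \<open>h\<close> does not raise the degree, and the variation
      bound depends on the degree alone.\<close>
    define q where "q = smult (1 / of_real h) r"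
    have q: "degree q \<le> d" "\<And>t. poly q t = poly r t / of_real h" "\<And>t. poly (pderiv q) t = poly (pderiv r) t / of_real h"
      using r(1) by (auto simp: q_def pderiv_smult intro: order_trans[OF degree_smult_le])
    have "poly q (of_real t) \<in> \<real>" for t :: real
      using real[of "x + t *\<^sub>R axis l a"] by (simp add: q r line)
    from real_variation_integral[OF q(1) this]
    have le: "(\<integral>\<^sup>+t. ennreal (cmod (poly (pderiv q) (of_real t)) / (1 + (cmod (poly q (of_real t)))\<^sup>2)) * indicator {-1..1} t \<partial>lborel) \<le> ennreal (d * pi)" .
    have "(\<integral>\<^sup>+t. indicator (ball 0 1) t * ennreal ((cmod (ceval (pdiff l p) (emb_vec \<omega> \<sigma> (x + t *\<^sub>R axis l a)) / of_real h) /
        (1 + (cmod (ceval p (emb_vec \<omega> \<sigma> (x + t *\<^sub>R axis l a)) / of_real h))\<^sup>2)) ^ 1) \<partial>lborel) \<le>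
        (\<integral>\<^sup>+t. ennreal (cmod (poly (pderiv q) (of_real t)) / (1 + (cmod (poly q (of_real t)))\<^sup>2)) * indicator {-1..1} t \<partial>lborel)"
      by (rule nn_integral_mono) (auto simp: indicator_def line q r dist_real_def)
    then show "(\<integral>\<^sup>+t. indicator (ball 0 1) t * ennreal ((cmod (ceval (pdiff l p) (emb_vec \<omega> \<sigma> (x + t *\<^sub>R axis l a)) / of_real h) /
        (1 + (cmod (ceval p (emb_vec \<omega> \<sigma> (x + t *\<^sub>R axis l a)) / of_real h))\<^sup>2)) ^ 1) \<partial>lborel) \<le> ennreal (d * pi)"
      using le by (rule order_trans)
  qed
qed

lemma averaged_complex:
  assumes "\<And>\<tau>. emb_coord \<omega> \<sigma> ((2 * Re \<tau>) *\<^sub>R a - (2 * Im \<tau>) *\<^sub>R b) = \<tau>"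
  shows averaged_bad_complex: "averaged \<rho> (place_dirs a b)
      (indicator {x. h * cmod (ceval p (emb_vec \<omega> \<sigma> x)) < cmod (ceval (pdiff l p) (emb_vec \<omega> \<sigma> x))})
      (ennreal (4 * real d ^ 3 / h\<^sup>2))"
    and averaged_ratio_complex: "averaged \<rho> (place_dirs a b)
      (\<lambda>x. ennreal ((cmod (ceval (pdiff l p) (emb_vec \<omega> \<sigma> x) / of_real h) /
        (1 + (cmod (ceval p (emb_vec \<omega> \<sigma> x) / of_real h))\<^sup>2))\<^sup>2)) (ennreal (4 + 32 * real d))"
proof -
  have line: "emb_vec \<omega> \<sigma> (x + axis l ((2 * Re \<tau>) *\<^sub>R a - (2 * Im \<tau>) *\<^sub>R b)) = emb_vec \<omega> \<sigma> x + axis l \<tau>" for x :: "(real^'k)^'n" and \<tau>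
    by (simp only: linear_add[OF linear_emb_vec[OF \<omega>]] emb_vec_axis[OF \<omega>] assms)
  show "averaged \<rho> (place_dirs a b)
      (indicator {x. h * cmod (ceval p (emb_vec \<omega> \<sigma> x)) < cmod (ceval (pdiff l p) (emb_vec \<omega> \<sigma> x))})
      (ennreal (4 * real d ^ 3 / h\<^sup>2))"
  proof (rule averaged_line_complex[OF _ \<rho>])
    fix x :: "(real^'k)^'n"
    obtain r where r: "degree r \<le> d" "\<And>t. poly r t = ceval p (emb_vec \<omega> \<sigma> x + axis l t)"
      "\<And>t. poly (pderiv r) t = ceval (pdiff l p) (emb_vec \<omega> \<sigma> x + axis l t)"
      using ceval_line[OF deg] by blast
    define B where "B = {t. h * cmod (poly r t) < cmod (poly (pderiv r) t)}"
    have "B \<in> sets borel" unfolding B_def by (intro borel_open open_Collect_less continuous_intros)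
    have "(\<integral>\<^sup>+\<tau>. indicator (ball 0 1) \<tau> * indicator {x. h * cmod (ceval p (emb_vec \<omega> \<sigma> x)) < cmod (ceval (pdiff l p) (emb_vec \<omega> \<sigma> x))} (x + axis l ((2 * Re \<tau>) *\<^sub>R a - (2 * Im \<tau>) *\<^sub>R b)) \<partial>lborel)
        \<le> (\<integral>\<^sup>+t. indicator B t \<partial>lborel)"
      by (rule nn_integral_mono) (simp add: indicator_def B_def line r)
    also have "\<dots> = emeasure lborel B" using \<open>B \<in> sets borel\<close> by simp
    also have "\<dots> \<le> ennreal (4 * real d ^ 3 / h\<^sup>2)" unfolding B_def by (rule near_root_complex_measure[OF r(1) h])
    finally show "(\<integral>\<^sup>+\<tau>. indicator (ball 0 1) \<tau> * indicator {x. h * cmod (ceval p (emb_vec \<omega> \<sigma> x)) < cmod (ceval (pdiff l p) (emb_vec \<omega> \<sigma> x))} (x + axis l ((2 * Re \<tau>) *\<^sub>R a - (2 * Im \<tau>) *\<^sub>R b)) \<partial>lborel)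
        \<le> ennreal (4 * real d ^ 3 / h\<^sup>2)" .
  qed (intro borel_measurable_indicator measurable_bad_set \<omega>)
  show "averaged \<rho> (place_dirs a b)
      (\<lambda>x. ennreal ((cmod (ceval (pdiff l p) (emb_vec \<omega> \<sigma> x) / of_real h) /
        (1 + (cmod (ceval p (emb_vec \<omega> \<sigma> x) / of_real h))\<^sup>2))\<^sup>2)) (ennreal (4 + 32 * real d))"
  proof (rule averaged_line_complex[OF measurable_ratio[OF \<omega>] \<rho>])
    fix x :: "(real^'k)^'n"
    obtain r where r: "degree r \<le> d" "\<And>t. poly r t = ceval p (emb_vec \<omega> \<sigma> x + axis l t)"
      "\<And>t. poly (pderiv r) t = ceval (pdiff l p) (emb_vec \<omega> \<sigma> x + axis l t)"
      using ceval_line[OF deg] by blast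
    define q where "q = smult (1 / of_real h) r"
    have q: "degree q \<le> d" "\<And>t. poly q t = poly r t / of_real h" "\<And>t. poly (pderiv q) t = poly (pderiv r) t / of_real h"
      using r(1) by (auto simp: q_def pderiv_smult intro: order_trans[OF degree_smult_le])
    show "(\<integral>\<^sup>+\<tau>. indicator (ball 0 1) \<tau> * ennreal ((cmod (ceval (pdiff l p) (emb_vec \<omega> \<sigma> (x + axis l ((2 * Re \<tau>) *\<^sub>R a - (2 * Im \<tau>) *\<^sub>R b))) / of_real h) /
        (1 + (cmod (ceval p (emb_vec \<omega> \<sigma> (x + axis l ((2 * Re \<tau>) *\<^sub>R a - (2 * Im \<tau>) *\<^sub>R b))) / of_real h))\<^sup>2))\<^sup>2) \<partial>lborel) \<le> ennreal (4 + 32 * real d)"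
      using complex_variation_integral[OF q(1)] unfolding line q r
      by (simp only: mult.commute of_nat_add of_nat_mult of_nat_numeral)
  qed
qed

end


subsection \<open>The contribution of one place\<close>

text \<open>\<open>A\<close> holds the weights from integration by parts, \<open>G\<close> a
  majorant of their total size on \<open>K\<close>, and \<open>M\<close> the average size of
  \<open>G\<close>. Invariance along all \<open>v\<close> with
  \<open>emb_vec \<omega> \<sigma> v = 0\<close> says that the weights depend only on the
  coordinates of this embedding; they are thus constant in the directions of other places.\<close>

definition place_estimate ::
    "('k::finite \<Rightarrow> 'a::field_char_0) \<Rightarrow> ('n::finite, real^'k^'k) mpoly \<Rightarrow> ('a \<Rightarrow> complex) \<Rightarrow>
      ((real^'k)^'n) set \<Rightarrow> real^'k \<Rightarrow> real^'k \<Rightarrow> real \<Rightarrow> real \<Rightarrow> bool"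
  where "place_estimate \<omega> f \<sigma> K a b \<rho> M \<longleftrightarrow>
    (\<exists>(A :: 'n option \<times> 'n option \<Rightarrow> (real^'k)^'n \<Rightarrow> complex) G.
      (\<forall>i. continuous_on UNIV (A i)) \<and>
      (\<forall>i V. (\<forall>v\<in>V. emb_vec \<omega> \<sigma> v = 0) \<longrightarrow> invariant V (A i)) \<and>
      (\<forall>V. (\<forall>v\<in>V. emb_vec \<omega> \<sigma> v = 0) \<longrightarrow> invariant V G) \<and>
      (\<forall>g \<psi>. continuous_on UNIV g \<longrightarrow> invariant (place_dirs a b) g \<longrightarrow> test_function K \<psi> \<longrightarrow>
        (LINT x|lborel. osc \<omega> f x * g x * \<psi> x) =
        (\<Sum>i\<in>UNIV. LINT x|lborel. osc \<omega> f x * (g x * A i x) * place_op (\<lambda>l. axis l a) (\<lambda>l. axis l b) i \<psi> x)) \<and>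
      averaged \<rho> (place_dirs a b) G (ennreal M) \<and>
      (\<forall>x\<in>K. ennreal (\<Sum>i\<in>UNIV. cmod (A i x)) \<le> G x))"

text \<open>Used for the places outside \<open>S\<close>: the amplitude is left unchanged and
  nothing is gained.\<close>

lemma place_estimate_trivial:
  fixes \<omega> :: "'k::finite \<Rightarrow> 'a::field_char_0" and f :: "('n::finite, real^'k^'k) mpoly"
  assumes "\<rho> \<ge> 0"
  shows "place_estimate \<omega> f \<sigma> K a b \<rho> 1"
  unfolding place_estimate_def
proof (intro exI[of _ "\<lambda>i _. if i = (None, None) then 1 else 0"] exI[of _ "\<lambda>_. 1"] conjI allI impI ballI)
  show "averaged \<rho> (place_dirs a b) (\<lambda>_. 1) (ennreal 1)" using averaged_const[OF assms, of _ 1] by simp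
  fix g \<psi> :: "(real^'k)^'n \<Rightarrow> complex"
  show "(LINT x|lborel. osc \<omega> f x * g x * \<psi> x) =
      (\<Sum>i\<in>UNIV. LINT x|lborel. osc \<omega> f x * (g x * (if i = (None, None) then 1 else 0)) * place_op (\<lambda>l. axis l a) (\<lambda>l. axis l b) i \<psi> x)"
    by (simp add: sum_UNIV_option_pair place_op_def)
qed (auto simp: sum_UNIV_option_pair invariant_def)

lemma place_estimate_mono:
  fixes \<omega> :: "'k::finite \<Rightarrow> 'a::field_char_0" and f :: "('n::finite, real^'k^'k) mpoly"
  assumes "place_estimate \<omega> f \<sigma> K a b \<rho> M" "M \<le> M'"
  shows "place_estimate \<omega> f \<sigma> K a b \<rho> M'"
proof -
  have "averaged \<rho> U G (ennreal M')" if "averaged \<rho> U G (ennreal M)" for U and G :: "(real^'k)^'n \<Rightarrow> ennreal"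
    using that unfolding averaged_def
    using order_trans[OF _ mult_right_mono[OF ennreal_leI[OF assms(2)], OF zero_le]] by auto
  note mono = this
  show ?thesis
    using assms(1) unfolding place_estimate_def
    by (elim exE conjE) (intro exI conjI; (assumption | rule mono, assumption))
qed

lemma ennreal_double_sums:
  assumes "0 \<le> \<alpha>" "0 \<le> \<beta>" "0 \<le> \<gamma>" "0 \<le> \<delta>"
  shows "(\<Sum>i\<in>I. \<Sum>j\<in>J. ennreal \<alpha>) + (ennreal \<beta> + ennreal \<gamma> * (\<Sum>l\<in>L. \<Sum>r\<in>R. ennreal \<delta>)) =
    ennreal ((\<Sum>i\<in>I. \<Sum>j\<in>J. \<alpha>) + (\<beta> + \<gamma> * (\<Sum>l\<in>L. \<Sum>r\<in>R. \<delta>)))"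
  using assms by (simp add: sum_ennreal sum_nonneg ennreal_plus ennreal_mult del: sum_constant)

lemma ennreal_affine:
  assumes "0 \<le> u" "0 \<le> v" "0 \<le> w" "0 \<le> t"
  shows "ennreal (u + (v + w * t)) = ennreal u + (ennreal v + ennreal w * ennreal t)"
  using assms by (simp add: ennreal_plus ennreal_mult)

lemma invariant_emb_vec:
  assumes "number_field_basis \<omega>" "\<forall>v\<in>V. emb_vec \<omega> \<sigma> v = 0"
  shows "invariant V (\<lambda>x. F (emb_vec \<omega> \<sigma> x))"
  using assms(2) by (simp add: invariant_def linear_add[OF linear_emb_vec[OF assms(1)]] linear_scale[OF linear_emb_vec[OF assms(1)]])

text \<open>The full gradient in the denominator is weakened to one component at a time, by
  \<open>max 1 s \<ge> (1 + |q r|^2) / 2\<close>. This leaves weights built from a single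
  polynomial, whose averages along lines are known.\<close>

lemma deriv_ratio_le:
  fixes q :: "'n::finite \<Rightarrow> 'v \<Rightarrow> complex"
  shows "deriv_ratio q y x \<le> 2 * (\<Sum>l\<in>UNIV. \<Sum>r\<in>UNIV. cmod (y l r x) / (1 + (cmod (q r x))\<^sup>2))" "0 \<le> deriv_ratio q y x"
proof -
  define s where "s = sq_sum q x"
  have "cmod (y l r x) / max 1 s \<le> 2 * (cmod (y l r x) / (1 + (cmod (q r x))\<^sup>2))" for l r
  proof -
    have "(cmod (q r x))\<^sup>2 \<le> s" unfolding s_def sq_sum_def by (rule member_le_sum[of r UNIV "\<lambda>r. (cmod (q r x))\<^sup>2"]) auto
    then have "(1 + (cmod (q r x))\<^sup>2) / 2 \<le> max 1 s" by simp
    moreover have "1 + (cmod (q r x))\<^sup>2 > 0" by (rule add_pos_nonneg) auto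
    ultimately have "cmod (y l r x) / max 1 s \<le> cmod (y l r x) / ((1 + (cmod (q r x))\<^sup>2) / 2)"
      by (intro divide_left_mono) auto
    then show ?thesis by (simp add: mult.commute)
  qed
  then show "deriv_ratio q y x \<le> 2 * (\<Sum>l\<in>UNIV. \<Sum>r\<in>UNIV. cmod (y l r x) / (1 + (cmod (q r x))\<^sup>2))"
    unfolding deriv_ratio_def s_def[symmetric] sum_divide_distrib sum_distrib_left by (intro sum_mono)
  show "0 \<le> deriv_ratio q y x" unfolding deriv_ratio_def by (intro divide_nonneg_pos sum_nonneg) auto
qed

context
  fixes \<omega> :: "'k::finite \<Rightarrow> 'a::field_char_0" and f :: "('n::finite, real^'k^'k) mpoly" and \<sigma> :: "'a \<Rightarrow> complex"
    and a b :: "real^'k" and d :: nat and h \<rho> :: real and K :: "((real^'k)^'n) set"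
  assumes \<omega>: "number_field_basis \<omega>" and f: "\<And>\<beta>. Poly_Mapping.lookup f \<beta> \<in> real_algebra \<omega>"
    and deg: "degree_at_most d (emb_poly \<omega> \<sigma> f)" and \<sigma>: "\<sigma> \<in> embeddings" "is_dual \<omega> \<sigma> a b"
    and h: "h > 0" and H: "\<And>x. x \<in> K \<Longrightarrow> h \<le> H_point \<omega> f \<sigma> x" and \<rho>: "2 * norm a + 2 * norm b \<le> \<rho>"
begin

definition "loc_poly = emb_poly \<omega> \<sigma> f"
definition "grad_quot r x = ceval (pdiff r loc_poly) (emb_vec \<omega> \<sigma> x) / complex_of_real h"
definition "hess_quot l r x = ceval (pdiff l (pdiff r loc_poly)) (emb_vec \<omega> \<sigma> x) / complex_of_real h"
definition "bad_set js i = {x :: (real^'k)^'n. h * cmod (ceval (foldr pdiff js loc_poly) (emb_vec \<omega> \<sigma> x)) <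
  cmod (ceval (pdiff i (foldr pdiff js loc_poly)) (emb_vec \<omega> \<sigma> x))}"
definition "words = {js :: 'n list. length js \<le> d}"
text \<open>The counted sets are given by polynomial inequalities and can be followed along whole
  lines, whereas the lower bound for the H-functional is known on \<open>K\<close> only. A sum of
  indicators, in place of the indicator of the union, is averaged term by term.\<close>

definition "bad_count x = (\<Sum>js\<in>words. \<Sum>i\<in>UNIV. indicator (bad_set js i) x :: ennreal)"

lemma finite_J: "finite words"
  using finite_lists_length_le[of "UNIV :: 'n set" d] by (simp add: words_def)

lemma bad_count_ge:
  assumes "x \<in> K"
  shows "ennreal (if sq_sum grad_quot x < 1 then 1 else 0) \<le> bad_count x"
proof (cases "sq_sum grad_quot x < 1")
  case True
  then obtain js i where "js \<in> words" "x \<in> bad_set js i"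
    using small_gradient_cover[OF deg h H[OF assms]]
    unfolding words_def bad_set_def loc_poly_def grad_quot_def[abs_def] by blast
  then have "1 \<le> (\<Sum>i\<in>UNIV. indicator (bad_set js i) x :: ennreal)"
    using member_le_sum[of i UNIV "\<lambda>i. indicator (bad_set js i) x :: ennreal"] by simp
  also have "\<dots> \<le> bad_count x"
    unfolding bad_count_def by (rule member_le_sum[OF \<open>js \<in> words\<close> _ finite_J]) simp
  finally show ?thesis using True by simp
qed simp

lemma invariant_place:
  assumes "\<forall>v\<in>V. emb_vec \<omega> \<sigma> v = 0"
  shows "invariant V (grad_quot r)" "invariant V (hess_quot l r)" "invariant V (bad_count)"
  using invariant_emb_vec[OF \<omega> assms, of "\<lambda>z. ceval (pdiff r loc_poly) z / complex_of_real h"]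
    invariant_emb_vec[OF \<omega> assms, of "\<lambda>z. ceval (pdiff l (pdiff r loc_poly)) z / complex_of_real h"]
    invariant_emb_vec[OF \<omega> assms, of "\<lambda>z. \<Sum>js\<in>words. \<Sum>i\<in>UNIV. indicator {z. h * cmod (ceval (foldr pdiff js loc_poly) z) <
      cmod (ceval (pdiff i (foldr pdiff js loc_poly)) z)} z :: ennreal"]
  by (simp_all add: grad_quot_def[abs_def] hess_quot_def[abs_def] bad_count_def[abs_def] bad_set_def indicator_def)

lemma cder_place:
  "cder (axis l a) (axis l b) (osc \<omega> f) (\<lambda>x. (2 * of_real pi * \<i> * of_real h) * grad_quot l x * osc \<omega> f x)"
  "cder (axis l a) (- axis l b) (osc \<omega> f) (\<lambda>x. (2 * of_real pi * \<i> * of_real h) * cnj (grad_quot l x) * osc \<omega> f x)"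
  "cder (axis l a) (axis l b) (grad_quot r) (hess_quot l r)"
proof -
  have h0: "complex_of_real h \<noteq> 0" using h by simp
  show "cder (axis l a) (axis l b) (osc \<omega> f) (\<lambda>x. (2 * of_real pi * \<i> * of_real h) * grad_quot l x * osc \<omega> f x)"
    by (rule cder_cong[OF cder_osc(1)[OF \<omega> f \<sigma>]]) (use h0 in \<open>simp add: grad_quot_def loc_poly_def\<close>)
  show "cder (axis l a) (- axis l b) (osc \<omega> f) (\<lambda>x. (2 * of_real pi * \<i> * of_real h) * cnj (grad_quot l x) * osc \<omega> f x)"
    by (rule cder_cong[OF cder_osc(2)[OF \<omega> f \<sigma>]]) (use h0 in \<open>simp add: grad_quot_def loc_poly_def\<close>)
  have one: "emb_coord \<omega> \<sigma> a + \<i> * emb_coord \<omega> \<sigma> b = 1" using \<sigma> by (simp add: is_dual_def)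
  show "cder (axis l a) (axis l b) (grad_quot r) (hess_quot l r)"
    unfolding grad_quot_def[abs_def] hess_quot_def[abs_def] divide_inverse mult.commute[of _ "inverse _"]
  proof (rule cder_cmult, rule cder_cong[OF cder_ceval[OF linear_emb_vec[OF \<omega>]]])
    fix x
    have "emb_vec \<omega> \<sigma> (axis l a) $ i + \<i> * emb_vec \<omega> \<sigma> (axis l b) $ i = (if i = l then 1 else 0)" for i
      using one by (simp add: emb_vec_axis[OF \<omega>]) (simp add: axis_def)
    then show "(\<Sum>i\<in>UNIV. (emb_vec \<omega> \<sigma> (axis l a) $ i + \<i> * emb_vec \<omega> \<sigma> (axis l b) $ i) * ceval (pdiff i (pdiff r loc_poly)) (emb_vec \<omega> \<sigma> x)) =
      ceval (pdiff l (pdiff r loc_poly)) (emb_vec \<omega> \<sigma> x)"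
      by (simp add: sum_delta_mult)
  qed
qed

lemma cder_invariant_place:
  assumes "continuous_on UNIV g" "invariant (place_dirs a b) g"
  shows "cder (axis l a) (axis l b) g (\<lambda>_. 0)" "cder (axis l a) (- axis l b) g (\<lambda>_. 0)"
proof -
  have inv: "invariant {axis l a, axis l b, - axis l b} g"
    using assms(2) scaleR_minus_left unfolding invariant_def place_dirs_def
    by (auto simp: scaleR_minus_left[symmetric] simp del: scaleR_minus_left)
  show "cder (axis l a) (axis l b) g (\<lambda>_. 0)" "cder (axis l a) (- axis l b) g (\<lambda>_. 0)"
    by (rule cder_invariant[OF inv assms(1)]; simp)+
qed

lemma cmod_const: "cmod (2 * of_real pi * \<i> * of_real h) \<ge> h"
proof -
  have "1 * h \<le> (2 * pi) * h" using h pi_ge_two by (intro mult_right_mono) auto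
  then show ?thesis using h by (simp add: norm_mult)
qed

definition "hess_ratio l r x = cmod (hess_quot l r x) / (1 + (cmod (grad_quot r x))\<^sup>2)"

lemma ratio_nonneg: "hess_ratio l r x \<ge> 0"
  unfolding hess_ratio_def by (intro divide_nonneg_pos add_pos_nonneg) auto

lemma invariant_ratio:
  assumes "\<forall>v\<in>V. emb_vec \<omega> \<sigma> v = 0"
  shows "invariant V (hess_ratio l r)"
  using invariant_place(1)[OF assms, of r] invariant_place(2)[OF assms, of l r] by (simp add: invariant_def hess_ratio_def)

lemma deg_P: "degree_at_most d loc_poly"
  using deg by (simp add: loc_poly_def)

lemma place_estimate_real:
  assumes real: "\<not> strictly_complex \<sigma>"
  shows "place_estimate \<omega> f \<sigma> K a b \<rho>
    ((card {js :: 'n list. length js \<le> d} * (CARD('n) * (2 * (real d)\<^sup>2)) +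
      (CARD('n) * 3 + CARD('n) * 42 * (CARD('n) * (CARD('n) * (d * pi))))) / h)"
proof -
  have cn: "(\<chi> i. cnj (emb_vec \<omega> \<sigma> x $ i)) = emb_vec \<omega> \<sigma> x" for x :: "(real^'k)^'n"
    using emb_coord_cnj[of \<omega> \<sigma>] real_embedding_cnj[OF real] by (simp add: vec_eq_iff emb_vec_nth[OF \<omega>])
  have Pc: "Poly_Mapping.map cnj loc_poly = loc_poly"
    using emb_poly_cnj[of \<omega> \<sigma> f] real_embedding_cnj[OF real] by (simp add: loc_poly_def)
  \<comment> \<open>Conjugation fixes both the polynomial and the point at a real embedding, so the
    gradient is real, as \<open>real_place\<close> and the variation bound require.\<close>
  have qreal: "cnj (ceval (pdiff r loc_poly) (emb_vec \<omega> \<sigma> x)) = ceval (pdiff r loc_poly) (emb_vec \<omega> \<sigma> x)" for r and x :: "(real^'k)^'n"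
    using ceval_map_cnj[of "pdiff r loc_poly" "emb_vec \<omega> \<sigma> x"] by (simp add: cn Pc pdiff_map_cnj[symmetric])
  have gq: "cnj (grad_quot r x) = grad_quot r x" for r x by (simp add: grad_quot_def qreal)
  obtain A :: "'n option \<times> 'n option \<Rightarrow> (real^'k)^'n \<Rightarrow> complex" where A: "\<And>i. continuous_on UNIV (A i)"
    "\<And>i U. (\<And>r. invariant U (grad_quot r)) \<Longrightarrow> (\<And>l r. invariant U (hess_quot l r)) \<Longrightarrow> invariant U (A i)"
    "\<And>g \<psi> K. (\<And>l. cder (axis l a) (axis l b) g (\<lambda>_. 0)) \<Longrightarrow> test_function K \<psi> \<Longrightarrow>
      (LINT x|lborel. osc \<omega> f x * g x * \<psi> x) = (\<Sum>i\<in>UNIV. LINT x|lborel. osc \<omega> f x * (g x * A i x) * place_op (\<lambda>l. axis l a) (\<lambda>l. axis l b) i \<psi> x)"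
    "\<And>x. (\<Sum>i\<in>UNIV. cmod (A i x)) \<le> (if sq_sum grad_quot x < 1 then 1 else 0) + CARD('n) / h * (3 + 21 * deriv_ratio grad_quot hess_quot x)"
    by (rule real_place[where a = "\<lambda>l. axis l a" and b = "\<lambda>l. axis l b" and q = grad_quot and y = hess_quot,
          OF cder_place(1) cder_place(3) gq cmod_const h]) blast
  \<comment> \<open>The factor 42 is 21 from \<open>real_place\<close> times the 2 lost in
    \<open>deriv_ratio_le\<close>.\<close>
  define G where "G x = bad_count x + (ennreal (CARD('n) * 3 / h) + ennreal (CARD('n) * 42 / h) * (\<Sum>l\<in>UNIV. \<Sum>r\<in>UNIV. ennreal (hess_ratio l r x)))" for x
  have \<rho>0: "\<rho> \<ge> 0" using \<rho> norm_ge_zero[of a] norm_ge_zero[of b] by linarith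
  have av1: "averaged \<rho> (place_dirs a b) (bad_count) (\<Sum>js\<in>words. \<Sum>i\<in>(UNIV :: 'n set). ennreal (2 * (real d)\<^sup>2 / h))"
    unfolding bad_count_def[abs_def] bad_set_def
    by (intro averaged_sum \<rho>0 averaged_bad_real[OF \<omega> degree_at_most_foldr_pdiff[OF deg_P] h \<rho> dual_real[OF \<sigma>(2,1) real]])
  have av2: "averaged \<rho> (place_dirs a b) (\<lambda>x. ennreal (hess_ratio l r x)) (ennreal (d * pi))" for l r
    using averaged_ratio_real[OF \<omega> degree_at_most_pdiff[OF deg_P] h \<rho> dual_real[OF \<sigma>(2,1) real], of r l] qreal
    by (simp add: hess_ratio_def grad_quot_def hess_quot_def Reals_cnj_iff)
  have "averaged \<rho> (place_dirs a b) G ((\<Sum>js\<in>words. \<Sum>i\<in>(UNIV :: 'n set). ennreal (2 * (real d)\<^sup>2 / h)) +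
      (ennreal (CARD('n) * 3 / h) + ennreal (CARD('n) * 42 / h) * (\<Sum>l\<in>(UNIV :: 'n set). \<Sum>r\<in>(UNIV :: 'n set). ennreal (d * pi))))"
    unfolding G_def[abs_def] by (intro averaged_add av1 averaged_const \<rho>0 averaged_cmult averaged_sum av2)
  also have "(\<Sum>js\<in>words. \<Sum>i\<in>(UNIV :: 'n set). ennreal (2 * (real d)\<^sup>2 / h)) +
      (ennreal (CARD('n) * 3 / h) + ennreal (CARD('n) * 42 / h) * (\<Sum>l\<in>(UNIV :: 'n set). \<Sum>r\<in>(UNIV :: 'n set). ennreal (d * pi))) =
      ennreal ((\<Sum>js\<in>words. \<Sum>i\<in>(UNIV :: 'n set). 2 * (real d)\<^sup>2 / h) +
      (CARD('n) * 3 / h + CARD('n) * 42 / h * (\<Sum>l\<in>(UNIV :: 'n set). \<Sum>r\<in>(UNIV :: 'n set). d * pi)))"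
    using h by (intro ennreal_double_sums) auto
  also have "(\<Sum>js\<in>words. \<Sum>i\<in>(UNIV :: 'n set). 2 * (real d)\<^sup>2 / h) +
      (CARD('n) * 3 / h + CARD('n) * 42 / h * (\<Sum>l\<in>(UNIV :: 'n set). \<Sum>r\<in>(UNIV :: 'n set). d * pi)) =
    (card {js :: 'n list. length js \<le> d} * (CARD('n) * (2 * (real d)\<^sup>2)) +
      (CARD('n) * 3 + CARD('n) * 42 * (CARD('n) * (CARD('n) * (d * pi))))) / h"
    by (simp add: words_def add_divide_distrib)
  finally have av: "averaged \<rho> (place_dirs a b) G (ennreal ((card {js :: 'n list. length js \<le> d} * (CARD('n) * (2 * (real d)\<^sup>2)) +
      (CARD('n) * 3 + CARD('n) * 42 * (CARD('n) * (CARD('n) * (d * pi))))) / h))" .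
  have le: "ennreal (\<Sum>i\<in>UNIV. cmod (A i x)) \<le> G x" if "x \<in> K" for x
  proof -
    define B where "B = (\<Sum>l\<in>UNIV. \<Sum>r\<in>UNIV. hess_ratio l r x)"
    have B0: "B \<ge> 0" unfolding B_def by (intro sum_nonneg ratio_nonneg)
    have "(\<Sum>i\<in>UNIV. cmod (A i x)) \<le> (if sq_sum grad_quot x < 1 then 1 else 0) + CARD('n) / h * (3 + 21 * (2 * B))"
      using deriv_ratio_le(1)[of grad_quot hess_quot x, folded hess_ratio_def, folded B_def] h
      by (intro order_trans[OF A(4)] add_left_mono mult_left_mono) auto
    also have "CARD('n) / h * (3 + 21 * (2 * B)) = CARD('n) * 3 / h + CARD('n) * 42 / h * B"
      using h by (simp add: field_simps)
    finally have "ennreal (\<Sum>i\<in>UNIV. cmod (A i x)) \<le> ennreal ((if sq_sum grad_quot x < 1 then 1 else 0) + (CARD('n) * 3 / h + CARD('n) * 42 / h * B))"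
      by (rule ennreal_leI)
    also have "\<dots> = ennreal (if sq_sum grad_quot x < 1 then 1 else 0) + (ennreal (CARD('n) * 3 / h) + ennreal (CARD('n) * 42 / h) * ennreal B)"
      using h B0 by (intro ennreal_affine) auto
    also have "ennreal B = (\<Sum>l\<in>UNIV. \<Sum>r\<in>UNIV. ennreal (hess_ratio l r x))"
      unfolding B_def by (simp add: sum_ennreal ratio_nonneg sum_nonneg)
    also have "ennreal (if sq_sum grad_quot x < 1 then 1 else 0) + (ennreal (CARD('n) * 3 / h) + ennreal (CARD('n) * 42 / h) * (\<Sum>l\<in>UNIV. \<Sum>r\<in>UNIV. ennreal (hess_ratio l r x))) \<le> G x"
      unfolding G_def by (intro add_right_mono bad_count_ge that)
    finally show ?thesis .
  qed
  show ?thesis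
    unfolding place_estimate_def
  proof (intro exI[of _ A] exI[of _ G] conjI allI impI ballI)
    show "continuous_on UNIV (A i)" for i by (rule A(1))
    show "invariant V (A i)" if "\<forall>v\<in>V. emb_vec \<omega> \<sigma> v = 0" for i V
      by (intro A(2) invariant_place that)
    show "invariant V G" if "\<forall>v\<in>V. emb_vec \<omega> \<sigma> v = 0" for V
      using invariant_place(3)[OF that] invariant_ratio[OF that] by (simp add: invariant_def G_def)
    show "(LINT x|lborel. osc \<omega> f x * g x * \<psi> x) = (\<Sum>i\<in>UNIV. LINT x|lborel. osc \<omega> f x * (g x * A i x) * place_op (\<lambda>l. axis l a) (\<lambda>l. axis l b) i \<psi> x)"
      if "continuous_on UNIV g" "invariant (place_dirs a b) g" "test_function K \<psi>" for g \<psi>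
      by (rule A(3)[OF cder_invariant_place(1)[OF that(1,2)] that(3)])
  qed (use av le in auto)
qed

lemma place_estimate_complex:
  assumes cplx: "strictly_complex \<sigma>"
  shows "place_estimate \<omega> f \<sigma> K a b \<rho>
    ((card {js :: 'n list. length js \<le> d} * (CARD('n) * (4 * real d ^ 3)) +
      ((CARD('n))\<^sup>2 * 12 + (CARD('n))\<^sup>2 * 168 * (CARD('n))\<^sup>2 * (CARD('n) * (CARD('n) * (4 + 32 * real d))))) / h\<^sup>2)"
proof -
  have zero: "emb_coord \<omega> \<sigma> a - \<i> * emb_coord \<omega> \<sigma> b = 0"
    by (rule dual_complex(1)[OF \<sigma>(2,1) cplx])
  \<comment> \<open>The direction \<open>a - \<i> b\<close> has value zero under
    \<open>\<sigma>\<close>: the Cauchy-Riemann equation for all polynomials in the coordinates of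
    \<open>\<sigma>\<close>.\<close>
  have Dbar: "cder (axis l a) (- axis l b) (\<lambda>x. ceval p (emb_vec \<omega> \<sigma> x) / complex_of_real h) (\<lambda>_. 0)" for l and p :: "('n, complex) mpoly"
    unfolding divide_inverse mult.commute[of _ "inverse _"]
  proof (rule cder_cong[OF cder_cmult[OF cder_ceval[OF linear_emb_vec[OF \<omega>]]]])
    fix x
    have "emb_vec \<omega> \<sigma> (axis l a) $ i + \<i> * emb_vec \<omega> \<sigma> (- axis l b) $ i = 0" for i
      using zero by (simp add: linear_neg[OF linear_emb_vec[OF \<omega>]] emb_vec_axis[OF \<omega>]) (simp add: axis_def)
    then show "inverse (complex_of_real h) * (\<Sum>i\<in>UNIV. (emb_vec \<omega> \<sigma> (axis l a) $ i + \<i> * emb_vec \<omega> \<sigma> (- axis l b) $ i) * ceval (pdiff i p) (emb_vec \<omega> \<sigma> x)) = 0"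
      by simp
  qed
  have Dbar': "cder (axis l a) (- axis l b) (grad_quot r) (\<lambda>_. 0)" "cder (axis m a) (- axis m b) (hess_quot l r) (\<lambda>_. 0)" for l r m
    unfolding grad_quot_def[abs_def] hess_quot_def[abs_def] by (rule Dbar)+
  obtain A :: "'n option \<times> 'n option \<Rightarrow> (real^'k)^'n \<Rightarrow> complex" where A: "\<And>i. continuous_on UNIV (A i)"
    "\<And>i U. (\<And>r. invariant U (grad_quot r)) \<Longrightarrow> (\<And>l r. invariant U (hess_quot l r)) \<Longrightarrow> invariant U (A i)"
    "\<And>g \<psi> K. (\<And>l. cder (axis l a) (axis l b) g (\<lambda>_. 0)) \<Longrightarrow> (\<And>l. cder (axis l a) (- axis l b) g (\<lambda>_. 0)) \<Longrightarrow> test_function K \<psi> \<Longrightarrow>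
      (LINT x|lborel. osc \<omega> f x * g x * \<psi> x) = (\<Sum>i\<in>UNIV. LINT x|lborel. osc \<omega> f x * (g x * A i x) * place_op (\<lambda>l. axis l a) (\<lambda>l. axis l b) i \<psi> x)"
    "\<And>x. (\<Sum>i\<in>UNIV. cmod (A i x)) \<le> (if sq_sum grad_quot x < 1 then 1 else 0) + (CARD('n) / h)\<^sup>2 * (12 + 42 * (deriv_ratio grad_quot hess_quot x)\<^sup>2)"
    by (rule complex_place[where a = "\<lambda>l. axis l a" and b = "\<lambda>l. axis l b" and q = grad_quot and y = hess_quot,
          OF cder_place(1,2) cder_place(3) Dbar' cmod_const h]) blast
  define n where "n = real CARD('n)"
  define G where "G x = bad_count x + (ennreal (n\<^sup>2 * 12 / h\<^sup>2) + ennreal (n\<^sup>2 * 168 * n\<^sup>2 / h\<^sup>2) * (\<Sum>l\<in>UNIV. \<Sum>r\<in>UNIV. ennreal ((hess_ratio l r x)\<^sup>2)))" for x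
  have \<rho>0: "\<rho> \<ge> 0" using \<rho> norm_ge_zero[of a] norm_ge_zero[of b] by linarith
  have n0: "n \<ge> 0" by (simp add: n_def)
  have av1: "averaged \<rho> (place_dirs a b) (bad_count) (\<Sum>js\<in>words. \<Sum>i\<in>(UNIV :: 'n set). ennreal (4 * real d ^ 3 / h\<^sup>2))"
    unfolding bad_count_def[abs_def] bad_set_def
    by (intro averaged_sum \<rho>0 averaged_bad_complex[OF \<omega> degree_at_most_foldr_pdiff[OF deg_P] h \<rho> dual_complex(2)[OF \<sigma>(2,1) cplx]])
  have av2: "averaged \<rho> (place_dirs a b) (\<lambda>x. ennreal ((hess_ratio l r x)\<^sup>2)) (ennreal (4 + 32 * real d))" for l r
    using averaged_ratio_complex[OF \<omega> degree_at_most_pdiff[OF deg_P] h \<rho> dual_complex(2)[OF \<sigma>(2,1) cplx], of l r]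
    by (simp add: hess_ratio_def grad_quot_def hess_quot_def)
  have "averaged \<rho> (place_dirs a b) G ((\<Sum>js\<in>words. \<Sum>i\<in>(UNIV :: 'n set). ennreal (4 * real d ^ 3 / h\<^sup>2)) +
      (ennreal (n\<^sup>2 * 12 / h\<^sup>2) + ennreal (n\<^sup>2 * 168 * n\<^sup>2 / h\<^sup>2) * (\<Sum>l\<in>(UNIV :: 'n set). \<Sum>r\<in>(UNIV :: 'n set). ennreal (4 + 32 * real d))))"
    unfolding G_def[abs_def] by (intro averaged_add av1 averaged_const \<rho>0 averaged_cmult averaged_sum av2)
  also have "(\<Sum>js\<in>words. \<Sum>i\<in>(UNIV :: 'n set). ennreal (4 * real d ^ 3 / h\<^sup>2)) +
      (ennreal (n\<^sup>2 * 12 / h\<^sup>2) + ennreal (n\<^sup>2 * 168 * n\<^sup>2 / h\<^sup>2) * (\<Sum>l\<in>(UNIV :: 'n set). \<Sum>r\<in>(UNIV :: 'n set). ennreal (4 + 32 * real d))) =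
      ennreal ((\<Sum>js\<in>words. \<Sum>i\<in>(UNIV :: 'n set). 4 * real d ^ 3 / h\<^sup>2) +
      (n\<^sup>2 * 12 / h\<^sup>2 + n\<^sup>2 * 168 * n\<^sup>2 / h\<^sup>2 * (\<Sum>l\<in>(UNIV :: 'n set). \<Sum>r\<in>(UNIV :: 'n set). 4 + 32 * real d)))"
    by (intro ennreal_double_sums) auto
  also have "(\<Sum>js\<in>words. \<Sum>i\<in>(UNIV :: 'n set). 4 * real d ^ 3 / h\<^sup>2) +
      (n\<^sup>2 * 12 / h\<^sup>2 + n\<^sup>2 * 168 * n\<^sup>2 / h\<^sup>2 * (\<Sum>l\<in>(UNIV :: 'n set). \<Sum>r\<in>(UNIV :: 'n set). 4 + 32 * real d)) =
    (card {js :: 'n list. length js \<le> d} * (CARD('n) * (4 * real d ^ 3)) +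
      ((CARD('n))\<^sup>2 * 12 + (CARD('n))\<^sup>2 * 168 * (CARD('n))\<^sup>2 * (CARD('n) * (CARD('n) * (4 + 32 * real d))))) / h\<^sup>2"
    by (simp add: words_def n_def add_divide_distrib)
  finally have av: "averaged \<rho> (place_dirs a b) G (ennreal ((card {js :: 'n list. length js \<le> d} * (CARD('n) * (4 * real d ^ 3)) +
      ((CARD('n))\<^sup>2 * 12 + (CARD('n))\<^sup>2 * 168 * (CARD('n))\<^sup>2 * (CARD('n) * (CARD('n) * (4 + 32 * real d))))) / h\<^sup>2))" .
  have le: "ennreal (\<Sum>i\<in>UNIV. cmod (A i x)) \<le> G x" if "x \<in> K" for x
  proof -
    define B where "B = (\<Sum>l\<in>UNIV. \<Sum>r\<in>UNIV. (hess_ratio l r x)\<^sup>2)"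
    define B1 where "B1 = (\<Sum>l\<in>UNIV. \<Sum>r\<in>UNIV. hess_ratio l r x)"
    have B0: "B \<ge> 0" unfolding B_def by (intro sum_nonneg) auto
    \<comment> \<open>Cauchy-Schwarz in each of the two sums over the variables gives the factor
      \<open>n^2\<close>. Squaring the 2 of \<open>deriv_ratio_le\<close> turns 42 into 168.\<close>
    have "B1\<^sup>2 \<le> (\<Sum>l\<in>UNIV. (\<Sum>r\<in>UNIV. hess_ratio l r x)\<^sup>2) * n"
      unfolding B1_def n_def by (rule sum_squared_le_sum_of_squares)
    also have "\<dots> \<le> (\<Sum>l\<in>UNIV. (\<Sum>r\<in>UNIV. (hess_ratio l r x)\<^sup>2) * n) * n"
      unfolding n_def by (intro mult_right_mono sum_mono sum_squared_le_sum_of_squares) auto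
    also have "\<dots> = n\<^sup>2 * B" by (simp add: B_def sum_distrib_right[symmetric] power2_eq_square)
    finally have "B1\<^sup>2 \<le> n\<^sup>2 * B" .
    moreover have "(deriv_ratio grad_quot hess_quot x)\<^sup>2 \<le> (2 * B1)\<^sup>2"
      using deriv_ratio_le[of grad_quot hess_quot x, folded hess_ratio_def, folded B1_def] by (intro power_mono) auto
    ultimately have dr: "(deriv_ratio grad_quot hess_quot x)\<^sup>2 \<le> 4 * (n\<^sup>2 * B)" by (simp add: power_mult_distrib)
    have "(\<Sum>i\<in>UNIV. cmod (A i x)) \<le> (if sq_sum grad_quot x < 1 then 1 else 0) + (n / h)\<^sup>2 * (12 + 42 * (4 * (n\<^sup>2 * B)))"
      using dr unfolding n_def by (intro order_trans[OF A(4)] add_left_mono mult_left_mono) auto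
    also have "(n / h)\<^sup>2 * (12 + 42 * (4 * (n\<^sup>2 * B))) = n\<^sup>2 * 12 / h\<^sup>2 + n\<^sup>2 * 168 * n\<^sup>2 / h\<^sup>2 * B"
      using h by (simp add: power_divide field_simps)
    finally have "ennreal (\<Sum>i\<in>UNIV. cmod (A i x)) \<le> ennreal ((if sq_sum grad_quot x < 1 then 1 else 0) + (n\<^sup>2 * 12 / h\<^sup>2 + n\<^sup>2 * 168 * n\<^sup>2 / h\<^sup>2 * B))"
      by (rule ennreal_leI)
    also have "\<dots> = ennreal (if sq_sum grad_quot x < 1 then 1 else 0) + (ennreal (n\<^sup>2 * 12 / h\<^sup>2) + ennreal (n\<^sup>2 * 168 * n\<^sup>2 / h\<^sup>2) * ennreal B)"
      using h B0 n0 by (intro ennreal_affine) auto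
    also have "ennreal B = (\<Sum>l\<in>UNIV. \<Sum>r\<in>UNIV. ennreal ((hess_ratio l r x)\<^sup>2))"
      unfolding B_def by (simp add: sum_ennreal sum_nonneg)
    also have "ennreal (if sq_sum grad_quot x < 1 then 1 else 0) + (ennreal (n\<^sup>2 * 12 / h\<^sup>2) + ennreal (n\<^sup>2 * 168 * n\<^sup>2 / h\<^sup>2) * (\<Sum>l\<in>UNIV. \<Sum>r\<in>UNIV. ennreal ((hess_ratio l r x)\<^sup>2))) \<le> G x"
      unfolding G_def by (intro add_right_mono bad_count_ge that)
    finally show ?thesis .
  qed
  show ?thesis
    unfolding place_estimate_def
  proof (intro exI[of _ A] exI[of _ G] conjI allI impI ballI)
    show "continuous_on UNIV (A i)" for i by (rule A(1))
    show "invariant V (A i)" if "\<forall>v\<in>V. emb_vec \<omega> \<sigma> v = 0" for i V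
      by (intro A(2) invariant_place that)
    show "invariant V G" if "\<forall>v\<in>V. emb_vec \<omega> \<sigma> v = 0" for V
      using invariant_place(3)[OF that] invariant_ratio[OF that] by (simp add: invariant_def G_def)
    show "(LINT x|lborel. osc \<omega> f x * g x * \<psi> x) = (\<Sum>i\<in>UNIV. LINT x|lborel. osc \<omega> f x * (g x * A i x) * place_op (\<lambda>l. axis l a) (\<lambda>l. axis l b) i \<psi> x)"
      if "continuous_on UNIV g" "invariant (place_dirs a b) g" "test_function K \<psi>" for g \<psi>
      by (rule A(3)[OF cder_invariant_place(1)[OF that(1,2)] cder_invariant_place(2)[OF that(1,2)] that(3)])
  qed (use av le in auto)
qed

end

section \<open>One constant for all polynomials and all sets of embeddings\<close>

section \<open>Combination of the places\<close>

lemma degree_emb_poly: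
  fixes \<omega> :: "'k::finite \<Rightarrow> 'a::field_char_0" and f :: "('n::finite, real^'k^'k) mpoly"
  assumes "total_degree f \<le> d"
  shows "degree_at_most d (emb_poly \<omega> \<sigma> f)"
  unfolding degree_at_most_def
proof (intro allI impI)
  fix \<gamma> assume "Poly_Mapping.lookup (emb_poly \<omega> \<sigma> f) \<gamma> \<noteq> 0"
  then have "\<gamma> \<in> Poly_Mapping.keys f"
    by (auto simp: emb_poly_def Poly_Mapping.map.rep_eq in_keys_iff when_def split: if_splits)
  then have "mdeg \<gamma> \<le> total_degree f"
    unfolding total_degree_def by (intro Max_ge) auto
  with assms show "mdeg \<gamma> \<le> d" by simp
qed

text \<open>A place is an orbit of conjugation. Distinct orbits are disjoint, and a set closed under
  conjugation is the union of the orbits it contains.\<close>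

lemma prod_over_places:
  fixes g :: "('a::field_char_0 \<Rightarrow> complex) \<Rightarrow> 'b::comm_monoid_mult"
  assumes S: "S \<subseteq> embeddings" "\<And>\<tau>. \<tau> \<in> S \<Longrightarrow> cnj \<circ> \<tau> \<in> S" and fin: "finite (embeddings :: ('a \<Rightarrow> complex) set)"
  shows "prod g S = (\<Prod>p\<in>{p \<in> (\<lambda>\<sigma>. {\<sigma>, cnj \<circ> \<sigma>}) ` embeddings. p \<subseteq> S}. prod g p)"
proof -
  define C where "C = {p \<in> (\<lambda>\<sigma>. {\<sigma>, cnj \<circ> \<sigma>}) ` embeddings. p \<subseteq> S}"
  have cc: "cnj \<circ> (cnj \<circ> \<sigma>) = \<sigma>" for \<sigma> :: "'a \<Rightarrow> complex" by (simp add: fun_eq_iff)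
  have "S = \<Union>C"
  proof (intro set_eqI iffI)
    fix \<tau> assume "\<tau> \<in> S"
    then have "{\<tau>, cnj \<circ> \<tau>} \<in> C" using S by (auto simp: C_def)
    then show "\<tau> \<in> \<Union>C" by blast
  qed (auto simp: C_def)
  moreover have "prod g (\<Union>C) = (prod \<circ> prod) g C"
  proof (rule prod.Union_disjoint)
    show "\<forall>p\<in>C. finite p" by (auto simp: C_def)
    show "\<forall>A\<in>C. \<forall>B\<in>C. A \<noteq> B \<longrightarrow> A \<inter> B = {}"
    proof (intro ballI impI)
      fix A B assume "A \<in> C" "B \<in> C" "A \<noteq> B"
      then obtain \<sigma> \<tau> where st: "A = {\<sigma>, cnj \<circ> \<sigma>}" "B = {\<tau>, cnj \<circ> \<tau>}" by (auto simp: C_def)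
      have "\<sigma> \<noteq> \<tau>" "\<sigma> \<noteq> cnj \<circ> \<tau>" "cnj \<circ> \<sigma> \<noteq> \<tau>"
        using \<open>A \<noteq> B\<close> cc[of \<sigma>] cc[of \<tau>] unfolding st by auto
      moreover have "cnj \<circ> \<sigma> \<noteq> cnj \<circ> \<tau>" using \<open>\<sigma> \<noteq> \<tau>\<close> cc by metis
      ultimately show "A \<inter> B = {}" unfolding st by auto
    qed
  qed
  ultimately show ?thesis unfolding C_def by (simp add: o_def)
qed

theorem theorem1p8:
  fixes \<omega> :: "'k::finite \<Rightarrow> 'a::field_char_0"
    and \<psi> :: "(real^'k)^'n::finite \<Rightarrow> complex"
    and d :: nat
  assumes "number_field_basis \<omega>"
    and "smooth \<psi>" and "compact (supp \<psi>)"
  shows "\<exists>C::real. 0 \<le> C \<and>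
    (\<forall>(f :: ('n, real^'k^'k) mpoly) (S :: ('a \<Rightarrow> complex) set).
      f \<noteq> 0 \<longrightarrow> total_degree f \<le> d \<longrightarrow> (\<forall>\<beta>. Poly_Mapping.lookup f \<beta> \<in> real_algebra \<omega>) \<longrightarrow>
      S \<subseteq> embeddings \<longrightarrow>
      (\<forall>\<tau>\<in>embeddings. strictly_complex \<tau> \<longrightarrow> (\<tau> \<in> S \<longleftrightarrow> cnj \<circ> \<tau> \<in> S)) \<longrightarrow>
      ennreal (cmod (osc_integral \<omega> \<psi> f)) \<le>
        (if H_prod \<omega> \<psi> f S = 0 then \<infinity> else ennreal C * inverse (H_prod \<omega> \<psi> f S)))"
proof (cases "supp \<psi> = {}")
  \<comment> \<open>The infimum over an empty support is infinite and has no real value to work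
    with; but then the amplitude, and with it the integral, vanishes.\<close>
  case True
  then have "\<psi> x = 0" for x using closure_subset[of "{x. \<psi> x \<noteq> 0}"] by (auto simp: supp_def)
  then have "osc_integral \<omega> \<psi> f = 0" for f by (simp add: osc_integral_def)
  then show ?thesis by (intro exI[of _ 0]) auto
next
  case False
  note \<omega> = assms(1)
  define K where "K = supp \<psi>"
  have K: "compact K" "K \<noteq> {}" using assms(3) False by (auto simp: K_def)
  have test: "test_function K \<psi>"
    using assms(2,3) closure_subset[of "{x. \<psi> x \<noteq> 0}"] by (auto simp: test_function_def K_def supp_def)
  have fin: "finite (embeddings :: ('a \<Rightarrow> complex) set)" by (rule finite_embeddings[OF \<omega>])
  have "\<forall>\<sigma>\<in>embeddings. \<exists>ab. is_dual \<omega> \<sigma> (fst ab) (snd ab)"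
  proof
    fix \<sigma> :: "'a \<Rightarrow> complex" assume "\<sigma> \<in> embeddings"
    from dual_direction[OF \<omega> this] obtain a b where
      "\<And>\<tau>. \<tau> \<in> embeddings \<Longrightarrow> emb_coord \<omega> \<tau> a + \<i> * emb_coord \<omega> \<tau> b = (if \<tau> = \<sigma> then 1 else 0)"
      by blast
    then show "\<exists>ab. is_dual \<omega> \<sigma> (fst ab) (snd ab)" by (intro exI[of _ "(a, b)"]) (simp add: is_dual_def)
  qed
  then obtain ab where ab: "\<And>\<sigma>. \<sigma> \<in> embeddings \<Longrightarrow> is_dual \<omega> \<sigma> (fst (ab \<sigma>)) (snd (ab \<sigma>))"
    using bchoice by metis
  \<comment> \<open>The set of places. For a real embedding the two entries coincide, so the place
    is a singleton.\<close>
  define T where "T = (\<lambda>\<sigma>. {\<sigma>, cnj \<circ> \<sigma>}) ` (embeddings :: ('a \<Rightarrow> complex) set)"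
  have finT: "finite T" unfolding T_def using fin by simp
  have cc: "cnj \<circ> (cnj \<circ> \<sigma>) = \<sigma>" for \<sigma> :: "'a \<Rightarrow> complex" by (simp add: fun_eq_iff)
  define rep where "rep p = (SOME \<sigma>. \<sigma> \<in> p)" for p :: "('a \<Rightarrow> complex) set"
  have rep: "rep p \<in> embeddings" "p = {rep p, cnj \<circ> rep p}" if p: "p \<in> T" for p
  proof -
    obtain \<sigma> where \<sigma>: "\<sigma> \<in> embeddings" "p = {\<sigma>, cnj \<circ> \<sigma>}" using p by (auto simp: T_def)
    have "rep p \<in> p" unfolding rep_def by (rule someI[of _ \<sigma>]) (simp add: \<sigma>)
    then have "rep p = \<sigma> \<or> rep p = cnj \<circ> \<sigma>" unfolding \<sigma>(2) by blast
    then show "rep p \<in> embeddings" "p = {rep p, cnj \<circ> rep p}"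
      using \<sigma> embeddings_cnj[OF \<sigma>(1)] cc[of \<sigma>] by auto
  qed
  define a where "a p = fst (ab (rep p))" for p
  define b where "b p = snd (ab (rep p))" for p
  have dual: "is_dual \<omega> (rep p) (a p) (b p)" if "p \<in> T" for p
    unfolding a_def b_def by (intro ab rep that)
  have vanish: "emb_vec \<omega> (rep p') v = 0"
    if "p \<in> T" "p' \<in> T" "p \<noteq> p'" "v \<in> place_dirs (a p) (b p)" for p p' and v :: "(real^'k)^'n"
  proof -
    have "rep p' \<noteq> rep p" "rep p' \<noteq> cnj \<circ> rep p"
      using rep(2)[OF that(1)] rep(2)[OF that(2)] that(3) cc[of "rep p"] by auto
    then have "emb_coord \<omega> (rep p') (a p) = 0" "emb_coord \<omega> (rep p') (b p) = 0"
      using dual_zero[OF dual[OF that(1)] rep(1)[OF that(2)]] by auto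
    then show ?thesis using that(4) by (auto simp: place_dirs_def emb_vec_axis[OF \<omega>])
  qed
  \<comment> \<open>A single translation radius that is large enough at every place.\<close>
  define \<rho> where "\<rho> = (\<Sum>p\<in>T. 2 * norm (a p) + 2 * norm (b p))"
  have \<rho>: "2 * norm (a p) + 2 * norm (b p) \<le> \<rho>" if "p \<in> T" for p
    unfolding \<rho>_def using finT that by (intro member_le_sum) auto
  have \<rho>0: "\<rho> \<ge> 0" unfolding \<rho>_def by (intro sum_nonneg) auto
  define Kr where "Kr = card {js :: 'n list. length js \<le> d} * (CARD('n) * (2 * (real d)\<^sup>2)) +
      (CARD('n) * 3 + CARD('n) * 42 * (CARD('n) * (CARD('n) * (d * pi))))"
  define Kc where "Kc = card {js :: 'n list. length js \<le> d} * (CARD('n) * (4 * real d ^ 3)) +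
      ((CARD('n))\<^sup>2 * 12 + (CARD('n))\<^sup>2 * 168 * (CARD('n))\<^sup>2 * (CARD('n) * (CARD('n) * (4 + 32 * real d))))"
  have Krc: "Kr \<ge> 0" "Kc \<ge> 0" by (auto simp: Kr_def Kc_def)
  \<comment> \<open>At least 1, so that the trivial estimate for places outside \<open>S\<close> has
    the form \<open>K0 * w p\<close> as well.\<close>
  define K0 where "K0 = 1 + Kr + Kc"
  have K0: "K0 \<ge> 1" "K0 \<ge> Kr" "K0 \<ge> Kc" using Krc by (auto simp: K0_def)
  \<comment> \<open>The conclusion of \<open>iterate_places\<close> for this amplitude and these
    dual directions. Its constant is obtained here, before \<open>f\<close> and \<open>S\<close> are
    introduced.\<close>
  define Bd where "Bd C1 \<longleftrightarrow> (\<forall>E g A. continuous_on UNIV E \<longrightarrow> (\<forall>x. cmod (E x) \<le> 1) \<longrightarrow>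
    continuous_on UNIV g \<longrightarrow> (\<forall>p\<in>T. invariant (place_dirs (a p) (b p)) g) \<longrightarrow>
    (\<forall>p\<in>T. \<forall>i. continuous_on UNIV (A p i)) \<longrightarrow>
    (\<forall>p\<in>T. \<forall>p'\<in>T. p \<noteq> p' \<longrightarrow> (\<forall>i. invariant (place_dirs (a p') (b p')) (A p i))) \<longrightarrow>
    (\<forall>p\<in>T. \<forall>g \<psi>. continuous_on UNIV g \<longrightarrow> invariant (place_dirs (a p) (b p)) g \<longrightarrow> test_function K \<psi> \<longrightarrow>
      (LINT x|lborel. E x * g x * \<psi> x) = (\<Sum>i\<in>UNIV. LINT x|lborel. E x * (g x * A p i x) *
        place_op (\<lambda>l. axis l (a p)) (\<lambda>l. axis l (b p)) i \<psi> x)) \<longrightarrow>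
    ennreal (cmod (LINT x|lborel. E x * g x * \<psi> x)) \<le>
      ennreal C1 * (\<integral>\<^sup>+x. indicator K x * (ennreal (cmod (g x)) * (\<Prod>p\<in>T. ennreal (\<Sum>i\<in>UNIV. cmod (A p i x)))) \<partial>lborel))"
    for C1
  have "\<exists>C1\<ge>0. Bd C1"
    unfolding Bd_def by (rule iterate_places[OF finT test_function_place_op test])
  then obtain C1 where C1: "C1 \<ge> 0" "Bd C1" by blast
  obtain R where R: "K \<subseteq> ball 0 R"
    using bounded_subset_ballD[OF compact_imp_bounded[OF K(1)], of 0] by blast
  define vol where "vol = measure lborel (ball (0 :: (real^'k)^'n) (R + card T * \<rho>))"
  have vol: "emeasure lborel (ball (0 :: (real^'k)^'n) (R + card T * \<rho>)) = ennreal vol" "vol \<ge> 0"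
    unfolding vol_def using emeasure_lborel_ball_finite[of "0 :: (real^'k)^'n" "R + card T * \<rho>"]
    by (auto intro!: emeasure_eq_ennreal_measure)
  define C where "C = C1 * (K0 ^ card T * vol)"
  have "C \<ge> 0" unfolding C_def using C1(1) K0 vol(2) by (intro mult_nonneg_nonneg zero_le_power) auto
  moreover have "ennreal (cmod (osc_integral \<omega> \<psi> f)) \<le> ennreal C * inverse (H_prod \<omega> \<psi> f S)"
    if f: "total_degree f \<le> d" "\<And>\<beta>. Poly_Mapping.lookup f \<beta> \<in> real_algebra \<omega>"
      and S: "S \<subseteq> embeddings" "\<And>\<tau>. \<tau> \<in> embeddings \<Longrightarrow> strictly_complex \<tau> \<Longrightarrow> (\<tau> \<in> S \<longleftrightarrow> cnj \<circ> \<tau> \<in> S)"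
      and H: "H_prod \<omega> \<psi> f S \<noteq> 0" for f :: "('n, real^'k^'k) mpoly" and S
  proof -
    have finS: "finite S" using S(1) fin by (rule finite_subset)
    have Scnj: "cnj \<circ> \<tau> \<in> S" if "\<tau> \<in> S" for \<tau>
      using that S real_embedding_cnj[of \<tau>] by (cases "strictly_complex \<tau>") auto
    define h where "h \<sigma> = enn2real (H_unif \<omega> \<psi> f \<sigma>)" for \<sigma>
    \<comment> \<open>A point of the nonempty support bounds the infimum, so the functional can be
      handled as a real number \<open>h\<close>.\<close>
    have Hfin: "H_unif \<omega> \<psi> f \<sigma> < top" for \<sigma>
    proof -
      obtain x where "x \<in> supp \<psi>" using K(2) by (auto simp: K_def)
      then have "H_unif \<omega> \<psi> f \<sigma> \<le> ennreal (H_point \<omega> f \<sigma> x)" unfolding H_unif_def by (rule INF_lower)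
      then show ?thesis using ennreal_less_top le_less_trans by blast
    qed
    have Hh: "H_unif \<omega> \<psi> f \<sigma> = ennreal (h \<sigma>)" for \<sigma> using Hfin[of \<sigma>] by (simp add: h_def)
    have hpos: "h \<sigma> > 0" if "\<sigma> \<in> S" for \<sigma>
    proof -
      have "H_unif \<omega> \<psi> f \<sigma> \<noteq> 0" using H finS that by (simp add: H_prod_def)
      then show ?thesis unfolding Hh by (simp add: ennreal_eq_0_iff)
    qed
    have hcnj: "h (cnj \<circ> \<sigma>) = h \<sigma>" for \<sigma> by (simp add: h_def H_unif_cnj)
    have Hpoint: "h \<sigma> \<le> H_point \<omega> f \<sigma> x" if "\<sigma> \<in> S" "x \<in> K" for \<sigma> x
    proof -
      have "ennreal (h \<sigma>) \<le> ennreal (H_point \<omega> f \<sigma> x)"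
        unfolding Hh[symmetric] H_unif_def using that(2) by (intro INF_lower) (simp add: K_def)
      then show ?thesis using hpos[OF that(1)] by (metis ennreal_le_iff2 not_le)
    qed
    \<comment> \<open>For a place inside \<open>S\<close> this is \<open>1 / h\<close> if it is real
      and \<open>1 / h^2\<close> if it is complex, because conjugate embeddings have the same
      \<open>h\<close>.\<close>
    define w where "w p = (if p \<subseteq> S then \<Prod>\<sigma>\<in>p. 1 / h \<sigma> else 1)" for p
    have w0: "w p \<ge> 0" for p unfolding w_def using hpos by (auto intro!: prod_nonneg simp: less_imp_le)
    have est: "place_estimate \<omega> f (rep p) K (a p) (b p) \<rho> (K0 * w p)" if p: "p \<in> T" for p
    proof (cases "p \<subseteq> S")
      case False
      have "place_estimate \<omega> f (rep p) K (a p) (b p) \<rho> 1" by (rule place_estimate_trivial[OF \<rho>0])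
      then show ?thesis by (rule place_estimate_mono) (use K0 False in \<open>simp add: w_def\<close>)
    next
      case True
      have rS: "rep p \<in> S" using True rep(2)[OF p] by auto
      note hp = hpos[OF rS]
      note facts = \<omega> f(2) degree_emb_poly[OF f(1)] rep(1)[OF p] dual[OF p] hp Hpoint[OF rS] \<rho>[OF p]
      show ?thesis
      proof (cases "strictly_complex (rep p)")
        case False
        have "place_estimate \<omega> f (rep p) K (a p) (b p) \<rho> (Kr / h (rep p))"
          unfolding Kr_def by (rule place_estimate_real[OF facts False])
        moreover have "p = {rep p}" using rep(2)[OF p] real_embedding_cnj[OF False] by simp
        then have "w p = 1 / h (rep p)" using True by (metis prod.insert prod.empty mult_1_right finite.emptyI empty_iff w_def)
        ultimately show ?thesis using K0 hp
          by (elim place_estimate_mono) (simp add: divide_right_mono)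
      next
        case cplx: True
        have "place_estimate \<omega> f (rep p) K (a p) (b p) \<rho> (Kc / (h (rep p))\<^sup>2)"
          unfolding Kc_def by (rule place_estimate_complex[OF facts cplx])
        moreover have "(\<Prod>\<sigma>\<in>{rep p, cnj \<circ> rep p}. 1 / h \<sigma>) = 1 / (h (rep p))\<^sup>2"
          using strictly_complex_cnj_neq[OF cplx] by (simp add: hcnj power2_eq_square)
        then have "w p = 1 / (h (rep p))\<^sup>2" using True rep(2)[OF p] by (simp add: w_def)
        ultimately show ?thesis using K0 hp
          by (elim place_estimate_mono) (simp add: divide_right_mono)
      qed
    qed
    have "\<forall>p\<in>T. \<exists>AG. (\<forall>i. continuous_on UNIV (fst AG i)) \<and>
      (\<forall>i V. (\<forall>v\<in>V. emb_vec \<omega> (rep p) v = 0) \<longrightarrow> invariant V (fst AG i)) \<and>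
      (\<forall>V. (\<forall>v\<in>V. emb_vec \<omega> (rep p) v = 0) \<longrightarrow> invariant V (snd AG)) \<and>
      (\<forall>g \<psi>. continuous_on UNIV g \<longrightarrow> invariant (place_dirs (a p) (b p)) g \<longrightarrow> test_function K \<psi> \<longrightarrow>
        (LINT x|lborel. osc \<omega> f x * g x * \<psi> x) =
        (\<Sum>i\<in>(UNIV :: ('n option \<times> 'n option) set). LINT x|lborel. osc \<omega> f x * (g x * fst AG i x) *
          place_op (\<lambda>l. axis l (a p)) (\<lambda>l. axis l (b p)) i \<psi> x)) \<and>
      averaged \<rho> (place_dirs (a p) (b p)) (snd AG) (ennreal (K0 * w p)) \<and>
      (\<forall>x\<in>K. ennreal (\<Sum>i\<in>UNIV. cmod (fst AG i x)) \<le> snd AG x)"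
      unfolding split_paired_Ex fst_conv snd_conv by (intro ballI est[unfolded place_estimate_def])
    then obtain AG where AG: "\<forall>p\<in>T. (\<forall>i. continuous_on UNIV (fst (AG p) i)) \<and>
      (\<forall>i V. (\<forall>v\<in>V. emb_vec \<omega> (rep p) v = 0) \<longrightarrow> invariant V (fst (AG p) i)) \<and>
      (\<forall>V. (\<forall>v\<in>V. emb_vec \<omega> (rep p) v = 0) \<longrightarrow> invariant V (snd (AG p))) \<and>
      (\<forall>g \<psi>. continuous_on UNIV g \<longrightarrow> invariant (place_dirs (a p) (b p)) g \<longrightarrow> test_function K \<psi> \<longrightarrow>
        (LINT x|lborel. osc \<omega> f x * g x * \<psi> x) =
        (\<Sum>i\<in>(UNIV :: ('n option \<times> 'n option) set). LINT x|lborel. osc \<omega> f x * (g x * fst (AG p) i x) *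
          place_op (\<lambda>l. axis l (a p)) (\<lambda>l. axis l (b p)) i \<psi> x)) \<and>
      averaged \<rho> (place_dirs (a p) (b p)) (snd (AG p)) (ennreal (K0 * w p)) \<and>
      (\<forall>x\<in>K. ennreal (\<Sum>i\<in>UNIV. cmod (fst (AG p) i x)) \<le> snd (AG p) x)"
      by (rule bchoice[THEN exE]) (rule that)
    define A where "A p = fst (AG p)" for p
    define G where "G p = snd (AG p)" for p
    have A: "\<And>p i. p \<in> T \<Longrightarrow> continuous_on UNIV (A p i)"
      "\<And>p i V. p \<in> T \<Longrightarrow> (\<forall>v\<in>V. emb_vec \<omega> (rep p) v = 0) \<Longrightarrow> invariant V (A p i)"
      "\<And>p V. p \<in> T \<Longrightarrow> (\<forall>v\<in>V. emb_vec \<omega> (rep p) v = 0) \<Longrightarrow> invariant V (G p)"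
      "\<And>p. p \<in> T \<Longrightarrow> \<forall>g \<psi>. continuous_on UNIV g \<longrightarrow> invariant (place_dirs (a p) (b p)) g \<longrightarrow> test_function K \<psi> \<longrightarrow>
        (LINT x|lborel. osc \<omega> f x * g x * \<psi> x) =
        (\<Sum>i\<in>UNIV. LINT x|lborel. osc \<omega> f x * (g x * A p i x) * place_op (\<lambda>l. axis l (a p)) (\<lambda>l. axis l (b p)) i \<psi> x)"
      "\<And>p. p \<in> T \<Longrightarrow> averaged \<rho> (place_dirs (a p) (b p)) (G p) (ennreal (K0 * w p))"
      "\<And>p x. p \<in> T \<Longrightarrow> x \<in> K \<Longrightarrow> ennreal (\<Sum>i\<in>UNIV. cmod (A p i x)) \<le> G p x"
      using AG unfolding A_def G_def by blast+
    have cosc: "continuous_on UNIV (osc \<omega> f)"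
    proof -
      \<comment> \<open>Continuity of the oscillating factor is part of its derivative relation at
        any place, and a place exists because the field has an embedding.\<close>
      obtain p where "p \<in> T"
      proof -
        obtain e :: "'k \<Rightarrow> 'a \<Rightarrow> complex" and W where "bij_betw e UNIV embeddings" by (rule embedding_matrix[OF \<omega>])
        then have "e undefined \<in> embeddings" by (auto simp: bij_betw_def)
        then show thesis using that by (auto simp: T_def)
      qed
      then show ?thesis using cder_continuous(1)[OF cder_osc(1)[OF \<omega> f(2) rep(1) dual]] by blast
    qed
    have "ennreal (cmod (osc_integral \<omega> \<psi> f)) = ennreal (cmod (LINT x|lborel. osc \<omega> f x * 1 * \<psi> x))"
      by (simp add: osc_integral_def osc_def)
    also have "\<dots> \<le> ennreal C1 * (\<integral>\<^sup>+x. indicator K x * (ennreal (cmod 1) * (\<Prod>p\<in>T. ennreal (\<Sum>i\<in>UNIV. cmod (A p i x)))) \<partial>lborel)"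
    proof (rule C1(2)[unfolded Bd_def, THEN spec, THEN spec, THEN spec, THEN mp, THEN mp, THEN mp, THEN mp, THEN mp, THEN mp, THEN mp])
      show "\<forall>x. cmod (osc \<omega> f x) \<le> 1"
      proof
        fix x
        have "2 * of_real pi * \<i> * of_real (phase \<omega> f x) = \<i> * of_real (2 * pi * phase \<omega> f x)" by simp
        then show "cmod (osc \<omega> f x) \<le> 1" unfolding osc_def by (simp only: norm_exp_i_times order_refl)
      qed
      show "\<forall>p\<in>T. \<forall>p'\<in>T. p \<noteq> p' \<longrightarrow> (\<forall>i. invariant (place_dirs (a p') (b p')) (A p i))"
        using A(2) vanish by metis
    qed (use cosc A(1,4) in \<open>auto simp: invariant_def\<close>)
    also have "\<dots> \<le> ennreal C1 * (\<integral>\<^sup>+x. indicator (ball 0 R) x * (\<Prod>p\<in>T. G p x) \<partial>lborel)"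
    proof (intro mult_left_mono nn_integral_mono)
      fix x
      show "indicator K x * (ennreal (cmod 1) * (\<Prod>p\<in>T. ennreal (\<Sum>i\<in>UNIV. cmod (A p i x)))) \<le> indicator (ball 0 R) x * (\<Prod>p\<in>T. G p x)"
      proof (cases "x \<in> K")
        case True
        then have "x \<in> ball 0 R" using R by blast
        moreover have "(\<Prod>p\<in>T'. ennreal (\<Sum>i\<in>UNIV. cmod (A p i x))) \<le> (\<Prod>p\<in>T'. G p x)" if "T' \<subseteq> T" for T'
          using finite_subset[OF that finT] that
          by (induction T') (auto intro!: mult_mono A(6) True)
        ultimately show ?thesis using True by simp
      qed simp
    qed simp
    also have "\<dots> \<le> ennreal C1 * ((\<Prod>p\<in>T. ennreal (K0 * w p)) * emeasure lborel (ball (0 :: (real^'k)^'n) (R + card T * \<rho>)))"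
    proof (rule mult_left_mono[OF averaged_prod[where U = "\<lambda>p. place_dirs (a p) (b p)", OF finT \<rho>0]])
      show "averaged \<rho> (place_dirs (a p) (b p)) (G p) (ennreal (K0 * w p))" if "p \<in> T" for p by (rule A(5)[OF that])
      show "invariant (place_dirs (a p) (b p)) (G p')" if "p \<in> T" "p' \<in> T" "p \<noteq> p'" for p p'
        using A(3)[OF that(2)] vanish[OF that] by blast
    qed simp
    also have "(\<Prod>p\<in>T. ennreal (K0 * w p)) = ennreal (K0 ^ card T * (\<Prod>p\<in>T. w p))"
      using K0 w0 by (simp add: prod_ennreal prod.distrib)
    also have "(\<Prod>p\<in>T. w p) = (\<Prod>\<sigma>\<in>S. 1 / h \<sigma>)"
    proof -
      have "(\<Prod>p\<in>T. w p) = (\<Prod>p\<in>{p \<in> T. p \<subseteq> S}. \<Prod>\<sigma>\<in>p. 1 / h \<sigma>)"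
        unfolding w_def using finT by (simp add: prod.inter_filter)
      also have "\<dots> = (\<Prod>\<sigma>\<in>S. 1 / h \<sigma>)"
        unfolding T_def by (rule prod_over_places[OF S(1) Scnj fin, symmetric])
      finally show ?thesis .
    qed
    also have "ennreal C1 * (ennreal (K0 ^ card T * (\<Prod>\<sigma>\<in>S. 1 / h \<sigma>)) * emeasure lborel (ball (0 :: (real^'k)^'n) (R + card T * \<rho>))) =
        ennreal (C * (\<Prod>\<sigma>\<in>S. 1 / h \<sigma>))"
    proof -
      have "0 \<le> K0 ^ card T" "0 \<le> (\<Prod>\<sigma>\<in>S. 1 / h \<sigma>)"
        using K0 hpos by (auto intro!: prod_nonneg simp: less_imp_le)
      then show ?thesis unfolding vol(1) C_def using C1(1) vol(2)
        by (simp add: ennreal_mult[symmetric] mult_ac)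
    qed
    also have "\<dots> = ennreal C * inverse (H_prod \<omega> \<psi> f S)"
    proof -
      have "H_prod \<omega> \<psi> f S = ennreal (\<Prod>\<sigma>\<in>S. h \<sigma>)"
        unfolding H_prod_def Hh using hpos by (intro prod_ennreal) (auto simp: less_imp_le)
      moreover have "(\<Prod>\<sigma>\<in>S. h \<sigma>) > 0" using hpos by (intro prod_pos) auto
      ultimately have "inverse (H_prod \<omega> \<psi> f S) = ennreal (\<Prod>\<sigma>\<in>S. 1 / h \<sigma>)"
        by (simp add: inverse_ennreal prod_dividef inverse_eq_divide)
      then show ?thesis using \<open>C \<ge> 0\<close> by (simp add: ennreal_mult')
    qed
    finally show ?thesis .
  qed
  ultimately show ?thesis by (intro exI[of _ C]) auto
qed

end
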